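(* Assume the following. (Dyadic dependence) For any two disjoint index sets $S_1,S_2\subset\{1,\dots,N\}$, the families $\{(\mathbf{x}_n,u_n)\}_{n\in S_1}$ and $\{(\mathbf{x}_m,u_m)\}_{m\in S_2}$ are independent whenever $\psi(n)\cap\psi(m)=\emptyset$ for every $n\in S_1$ and $m\in S_2$. (Bounded support) There are finite constants $C_x,C_u$ with $\|\mathbf{x}_n\|\le C_x$ and $|u_n|\le C_u$ almost surely for all $n$ and $N$. (Identification) $\mathbb{E}[\mathbf{x}_nu_n]=\mathbf{0}$ for all $n$, and there is a constant $c_Q$ with $\lambda_{\min}(Q_N)\ge c_Q>0$ for all $N$. (Variance accumulation) $\Omega_N$ is positive definite and $\delta_N:=N(\mathcal{M}^{H})^{3}/\lambda_{\min}(\Omega_N)^{2}\to0$. (Configuration) $K$ is fixed and $\mathcal{M}^{L}\ge1$ as $G\to\infty$. Let $\{R_N\}$ be an arbitrary sequence of nonrandom $K\times q$ matrices of full column rank $q\le K$, and write $\mathcal{V}_N:=R_N'V_NR_N$ and $\widehat{\mathcal{V}}^{J}_N:=R_N'\widehat{V}^{J}R_N$. Then there is a sequence of random variables $\varepsilon_N=o_p(1)$, not depending on $R_N$, such that $$\lambda_{\min}\big(\mathcal{V}_N^{-1/2}\widehat{\mathcal{V}}^{J}_N\mathcal{V}_N^{-1/2}\big)\ge1-\varepsilon_N .$$ Consequently, with $W^{J}_N:=(R_N'\widehat{\boldsymbol{\beta}}-\mathbf{r})'(\widehat{\mathcal{V}}^{J}_N)^{-1}(R_N'\widehat{\boldsymbol{\beta}}-\mathbf{r})$,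 for every $\gamma\in(0,1)$, $$\limsup_{G\to\infty}\mathbb{P}\big(W^{J}_N>\chi^2_{q,1-\gamma}\big)\le\gamma\qquad\text{under }H_0:R_N'\boldsymbol{\beta}=\mathbf{r}.$$
   Context: Setting. Units are indexed $g=1,\dots,G$ and all limits are as $G\to\infty$. For each $G$ there are observations $n=1,\dots,N$, $N=N_G$. Each observation carries a nonrandom support (its dyad) $\psi(n)\subset\{1,\dots,G\}$ with $|\psi(n)|=2$; $\psi$ need not be injective. Everything may form a triangular array (the configuration and the joint law of the data may change with $G$). Put $M_g:=\#\{n:g\in\psi(n)\}$, $\mathcal{M}^{H}:=\max_gM_g$, $\mathcal{M}^{L}:=\min_gM_g$. Model: $y_n=\boldsymbol{\beta}'\mathbf{x}_n+u_n$, with $\mathbf{x}_n\in\mathbb{R}^K$ and $u_n\in\mathbb{R}$ random and $\boldsymbol\beta\in\mathbb{R}^K$. Define $S_N:=\sum_n\mathbf{x}_nu_n$, $\Omega_N:=\operatorname{Var}(S_N)$, $Q_N:=N^{-1}\sum_n\mathbb{E}[\mathbf{x}_n\mathbf{x}_n']$, and $V_N:=N^{-2}Q_N^{-1}\Omega_NQ_N^{-1}$. Estimators: let $A:=\sum_n\mathbf{x}_n\mathbf{x}_n'$. If $A$ is invertible, $\widehat{\boldsymbol{\beta}}:=A^{-1}\sum_n\mathbf{x}_ny_n$; otherwise $\widehat{\boldsymbol{\beta}}:=\mathbf{0}$. Let $\mathcal{N}_g:=\{n:g\in\psi(n)\}$, $A_g:=\sum_{n\in\mathcal{N}_g}\mathbf{x}_n\mathbf{x}_n'$,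 $A_{(g)}:=A-A_g$, and let $\mathcal{E}^{J}_N$ be the event that every $A_{(g)}$, $g=1,\dots,G$, is invertible. On $\mathcal{E}^{J}_N$ set $\widehat{\boldsymbol{\beta}}_{(g)}:=A_{(g)}^{-1}\sum_{n\notin\mathcal{N}_g}\mathbf{x}_ny_n$, $\bar{\boldsymbol{\beta}}:=G^{-1}\sum_g\widehat{\boldsymbol{\beta}}_{(g)}$, and $$\widehat{V}^{J}:=\frac{G-1}{G}\sum_{g=1}^G\big(\widehat{\boldsymbol{\beta}}_{(g)}-\bar{\boldsymbol{\beta}}\big)\big(\widehat{\boldsymbol{\beta}}_{(g)}-\bar{\boldsymbol{\beta}}\big)',$$ with $\widehat{V}^{J}:=\mathbf{0}$ on $(\mathcal{E}^{J}_N)^c$. The statistic $W^{J}_N$ is set to $0$ whenever $\widehat{\mathcal{V}}^{J}_N$ is singular. Notation: $\lambda_{\min}$ is the smallest eigenvalue; $\|\cdot\|$ is the Euclidean norm for vectors and the spectral norm for matrices; for symmetric positive definite $B$, $B^{1/2}$ is the symmetric square root and $B^{-1/2}:=(B^{1/2})^{-1}$; $\chi^2_{q,1-\gamma}$ is the $(1-\gamma)$-quantile of the $\chi^2_q$ distribution. *)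

theory Defs
  imports "HOL-Probability.Probability"
begin

definition outer :: "real^'n \<Rightarrow> real^'m \<Rightarrow> real^'m^'n" where
  "outer v w = (\<chi> i j. v $ i * w $ j)"

definition pos_def :: "real^'n^'n \<Rightarrow> bool" where
  "pos_def A \<longleftrightarrow> transpose A = A \<and> (\<forall>v. v \<noteq> 0 \<longrightarrow> v \<bullet> (A *v v) > 0)"

definition real_eigenvalues :: "real^'n^'n \<Rightarrow> real set" where
  "real_eigenvalues A = {l. \<exists>v. v \<noteq> 0 \<and> A *v v = l *\<^sub>R v}"

text \<open>Only meaningful for symmetric matrices, whose set of real eigenvalues is finite and nonempty.\<close>

definition lambda_min :: "real^'n^'n \<Rightarrow> real" where
  "lambda_min A = Min (real_eigenvalues A)"

text \<open>Only meaningful for positive definite \<open>B\<close>, which has exactly one positive definite square root.\<close>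

definition mat_sqrt :: "real^'n^'n \<Rightarrow> real^'n^'n" where
  "mat_sqrt B = (THE S. pos_def S \<and> S ** S = B)"

definition mat_inv_sqrt :: "real^'n^'n \<Rightarrow> real^'n^'n" where
  "mat_inv_sqrt B = matrix_inv (mat_sqrt B)"

definition cov_matrix :: "'a measure \<Rightarrow> ('a \<Rightarrow> real^'n) \<Rightarrow> real^'n^'n" where
  "cov_matrix M X =
     (let m = integral\<^sup>L M X in integral\<^sup>L M (\<lambda>\<omega>. outer (X \<omega> - m) (X \<omega> - m)))"

text \<open>\<open>Z G = o_p(1)\<close> as \<open>G \<rightarrow> \<infinity>\<close>, where the probability space may change with \<open>G\<close>.\<close>

definition small_o_p_one :: "(nat \<Rightarrow> 'a measure) \<Rightarrow> (nat \<Rightarrow> 'a \<Rightarrow> real) \<Rightarrow> bool" where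
  "small_o_p_one M Z \<longleftrightarrow>
     (\<forall>\<eta>>0. (\<lambda>G. measure (M G) {\<omega> \<in> space (M G). \<bar>Z G \<omega>\<bar> > \<eta>}) \<longlonglongrightarrow> 0)"

definition chi_square :: "nat \<Rightarrow> real measure" where
  "chi_square q =
     distr (Pi\<^sub>M {..<q} (\<lambda>_. density lborel (\<lambda>t. ennreal (std_normal_density t)))) borel
       (\<lambda>z. \<Sum>i<q. (z i)\<^sup>2)"

definition chi_square_quantile :: "nat \<Rightarrow> real \<Rightarrow> real" where
  "chi_square_quantile q p = Inf {t. p \<le> cdf (chi_square q) t}"

text \<open>Units are \<open>1, \<dots>, G\<close> and observations \<open>1, \<dots>, N\<close>; \<open>\<psi> n\<close> is the support of
  observation \<open>n\<close>.\<close>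

definition obs_of :: "nat \<Rightarrow> (nat \<Rightarrow> nat set) \<Rightarrow> nat \<Rightarrow> nat set" where
  "obs_of N \<psi> g = {n \<in> {1..N}. g \<in> \<psi> n}"

definition unit_degree :: "nat \<Rightarrow> (nat \<Rightarrow> nat set) \<Rightarrow> nat \<Rightarrow> nat" where
  "unit_degree N \<psi> g = card (obs_of N \<psi> g)"

definition max_degree :: "nat \<Rightarrow> nat \<Rightarrow> (nat \<Rightarrow> nat set) \<Rightarrow> nat" where
  "max_degree G N \<psi> = Max (unit_degree N \<psi> ` {1..G})"

definition min_degree :: "nat \<Rightarrow> nat \<Rightarrow> (nat \<Rightarrow> nat set) \<Rightarrow> nat" where
  "min_degree G N \<psi> = Min (unit_degree N \<psi> ` {1..G})"

definition score_sum :: "nat \<Rightarrow> (nat \<Rightarrow> 'a \<Rightarrow> real^'k) \<Rightarrow> (nat \<Rightarrow> 'a \<Rightarrow> real) \<Rightarrow> 'a \<Rightarrow> real^'k" where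
  "score_sum N x u \<omega> = (\<Sum>n\<in>{1..N}. u n \<omega> *\<^sub>R x n \<omega>)"

definition Omega_mat ::
  "'a measure \<Rightarrow> nat \<Rightarrow> (nat \<Rightarrow> 'a \<Rightarrow> real^'k) \<Rightarrow> (nat \<Rightarrow> 'a \<Rightarrow> real) \<Rightarrow> real^'k^'k" where
  "Omega_mat M N x u = cov_matrix M (score_sum N x u)"

definition Q_mat :: "'a measure \<Rightarrow> nat \<Rightarrow> (nat \<Rightarrow> 'a \<Rightarrow> real^'k) \<Rightarrow> real^'k^'k" where
  "Q_mat M N x = (1 / real N) *\<^sub>R (\<Sum>n\<in>{1..N}. integral\<^sup>L M (\<lambda>\<omega>. outer (x n \<omega>) (x n \<omega>)))"

definition V_mat ::
  "'a measure \<Rightarrow> nat \<Rightarrow> (nat \<Rightarrow> 'a \<Rightarrow> real^'k) \<Rightarrow> (nat \<Rightarrow> 'a \<Rightarrow> real) \<Rightarrow> real^'k^'k" where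
  "V_mat M N x u = (1 / (real N)\<^sup>2) *\<^sub>R
     (matrix_inv (Q_mat M N x) ** Omega_mat M N x u ** matrix_inv (Q_mat M N x))"

text \<open>The estimators are functions of realised data \<open>X n\<close>, \<open>Y n\<close>.\<close>

definition gram :: "(nat \<Rightarrow> real^'k) \<Rightarrow> nat set \<Rightarrow> real^'k^'k" where
  "gram X S = (\<Sum>n\<in>S. outer (X n) (X n))"

definition cross :: "(nat \<Rightarrow> real^'k) \<Rightarrow> (nat \<Rightarrow> real) \<Rightarrow> nat set \<Rightarrow> real^'k" where
  "cross X Y S = (\<Sum>n\<in>S. Y n *\<^sub>R X n)"

definition ols :: "nat \<Rightarrow> (nat \<Rightarrow> real^'k) \<Rightarrow> (nat \<Rightarrow> real) \<Rightarrow> real^'k" where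
  "ols N X Y =
     (if invertible (gram X {1..N}) then matrix_inv (gram X {1..N}) *v cross X Y {1..N} else 0)"

definition loo_gram :: "nat \<Rightarrow> (nat \<Rightarrow> nat set) \<Rightarrow> (nat \<Rightarrow> real^'k) \<Rightarrow> nat \<Rightarrow> real^'k^'k" where
  "loo_gram N \<psi> X g = gram X {1..N} - gram X (obs_of N \<psi> g)"

definition loo_ols ::
  "nat \<Rightarrow> (nat \<Rightarrow> nat set) \<Rightarrow> (nat \<Rightarrow> real^'k) \<Rightarrow> (nat \<Rightarrow> real) \<Rightarrow> nat \<Rightarrow> real^'k" where
  "loo_ols N \<psi> X Y g = matrix_inv (loo_gram N \<psi> X g) *v cross X Y ({1..N} - obs_of N \<psi> g)"

definition loo_mean ::
  "nat \<Rightarrow> nat \<Rightarrow> (nat \<Rightarrow> nat set) \<Rightarrow> (nat \<Rightarrow> real^'k) \<Rightarrow> (nat \<Rightarrow> real) \<Rightarrow> real^'k" where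
  "loo_mean G N \<psi> X Y = (1 / real G) *\<^sub>R (\<Sum>g\<in>{1..G}. loo_ols N \<psi> X Y g)"

definition jackknife_var ::
  "nat \<Rightarrow> nat \<Rightarrow> (nat \<Rightarrow> nat set) \<Rightarrow> (nat \<Rightarrow> real^'k) \<Rightarrow> (nat \<Rightarrow> real) \<Rightarrow> real^'k^'k" where
  "jackknife_var G N \<psi> X Y =
     (if \<forall>g\<in>{1..G}. invertible (loo_gram N \<psi> X g)
      then ((real G - 1) / real G) *\<^sub>R
        (\<Sum>g\<in>{1..G}. outer (loo_ols N \<psi> X Y g - loo_mean G N \<psi> X Y)
                          (loo_ols N \<psi> X Y g - loo_mean G N \<psi> X Y))
      else 0)"

definition sandwich :: "real^'q^'k \<Rightarrow> real^'k^'k \<Rightarrow> real^'q^'q" where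
  "sandwich R V = transpose R ** V ** R"

definition wald :: "real^'q^'k \<Rightarrow> real^'q \<Rightarrow> real^'k \<Rightarrow> real^'k^'k \<Rightarrow> real" where
  "wald R r b V =
     (if invertible (sandwich R V)
      then (transpose R *v b - r) \<bullet> (matrix_inv (sandwich R V) *v (transpose R *v b - r))
      else 0)"

end

(* The jackknife is conservative because sum_g S_g S_g', with S_g the score of unit g, counts each
   linked pair of observations once per shared unit: its mean exceeds Omega by a sum of squares over
   the distinct dyads, and its fluctuation has variance O(N M^3), that is o(lambda_min(Omega)^2).
   Replacing S_g by the actual leave-one-out deviations costs a relative error O(M / sqrt(lambda_min(Omega))) in l2.

   The rate N M^3 / lambda_min^2 -> 0 is too weak for the usual third-moment Stein bound.  Leaving
   out dependency neighbourhoods to third order gives, for the normalised score W and complex z,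
   E[W e^(zW)] = (z + kappa z^2) E[e^(zW)] + O(N M^3 / lambda_min^2) E[e^(Re(z) W)] with a real
   number kappa.  For real z, convexity of the logarithm of the moment generating function forces
   kappa -> 0; for z = i t the relation is then a differential equation for the characteristic
   function that yields asymptotic normality.  The norm of the standardised estimator is handled
   through its Laplace transform, a Gaussian average of characteristic functions. *)

theory Submission
  imports Defs
begin

section \<open>Symmetric matrices\<close>

text \<open>Why the third order: standardised scores have size a ~ 1 / sqrt(lambda_min), and each
  further observation taken from a neighbourhood costs a factor D a with D = 2 M. The third-moment
  term is thus only bounded by N D^2 a^3, which exceeds the available rate N D^3 a^4 by the
  diverging factor 1 / (D a). It cannot be discarded by size, but its coefficient is the same number
  for all z, so information gained at real z can be spent at z = i t.

  The single rate controls everything else: M <= N turns it into M / sqrt(lambda_min) -> 0, and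
  lambda_min = O(N M) turns it into M / N -> 0, which keeps every leave-one-out Gram matrix near its
  mean.

  Uniformity in R comes from comparing the quadratic forms at every v before inserting v = R z. The
  error variable equals 1 off a good event, where the jackknife form is merely nonnegative. The
  almost sure bounds are made sure by truncating each observation separately, which leaves the
  dependence structure intact.\<close>

lemma inner_matrix_transpose:
  fixes A :: "real^'n^'m"
  shows "x \<bullet> (A *v y) = (transpose A *v x) \<bullet> y"
  by (simp add: dot_lmul_matrix)

lemma symmetric_matrixD:
  fixes A :: "real^'n^'n"
  assumes "transpose A = A"
  shows "(A *v x) \<bullet> y = x \<bullet> (A *v y)"
  using inner_matrix_transpose[of x A y] assms by metis

text \<open>\<open>norm\<close> on the nested vector type is the Frobenius norm, which dominates the
  spectral norm. The matrix perturbation bounds below are therefore all stated in it.\<close>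

lemma norm_matrix_vector_le:
  fixes A :: "real^'n^'m"
  shows "norm (A *v x) \<le> norm A * norm x"
proof -
  have "(norm (A *v x))\<^sup>2 = (\<Sum>i\<in>UNIV. (A$i \<bullet> x)\<^sup>2)"
    by (simp add: norm_vec_def L2_set_def sum_nonneg matrix_vector_mul_component)
  also have "\<dots> \<le> (\<Sum>i\<in>UNIV. (norm (A$i))\<^sup>2 * (norm x)\<^sup>2)"
  proof (rule sum_mono)
    fix i
    show "(A$i \<bullet> x)\<^sup>2 \<le> (norm (A$i))\<^sup>2 * (norm x)\<^sup>2"
      using Cauchy_Schwarz_ineq2[of "A$i" x] by (metis abs_ge_zero power2_abs power_mono power_mult_distrib)
  qed
  also have "\<dots> = (norm A)\<^sup>2 * (norm x)\<^sup>2"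
    by (simp add: norm_vec_def[of A] L2_set_def sum_nonneg sum_distrib_right)
  also have "\<dots> = (norm A * norm x)\<^sup>2"
    by (simp add: power_mult_distrib)
  finally show ?thesis
    by (rule power2_le_imp_le) simp
qed

lemma norm_matrix_sq:
  fixes A :: "real^'n^'m"
  shows "(norm A)\<^sup>2 = (\<Sum>i\<in>UNIV. \<Sum>j\<in>UNIV. (A$i$j)\<^sup>2)"
  by (simp add: norm_vec_def L2_set_def sum_nonneg)

lemma outer_mult_vector: "outer v w *v z = (w \<bullet> z) *\<^sub>R v"
  by (simp add: vec_eq_iff outer_def matrix_vector_mult_def inner_vec_def sum_distrib_left
      sum_distrib_right mult_ac)

lemma transpose_outer: "transpose (outer v w) = outer w v"
  by (simp add: vec_eq_iff outer_def transpose_def mult.commute)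

lemma norm_outer: "norm (outer v w) = norm v * norm w"
proof -
  have "(norm (outer v w))\<^sup>2 = (norm v * norm w)\<^sup>2"
    unfolding norm_matrix_sq power_mult_distrib
    by (simp add: outer_def norm_vec_def L2_set_def sum_nonneg sum_product power_mult_distrib)
  then show ?thesis
    by (simp add: power2_eq_iff_nonneg)
qed

lemma matrix_sum_mult_vector: "(\<Sum>i\<in>I. A i) *v x = (\<Sum>i\<in>I. A i *v x)"
  for A :: "'i \<Rightarrow> real^'n^'m"
  by (induction I rule: infinite_finite_induct) (auto simp: matrix_vector_mult_add_rdistrib)

lemma matrix_vector_mult_sum: "A *v (\<Sum>i\<in>I. x i) = (\<Sum>i\<in>I. A *v x i)"
  for A :: "real^'n^'m"
  by (induction I rule: infinite_finite_induct) (auto simp: matrix_vector_right_distrib)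

lemma transpose_sum: "transpose (\<Sum>i\<in>I. A i) = (\<Sum>i\<in>I. transpose (A i))"
  for A :: "'i \<Rightarrow> real^'n^'m"
  by (simp add: vec_eq_iff transpose_def)

lemma transpose_diff: "transpose (A - B) = transpose A - transpose B"
  for A :: "real^'n^'m"
  by (simp add: vec_eq_iff transpose_def)

subsection \<open>Inverses and positive definite matrices\<close>

lemma matrix_inv_mult:
  fixes A :: "real^'n^'n"
  assumes "invertible A"
  shows "A ** matrix_inv A = mat 1" "matrix_inv A ** A = mat 1"
proof -
  have "A ** matrix_inv A = mat 1 \<and> matrix_inv A ** A = mat 1"
    using assms unfolding invertible_def matrix_inv_def by (rule someI_ex)
  then show "A ** matrix_inv A = mat 1" "matrix_inv A ** A = mat 1"
    by auto
qed

lemma matrix_inv_mult_vector: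
  fixes A :: "real^'n^'n"
  assumes "invertible A"
  shows "A *v (matrix_inv A *v x) = x" "matrix_inv A *v (A *v x) = x"
  using matrix_inv_mult[OF assms] by (simp_all add: matrix_vector_mul_assoc)

lemma matrix_inv_eqI:
  fixes A :: "real^'n^'n"
  assumes "A ** B = mat 1"
  shows "matrix_inv A = B"
proof -
  have inv: "invertible A"
    using assms invertible_right_inverse by blast
  have "matrix_inv A = matrix_inv A ** (A ** B)"
    by (simp add: assms)
  also have "\<dots> = B"
    by (simp add: matrix_mul_assoc matrix_inv_mult[OF inv])
  finally show ?thesis .
qed

lemma invertible_if_kernel_trivial:
  fixes A :: "real^'n^'n"
  assumes "\<And>v. A *v v = 0 \<Longrightarrow> v = 0"
  shows "invertible A"
  using assms matrix_left_invertible_ker[of A] invertible_left_inverse by blast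

lemma transpose_matrix_inv:
  fixes A :: "real^'n^'n"
  assumes "invertible A" "transpose A = A"
  shows "transpose (matrix_inv A) = matrix_inv A"
proof -
  have "A ** transpose (matrix_inv A) = transpose (matrix_inv A ** A)"
    by (simp add: matrix_transpose_mul assms)
  then have "A ** transpose (matrix_inv A) = mat 1"
    by (simp add: matrix_inv_mult[OF assms(1)])
  then show ?thesis
    using matrix_inv_eqI by metis
qed

text \<open>Coercivity is the form in which invertibility is tracked: it survives small
  perturbations of the matrix and bounds the inverse by \<open>1 / c\<close>.\<close>

lemma coercive_imp_invertible:
  fixes A :: "real^'n^'n"
  assumes "c > 0" "\<And>v. c * (norm v)\<^sup>2 \<le> v \<bullet> (A *v v)"
  shows "invertible A"
proof (rule invertible_if_kernel_trivial)
  fix v assume "A *v v = 0"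
  with assms(2)[of v] have "c * (norm v)\<^sup>2 \<le> 0"
    by simp
  with \<open>c > 0\<close> show "v = 0"
    by (simp add: mult_le_0_iff)
qed

lemma coercive_norm_inv_le:
  fixes A :: "real^'n^'n"
  assumes "c > 0" "\<And>v. c * (norm v)\<^sup>2 \<le> v \<bullet> (A *v v)"
  shows "norm (matrix_inv A *v y) \<le> norm y / c"
proof -
  define v where "v = matrix_inv A *v y"
  have "A *v v = y"
    unfolding v_def by (rule matrix_inv_mult_vector(1)[OF coercive_imp_invertible[OF assms]])
  then have "c * (norm v)\<^sup>2 \<le> norm v * norm y"
    using assms(2)[of v] Cauchy_Schwarz_ineq2[of v y] by simp
  then have "c * norm v \<le> norm y"
    by (cases "v = 0") (auto simp: power2_eq_square)
  then show ?thesis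
    unfolding v_def[symmetric] using \<open>c > 0\<close> by (simp add: field_simps)
qed

lemma pos_defD:
  assumes "pos_def A"
  shows "transpose A = A" "v \<noteq> 0 \<Longrightarrow> v \<bullet> (A *v v) > 0" "v \<bullet> (A *v v) \<ge> 0"
  using assms unfolding pos_def_def by (auto simp: less_imp_le) (cases "v = 0"; force simp: less_imp_le)

lemma pos_def_invertible:
  assumes "pos_def A"
  shows "invertible A"
  by (rule invertible_if_kernel_trivial) (metis assms inner_zero_right less_irrefl pos_defD(2))

lemma pos_def_matrix_inv:
  fixes A :: "real^'n^'n"
  assumes "pos_def A"
  shows "pos_def (matrix_inv A)"
  unfolding pos_def_def
proof (intro conjI allI impI)
  note inv = pos_def_invertible[OF assms]
  show "transpose (matrix_inv A) = matrix_inv A"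
    using transpose_matrix_inv[OF inv] pos_defD(1)[OF assms] by blast
  fix v :: "real^'n" assume "v \<noteq> 0"
  define w where "w = matrix_inv A *v v"
  have Aw: "A *v w = v"
    by (simp add: w_def matrix_inv_mult_vector(1)[OF inv])
  with \<open>v \<noteq> 0\<close> have "w \<noteq> 0"
    by auto
  from pos_defD(2)[OF assms this] show "v \<bullet> (matrix_inv A *v v) > 0"
    by (simp add: Aw w_def[symmetric] inner_commute)
qed

subsection \<open>Rayleigh quotients and the spectral theorem\<close>

text \<open>An invariant subspace is allowed so that the lemma serves twice: with
  \<open>UNIV\<close> for \<open>lambda_min\<close>, and with an orthogonal complement for extending
  a set of eigenvectors. The minimum is attained by compactness of the unit sphere in
  \<open>W\<close>; stationarity is tested along the residual
  \<open>z = A *v v - l *\<^sub>R v\<close>, which stays in \<open>W\<close>.\<close>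

lemma rayleigh_minimizer_is_eigenvector:
  fixes A :: "real^'n^'n"
  assumes sym: "transpose A = A" and W: "subspace W" "W \<noteq> {0}"
    and inv: "\<And>w. w \<in> W \<Longrightarrow> A *v w \<in> W"
  obtains l v where "v \<in> W" "norm v = 1" "A *v v = l *\<^sub>R v"
    "\<And>w. w \<in> W \<Longrightarrow> l * (norm w)\<^sup>2 \<le> w \<bullet> (A *v w)"
proof -
  obtain w0 where w0: "w0 \<in> W" "w0 \<noteq> 0"
    using W subspace_0 by blast
  have "compact (sphere 0 1 \<inter> W)"
    using closed_subspace[OF W(1)] by (intro compact_Int_closed) auto
  moreover have "(1 / norm w0) *\<^sub>R w0 \<in> sphere 0 1 \<inter> W"
    using w0 W(1) by (auto simp: subspace_scale)
  moreover have "continuous_on (sphere 0 1 \<inter> W) (\<lambda>v. v \<bullet> (A *v v))"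
    by (intro continuous_intros linear_continuous_on linear_linear[THEN iffD2]) auto
  ultimately obtain v where v: "v \<in> sphere 0 1 \<inter> W"
    and min: "\<And>w. w \<in> sphere 0 1 \<inter> W \<Longrightarrow> v \<bullet> (A *v v) \<le> w \<bullet> (A *v w)"
    using continuous_attains_inf[of "sphere 0 1 \<inter> W" "\<lambda>v. v \<bullet> (A *v v)"] by blast
  define l where "l = v \<bullet> (A *v v)"
  have ge: "l * (norm w)\<^sup>2 \<le> w \<bullet> (A *v w)" if "w \<in> W" for w
  proof (cases "w = 0")
    case False
    let ?u = "(1 / norm w) *\<^sub>R w"
    have "?u \<in> sphere 0 1 \<inter> W"
      using that W(1) False by (auto simp: subspace_scale)
    then have "l \<le> ?u \<bullet> (A *v ?u)"
      unfolding l_def by (rule min)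
    also have "\<dots> = (w \<bullet> (A *v w)) / (norm w)\<^sup>2"
      by (simp add: matrix_vector_mult_scaleR power2_eq_square)
    finally show ?thesis
      using False by (simp add: field_simps)
  qed auto
  define z where "z = A *v v - l *\<^sub>R v"
  have vW: "v \<in> W" and nv: "norm v = 1"
    using v by auto
  have zW: "z \<in> W"
    unfolding z_def using vW W(1) inv by (simp add: subspace_diff subspace_scale)
  have vv: "v \<bullet> v = 1"
    using nv by (simp add: norm_eq_1)
  define q where "q = z \<bullet> (A *v z) - l * (z \<bullet> z)"
  \<comment> \<open>The quadratic polynomial is the Rayleigh defect at the point v + t z. Being
    nonnegative for all t, it cannot have a nonzero linear coefficient.\<close>
  have key: "0 \<le> 2 * t * (z \<bullet> z) + t\<^sup>2 * q" for t
  proof -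
    have "v + t *\<^sub>R z \<in> W"
      using vW zW W(1) by (simp add: subspace_add subspace_scale)
    from ge[OF this] have le: "l * ((v + t *\<^sub>R z) \<bullet> (v + t *\<^sub>R z)) \<le> (v + t *\<^sub>R z) \<bullet> (A *v (v + t *\<^sub>R z))"
      by (simp add: power2_norm_eq_inner)
    moreover have "v \<bullet> (A *v z) = z \<bullet> (A *v v)"
      using symmetric_matrixD[OF sym, of v z] by (simp add: inner_commute)
    moreover have "z \<bullet> (A *v v) = z \<bullet> z + l * (z \<bullet> v)"
      by (subst (3) z_def) (simp add: inner_diff_right)
    ultimately have "2 * t * (z \<bullet> z) + t\<^sup>2 * q =
        (v + t *\<^sub>R z) \<bullet> (A *v (v + t *\<^sub>R z)) - l * ((v + t *\<^sub>R z) \<bullet> (v + t *\<^sub>R z))"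
      by (simp add: q_def matrix_vector_right_distrib matrix_vector_mult_scaleR inner_add_left
          inner_add_right l_def[symmetric] vv inner_commute[of v z] power2_eq_square algebra_simps)
    with le show ?thesis
      by linarith
  qed
  have "z \<bullet> z = 0"
  proof (rule ccontr)
    assume "z \<bullet> z \<noteq> 0"
    then have pos: "z \<bullet> z > 0"
      by (simp add: less_le)
    \<comment> \<open>The \<open>+ 1\<close> keeps the denominator positive. At this t the negative
      linear term is at least twice the quadratic one.\<close>
    define t where "t = - (z \<bullet> z) / (\<bar>q\<bar> + 1)"
    have "t\<^sup>2 * q \<le> t\<^sup>2 * (\<bar>q\<bar> + 1)"
      by (intro mult_left_mono) auto
    also have "\<dots> = - t * (z \<bullet> z)"
      by (simp add: t_def power2_eq_square)
    finally have "2 * t * (z \<bullet> z) + t\<^sup>2 * q \<le> t * (z \<bullet> z)"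
      by simp
    moreover have "t * (z \<bullet> z) < 0"
      using pos by (intro mult_neg_pos) (auto simp: t_def field_simps)
    ultimately show False
      using key[of t] by simp
  qed
  then have "A *v v = l *\<^sub>R v"
    by (simp add: z_def)
  with that vW nv ge show ?thesis by blast
qed

text \<open>Eigenvectors for distinct eigenvalues are orthogonal, hence independent. Finiteness is
  what gives \<open>Min\<close> in \<open>lambda_min\<close> a meaning.\<close>

lemma finite_real_eigenvalues:
  fixes A :: "real^'n^'n"
  assumes sym: "transpose A = A"
  shows "finite (real_eigenvalues A)"
proof -
  have "\<forall>l\<in>real_eigenvalues A. \<exists>v. v \<noteq> 0 \<and> A *v v = l *\<^sub>R v"
    by (auto simp: real_eigenvalues_def)
  then obtain f where f: "\<And>l. l \<in> real_eigenvalues A \<Longrightarrow> f l \<noteq> 0 \<and> A *v f l = l *\<^sub>R f l"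
    by metis
  have orth: "f l \<bullet> f m = 0" if "l \<in> real_eigenvalues A" "m \<in> real_eigenvalues A" "l \<noteq> m" for l m
    using symmetric_matrixD[OF sym, of "f l" "f m"] f that by simp
  have inj: "inj_on f (real_eigenvalues A)"
    by (rule inj_onI) (metis f inner_eq_zero_iff orth)
  have "pairwise orthogonal (f ` real_eigenvalues A)"
    unfolding pairwise_def orthogonal_def using orth by (metis imageE)
  then have "independent (f ` real_eigenvalues A)"
    by (rule pairwise_orthogonal_independent) (use f in auto)
  then have "finite (f ` real_eigenvalues A)"
    by (rule independent_imp_finite)
  then show ?thesis
    using inj by (rule finite_imageD)
qed

text \<open>Trades the eigenvalue definition for the variational one: \<open>lambda_min\<close> is
  the largest constant below the Rayleigh quotient. Later proofs use it only in this form.\<close>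

lemma lambda_min_rayleigh:
  fixes A :: "real^'n^'n"
  assumes sym: "transpose A = A"
  shows "lambda_min A * (norm v)\<^sup>2 \<le> v \<bullet> (A *v v)"
    and "\<And>c. (\<And>w. c * (norm w)\<^sup>2 \<le> w \<bullet> (A *v w)) \<Longrightarrow> c \<le> lambda_min A"
proof -
  have UNIV_nontrivial: "(UNIV :: (real^'n) set) \<noteq> {0}"
    by (metis UNIV_I axis_eq_0_iff singletonD zero_neq_one)
  obtain l z where z: "norm z = 1" "A *v z = l *\<^sub>R z"
    and ge: "\<And>w. l * (norm w)\<^sup>2 \<le> w \<bullet> (A *v w)"
    by (rule rayleigh_minimizer_is_eigenvector[OF sym, of UNIV]) (use UNIV_nontrivial in auto)
  have "lambda_min A = l"
    unfolding lambda_min_def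
  proof (rule Min_eqI[OF finite_real_eigenvalues[OF sym]])
    fix m assume "m \<in> real_eigenvalues A"
    then obtain w where w: "w \<noteq> 0" "A *v w = m *\<^sub>R w"
      by (auto simp: real_eigenvalues_def)
    then show "m \<ge> l"
      using ge[of w] by (simp add: power2_norm_eq_inner)
  next
    show "l \<in> real_eigenvalues A"
      unfolding real_eigenvalues_def mem_Collect_eq by (rule exI[of _ z]) (use z in auto)
  qed
  then show "lambda_min A * (norm v)\<^sup>2 \<le> v \<bullet> (A *v v)"
    using ge by simp
  fix c assume "\<And>w. c * (norm w)\<^sup>2 \<le> w \<bullet> (A *v w)"
  from this[of z] show "c \<le> lambda_min A"
    using z \<open>lambda_min A = l\<close> by (simp flip: power2_norm_eq_inner)
qed

lemma pos_def_lambda_min_pos: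
  fixes A :: "real^'n^'n"
  assumes "pos_def A"
  shows "lambda_min A > 0"
proof -
  have "(UNIV :: (real^'n) set) \<noteq> {0}"
    by (metis UNIV_I axis_eq_0_iff singletonD zero_neq_one)
  then obtain l z where z: "norm z = 1" "A *v z = l *\<^sub>R z"
    and ge: "\<And>w. l * (norm w)\<^sup>2 \<le> w \<bullet> (A *v w)"
    by (rule rayleigh_minimizer_is_eigenvector[OF pos_defD(1)[OF assms], of UNIV, rotated 1]) auto
  have "0 < z \<bullet> (A *v z)"
    using z by (intro pos_defD(2)[OF assms]) auto
  then have "l > 0"
    using z by (simp flip: power2_norm_eq_inner)
  also have "l \<le> lambda_min A"
    by (rule lambda_min_rayleigh(2)[OF pos_defD(1)[OF assms] ge])
  finally show ?thesis .
qed

text \<open>An orthonormal set of eigenvectors of maximal size must span: its orthogonal complement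
  is invariant under a symmetric matrix, and if nontrivial would supply one more unit
  eigenvector.\<close>

lemma orthonormal_eigenbasis:
  fixes A :: "real^'n^'n"
  assumes sym: "transpose A = A"
  obtains B f where "finite B" "pairwise orthogonal B" "\<And>b. b \<in> B \<Longrightarrow> norm b = 1"
    "\<And>b. b \<in> B \<Longrightarrow> A *v b = f b *\<^sub>R b" "span B = (UNIV :: (real^'n) set)"
proof -
  define P where "P B \<longleftrightarrow> pairwise orthogonal B \<and> (\<forall>b\<in>B. norm b = 1 \<and> (\<exists>l. A *v b = l *\<^sub>R b))"
    for B :: "(real^'n) set"
  have P_indep: "independent B" if "P B" for B
    using that unfolding P_def by (intro pairwise_orthogonal_independent) auto
  have "P {}"
    by (simp add: P_def)
  moreover have "\<forall>B. P B \<longrightarrow> card B < Suc (DIM(real^'n))"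
    using P_indep independent_bound by (metis less_Suc_eq_le)
  ultimately obtain B where B: "P B" and max: "\<And>C. P C \<Longrightarrow> card C \<le> card B"
    using ex_has_greatest_nat[of P "{}" card "Suc (DIM(real^'n))"] by (metis less_imp_le)
  have finB: "finite B"
    by (rule independent_imp_finite[OF P_indep[OF B]])
  have "span B = UNIV"
  proof (rule ccontr)
    assume "span B \<noteq> UNIV"
    define W where "W = {w. \<forall>b\<in>B. orthogonal b w}"
    have subW: "subspace W"
      unfolding W_def by (rule subspace_orthogonal_to_vectors)
    obtain a where a: "a \<noteq> 0" "\<And>x. x \<in> span B \<Longrightarrow> a \<bullet> x = 0"
      using span_not_UNIV_orthogonal[of B] \<open>span B \<noteq> UNIV\<close> by blast
    have "a \<in> W"
      using a(2) by (auto simp: W_def orthogonal_def inner_commute span_base)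
    with a(1) have "W \<noteq> {0}"
      by auto
    moreover have "A *v w \<in> W" if "w \<in> W" for w
    proof -
      have "b \<bullet> (A *v w) = 0" if "b \<in> B" for b
      proof -
        obtain l where "A *v b = l *\<^sub>R b"
          using B \<open>b \<in> B\<close> by (auto simp: P_def)
        with symmetric_matrixD[OF sym, of b w] \<open>w \<in> W\<close> \<open>b \<in> B\<close> show ?thesis
          by (auto simp: W_def orthogonal_def)
      qed
      then show ?thesis
        by (simp add: W_def orthogonal_def)
    qed
    ultimately obtain l v where v: "v \<in> W" "norm v = 1" "A *v v = l *\<^sub>R v"
      using rayleigh_minimizer_is_eigenvector[OF sym subW] by metis
    have "v \<notin> B"
      using v by (auto simp: W_def orthogonal_def)
    have "P (insert v B)"
      using B v by (auto simp: P_def pairwise_insert W_def orthogonal_commute)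
    from max[OF this] show False
      using finB \<open>v \<notin> B\<close> by simp
  qed
  moreover obtain f where "\<And>b. b \<in> B \<Longrightarrow> A *v b = f b *\<^sub>R b"
    using B unfolding P_def by metis
  ultimately show ?thesis
    using that[of B f] B finB by (auto simp: P_def)
qed

lemma orthonormal_basis_expansion:
  fixes B :: "(real^'n) set"
  assumes "finite B" "pairwise orthogonal B" "\<And>b. b \<in> B \<Longrightarrow> norm b = 1" "span B = UNIV"
  shows "x = (\<Sum>b\<in>B. (b \<bullet> x) *\<^sub>R b)"
proof -
  define y where "y = x - (\<Sum>b\<in>B. (b \<bullet> x) *\<^sub>R b)"
  have orth: "c \<bullet> (\<Sum>b\<in>B. (b \<bullet> x) *\<^sub>R b) = c \<bullet> x" if "c \<in> B" for c
  proof -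
    have "c \<bullet> (\<Sum>b\<in>B. (b \<bullet> x) *\<^sub>R b) = (\<Sum>b\<in>B. if b = c then c \<bullet> x else 0)"
      unfolding inner_sum_right
    proof (intro sum.cong refl)
      fix b assume "b \<in> B"
      with assms(2,3) that show "c \<bullet> ((b \<bullet> x) *\<^sub>R b) = (if b = c then c \<bullet> x else 0)"
        by (auto simp: pairwise_def orthogonal_def norm_eq_1)
    qed
    then show ?thesis
      using that assms(1) by simp
  qed
  have "y \<in> span B"
    using assms(4) by simp
  then have "orthogonal y y"
    by (rule orthogonal_to_span) (use orth in \<open>auto simp: y_def orthogonal_def inner_diff_right inner_diff_left inner_commute\<close>)
  then have "y = 0"
    by (simp add: orthogonal_self)
  then show ?thesis
    by (simp add: y_def)
qed

section \<open>Square roots of positive definite matrices and standardisation by them\<close>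

lemma pos_def_sqrt_exists:
  fixes A :: "real^'n^'n"
  assumes A: "pos_def A"
  obtains S where "pos_def S" "S ** S = A"
proof -
  obtain B f where B: "finite B" "pairwise orthogonal B" "\<And>b. b \<in> B \<Longrightarrow> norm b = 1"
    "\<And>b. b \<in> B \<Longrightarrow> A *v b = f b *\<^sub>R b" "span B = (UNIV :: (real^'n) set)"
    using orthonormal_eigenbasis[OF pos_defD(1)[OF A]] by blast
  have expand: "x = (\<Sum>b\<in>B. (b \<bullet> x) *\<^sub>R b)" for x
    by (rule orthonormal_basis_expansion) (use B in auto)
  have fpos: "f b > 0" if "b \<in> B" for b
  proof -
    have "b \<noteq> 0"
      using B(3)[OF that] by auto
    from pos_defD(2)[OF A this] show ?thesis
      using B(3)[OF that] B(4)[OF that] by (simp flip: power2_norm_eq_inner)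
  qed
  define S where "S = (\<Sum>b\<in>B. sqrt (f b) *\<^sub>R outer b b)"
  have S: "S *v x = (\<Sum>b\<in>B. (sqrt (f b) * (b \<bullet> x)) *\<^sub>R b)" for x
    by (simp add: S_def matrix_sum_mult_vector scaleR_matrix_vector_assoc[symmetric] outer_mult_vector)
  have Sb: "S *v b = sqrt (f b) *\<^sub>R b" if "b \<in> B" for b
  proof -
    have "S *v b = (\<Sum>c\<in>B. if c = b then sqrt (f b) *\<^sub>R b else 0)"
      unfolding S
    proof (intro sum.cong refl)
      fix c assume "c \<in> B"
      with B(2,3) that show "(sqrt (f c) * (c \<bullet> b)) *\<^sub>R c = (if c = b then sqrt (f b) *\<^sub>R b else 0)"
        by (auto simp: pairwise_def orthogonal_def norm_eq_1)
    qed
    then show ?thesis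
      using that B(1) by simp
  qed
  have "S ** S = A"
  proof (rule matrix_eq[THEN iffD2], rule allI)
    fix x
    have "(S ** S) *v b = A *v b" if "b \<in> B" for b
      using Sb[OF that] fpos[OF that] B(4)[OF that]
      by (simp add: matrix_vector_mul_assoc[symmetric] matrix_vector_mult_scaleR)
    then have "(S ** S) *v (\<Sum>b\<in>B. (b \<bullet> x) *\<^sub>R b) = A *v (\<Sum>b\<in>B. (b \<bullet> x) *\<^sub>R b)"
      unfolding matrix_vector_mult_sum matrix_vector_mult_scaleR by (intro sum.cong) auto
    then show "(S ** S) *v x = A *v x"
      unfolding expand[of x, symmetric] .
  qed
  moreover have "pos_def S"
    unfolding pos_def_def
  proof (intro conjI allI impI)
    show "transpose S = S"
      by (simp add: S_def transpose_sum transpose_scalar transpose_outer)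
    fix v :: "real^'n" assume "v \<noteq> 0"
    have "v \<bullet> (S *v v) = (\<Sum>b\<in>B. sqrt (f b) * (b \<bullet> v)\<^sup>2)"
      by (simp add: S inner_sum_right inner_commute power2_eq_square mult_ac)
    moreover have "\<exists>b\<in>B. b \<bullet> v \<noteq> 0"
    proof (rule ccontr)
      assume "\<not> (\<exists>b\<in>B. b \<bullet> v \<noteq> 0)"
      then have "(\<Sum>b\<in>B. (b \<bullet> v) *\<^sub>R b) = 0"
        by (intro sum.neutral) auto
      with expand[of v] \<open>v \<noteq> 0\<close> show False
        by metis
    qed
    then obtain b where "b \<in> B" "b \<bullet> v \<noteq> 0"
      by blast
    then have "(\<Sum>b\<in>B. sqrt (f b) * (b \<bullet> v)\<^sup>2) > 0"
      using fpos B(1) by (intro sum_pos2[of B b]) (auto simp: less_imp_le)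
    ultimately show "v \<bullet> (S *v v) > 0"
      by simp
  qed
  ultimately show ?thesis
    using that by blast
qed

text \<open>The difference \<open>D\<close> of two square roots satisfies \<open>D S = - T D\<close>, which is impossible on an
  eigenvector of \<open>D\<close> with nonzero eigenvalue.\<close>

lemma pos_def_sqrt_unique:
  fixes S T :: "real^'n^'n"
  assumes S: "pos_def S" and T: "pos_def T" and eq: "S ** S = T ** T"
  shows "S = T"
proof -
  define D where "D = S - T"
  have Dsym: "transpose D = D"
    by (simp add: D_def transpose_diff pos_defD(1)[OF S] pos_defD(1)[OF T])
  obtain B f where B: "finite B" "pairwise orthogonal B" "\<And>b. b \<in> B \<Longrightarrow> norm b = 1"
    "\<And>b. b \<in> B \<Longrightarrow> D *v b = f b *\<^sub>R b" "span B = (UNIV :: (real^'n) set)"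
    using orthonormal_eigenbasis[OF Dsym] by blast
  have expand: "x = (\<Sum>b\<in>B. (b \<bullet> x) *\<^sub>R b)" for x
    by (rule orthonormal_basis_expansion) (use B in auto)
  have "f b = 0" if "b \<in> B" for b
  proof -
    have b: "b \<noteq> 0"
      using B(3)[OF that] by auto
    have "S *v (S *v b) = T *v (T *v b)"
      using eq by (simp add: matrix_vector_mul_assoc)
    then have "D *v (S *v b) + T *v (D *v b) = 0"
      by (simp add: D_def algebra_simps)
    then have "b \<bullet> (D *v (S *v b)) + b \<bullet> (T *v (D *v b)) = 0"
      by (metis inner_add_right inner_zero_right)
    moreover have "b \<bullet> (D *v (S *v b)) = f b * (b \<bullet> (S *v b))"
      using symmetric_matrixD[OF Dsym, of b "S *v b"] B(4)[OF that] by simp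
    moreover have "b \<bullet> (T *v (D *v b)) = f b * (b \<bullet> (T *v b))"
      by (simp add: B(4)[OF that] matrix_vector_mult_scaleR)
    ultimately have "f b * (b \<bullet> (S *v b) + b \<bullet> (T *v b)) = 0"
      by (simp add: distrib_left)
    then show ?thesis
      using pos_defD(2)[OF S b] pos_defD(2)[OF T b] by simp
  qed
  then have "D *v b = 0" if "b \<in> B" for b
    using B(4) that by simp
  then have D0: "D *v (\<Sum>b\<in>B. (b \<bullet> x) *\<^sub>R b) = 0" for x
    unfolding matrix_vector_mult_sum matrix_vector_mult_scaleR by (intro sum.neutral) auto
  have "D *v x = 0" for x
    using D0[of x] unfolding expand[of x, symmetric] .
  then have "D = 0"
    by (subst matrix_eq) simp
  then show ?thesis
    by (simp add: D_def)
qed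

lemma mat_sqrt_pos_def:
  assumes "pos_def A"
  shows "pos_def (mat_sqrt A)" "mat_sqrt A ** mat_sqrt A = A"
proof -
  have "\<exists>!S. pos_def S \<and> S ** S = A"
    using pos_def_sqrt_exists[OF assms] pos_def_sqrt_unique by metis
  from theI'[OF this] show "pos_def (mat_sqrt A)" "mat_sqrt A ** mat_sqrt A = A"
    by (auto simp: mat_sqrt_def)
qed

lemma mat_inv_sqrt_pos_def:
  assumes A: "pos_def A"
  shows "pos_def (mat_inv_sqrt A)"
    "mat_sqrt A *v (mat_inv_sqrt A *v x) = x" "mat_inv_sqrt A *v (mat_sqrt A *v x) = x"
  unfolding mat_inv_sqrt_def
  using mat_sqrt_pos_def(1)[OF A]
  by (auto intro: pos_def_matrix_inv simp: matrix_inv_mult_vector pos_def_invertible)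

lemma norm_mat_sqrt_sq:
  assumes A: "pos_def A"
  shows "(norm (mat_sqrt A *v x))\<^sup>2 = x \<bullet> (A *v x)"
proof -
  have "x \<bullet> (A *v x) = x \<bullet> (mat_sqrt A *v (mat_sqrt A *v x))"
    by (simp add: matrix_vector_mul_assoc mat_sqrt_pos_def(2)[OF A])
  then show ?thesis
    using symmetric_matrixD[OF pos_defD(1)[OF mat_sqrt_pos_def(1)[OF A]], of x "mat_sqrt A *v x"]
    by (simp add: power2_norm_eq_inner)
qed

lemma norm_mat_inv_sqrt_sq:
  assumes A: "pos_def A"
  shows "(mat_inv_sqrt A *v x) \<bullet> (A *v (mat_inv_sqrt A *v x)) = (norm x)\<^sup>2"
  using norm_mat_sqrt_sq[OF A, of "mat_inv_sqrt A *v x"] by (simp add: mat_inv_sqrt_pos_def(2)[OF A])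

text \<open>Substituting z = B^(-1/2) w turns the order relation k B <= J into a Rayleigh bound.
  This is how a comparison of quadratic forms becomes the eigenvalue statement of the
  theorem.\<close>

lemma lambda_min_standardised_ge:
  fixes B J :: "real^'q^'q"
  assumes B: "pos_def B" and J: "transpose J = J"
    and ge: "\<And>z. k * (z \<bullet> (B *v z)) \<le> z \<bullet> (J *v z)"
  shows "k \<le> lambda_min (mat_inv_sqrt B ** J ** mat_inv_sqrt B)"
proof (rule lambda_min_rayleigh(2))
  let ?C = "mat_inv_sqrt B"
  have C: "transpose ?C = ?C"
    using mat_inv_sqrt_pos_def(1)[OF B] by (rule pos_defD)
  then show "transpose (?C ** J ** ?C) = ?C ** J ** ?C"
    by (simp add: matrix_transpose_mul J matrix_mul_assoc)
  fix w
  have "k * (norm w)\<^sup>2 \<le> (?C *v w) \<bullet> (J *v (?C *v w))"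
    using ge[of "?C *v w"] by (simp add: norm_mat_inv_sqrt_sq[OF B])
  also have "\<dots> = w \<bullet> ((?C ** J ** ?C) *v w)"
    using symmetric_matrixD[OF C, of w "J *v (?C *v w)"] by (simp add: matrix_vector_mul_assoc matrix_mul_assoc)
  finally show "k * (norm w)\<^sup>2 \<le> w \<bullet> ((?C ** J ** ?C) *v w)" .
qed

text \<open>Inversion reverses the order k B <= J. Test the hypothesis at y = J^(-1) t and split t
  as B^(1/2) B^(-1/2) t; Cauchy-Schwarz then bounds the norm of B^(1/2) y, and with it t' y. It is
  applied with the true variance as \<open>B\<close> and the estimated one as
  \<open>J\<close>.\<close>

lemma quadratic_form_inverse_le:
  fixes B J :: "real^'q^'q"
  assumes B: "pos_def B" and k: "k > 0" 
    and ge: "\<And>z. k * (z \<bullet> (B *v z)) \<le> z \<bullet> (J *v z)"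
  shows "t \<bullet> (matrix_inv J *v t) \<le> (norm (mat_inv_sqrt B *v t))\<^sup>2 / k"
proof -
  have "invertible J"
  proof (rule invertible_if_kernel_trivial)
    fix v assume "J *v v = 0"
    then have "v \<bullet> (B *v v) \<le> 0"
      using ge[of v] k by (simp add: mult_le_0_iff)
    then show "v = 0"
      using pos_defD(2)[OF B, of v] by force
  qed
  define y where "y = matrix_inv J *v t"
  have Jy: "J *v y = t"
    by (simp add: y_def matrix_inv_mult_vector[OF \<open>invertible J\<close>])
  have 1: "k * (norm (mat_sqrt B *v y))\<^sup>2 \<le> y \<bullet> t"
    using ge[of y] by (simp add: Jy norm_mat_sqrt_sq[OF B])
  have "y \<bullet> t = y \<bullet> (mat_sqrt B *v (mat_inv_sqrt B *v t))"
    by (simp add: mat_inv_sqrt_pos_def(2)[OF B])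
  also have "\<dots> = (mat_sqrt B *v y) \<bullet> (mat_inv_sqrt B *v t)"
    using symmetric_matrixD[OF pos_defD(1)[OF mat_sqrt_pos_def(1)[OF B]], of y "mat_inv_sqrt B *v t"] by simp
  also have "\<dots> \<le> norm (mat_sqrt B *v y) * norm (mat_inv_sqrt B *v t)"
    by (rule norm_cauchy_schwarz)
  finally have 2: "y \<bullet> t \<le> norm (mat_sqrt B *v y) * norm (mat_inv_sqrt B *v t)" .
  define p where "p = norm (mat_sqrt B *v y)"
  define r where "r = norm (mat_inv_sqrt B *v t)"
  have "k * p\<^sup>2 \<le> p * r"
    using 1 2 unfolding p_def r_def by linarith
  then have "k * p \<le> r"
    by (cases "p = 0") (auto simp: power2_eq_square p_def r_def)
  then have "p * r \<le> r\<^sup>2 / k"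
    using k mult_right_mono[of "k * p" r r] by (simp add: field_simps power2_eq_square r_def)
  then show ?thesis
    using 2 unfolding p_def r_def y_def by (simp add: inner_commute)
qed

subsection \<open>Sandwich forms\<close>

lemma sandwich_form:
  fixes R :: "real^'q^'k"
  shows "z \<bullet> (sandwich R V *v z) = (R *v z) \<bullet> (V *v (R *v z))"
  unfolding sandwich_def
  using inner_matrix_transpose[of z "transpose R" "V *v (R *v z)"]
  by (simp del: transpose_matrix_vector add: matrix_vector_mul_assoc[symmetric])

lemma transpose_sandwich:
  assumes "transpose V = V"
  shows "transpose (sandwich R V) = sandwich R V"
  by (simp add: sandwich_def matrix_transpose_mul assms matrix_mul_assoc)

lemma sandwich_pos_def:
  fixes R :: "real^'q^'k"
  assumes V: "pos_def V" and R: "rank R = CARD('q)"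
  shows "pos_def (sandwich R V)"
  unfolding pos_def_def
proof (intro conjI allI impI)
  show "transpose (sandwich R V) = sandwich R V"
    by (rule transpose_sandwich[OF pos_defD(1)[OF V]])
  fix z :: "real^'q" assume "z \<noteq> 0"
  then have "R *v z \<noteq> 0"
    using R matrix_nonfull_linear_equations_eq[of R] by metis
  then show "z \<bullet> (sandwich R V *v z) > 0"
    unfolding sandwich_form by (rule pos_defD(2)[OF V])
qed

section \<open>Local dependence\<close>

text \<open>Independence is granted only to families whose supports are disjoint. \<open>D\<close>
  bounds closed neighbourhoods: an observation is linked to itself because supports are
  nonempty.\<close>

locale local_dependence = prob_space M for M :: "'a measure" +
  fixes I :: "'i set" and \<psi> :: "'i \<Rightarrow> 'u set" and d :: "'i \<Rightarrow> 'a \<Rightarrow> 'b::second_countable_topology"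
    and D :: nat
  assumes finite_I: "finite I"
    and support_nonempty: "n \<in> I \<Longrightarrow> \<psi> n \<noteq> {}"
    and meas_d: "n \<in> I \<Longrightarrow> d n \<in> borel_measurable M"
    and indep: "\<lbrakk>S1 \<subseteq> I; S2 \<subseteq> I; S1 \<inter> S2 = {}; \<forall>n\<in>S1. \<forall>m\<in>S2. \<psi> n \<inter> \<psi> m = {}\<rbrakk> \<Longrightarrow>
        indep_var (Pi\<^sub>M S1 (\<lambda>_. borel)) (\<lambda>\<omega>. \<lambda>n\<in>S1. d n \<omega>) (Pi\<^sub>M S2 (\<lambda>_. borel)) (\<lambda>\<omega>. \<lambda>m\<in>S2. d m \<omega>)"
    and degree: "n \<in> I \<Longrightarrow> card {m\<in>I. \<psi> n \<inter> \<psi> m \<noteq> {}} \<le> D"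
begin

definition nb :: "'i set \<Rightarrow> 'i set" where
  "nb A = {m\<in>I. \<exists>n\<in>A. \<psi> n \<inter> \<psi> m \<noteq> {}}"

text \<open>The sigma-algebra generated by the data of \<open>A\<close>, packaged as a measure space
  so that being a function of these data becomes ordinary \<open>borel_measurable\<close>
  membership.\<close>

definition data_algebra :: "'i set \<Rightarrow> 'a measure" where
  "data_algebra A = vimage_algebra (space M) (\<lambda>\<omega>. \<lambda>n\<in>A. d n \<omega>) (Pi\<^sub>M A (\<lambda>_. borel))"

lemma nb_subset: "nb A \<subseteq> I"
  by (auto simp: nb_def)

lemma finite_nb [simp]: "finite (nb A)"
  using finite_subset[OF nb_subset finite_I] .

lemma card_nb_le:
  assumes "A \<subseteq> I"
  shows "card (nb A) \<le> card A * D"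
proof -
  have "nb A = (\<Union>n\<in>A. {m\<in>I. \<psi> n \<inter> \<psi> m \<noteq> {}})"
    by (auto simp: nb_def)
  also have "card \<dots> \<le> (\<Sum>n\<in>A. card {m\<in>I. \<psi> n \<inter> \<psi> m \<noteq> {}})"
    by (intro card_UN_le finite_subset[OF assms finite_I])
  also have "\<dots> \<le> (\<Sum>n\<in>A. D)"
    using assms degree by (intro sum_mono) auto
  finally show ?thesis
    by simp
qed

lemma space_data_algebra [simp]: "space (data_algebra A) = space M"
  by (simp add: data_algebra_def)

lemma measurable_data:
  assumes "n \<in> A"
  shows "d n \<in> borel_measurable (data_algebra A)"
proof -
  have "(\<lambda>\<omega>. \<lambda>n\<in>A. d n \<omega>) \<in> data_algebra A \<rightarrow>\<^sub>M Pi\<^sub>M A (\<lambda>_. borel)"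
    unfolding data_algebra_def by (rule measurable_vimage_algebra1) (auto simp: space_PiM)
  then have "(\<lambda>\<omega>. (\<lambda>n\<in>A. d n \<omega>) n) \<in> borel_measurable (data_algebra A)"
    by (rule measurable_compose[OF _ measurable_component_singleton[OF assms]])
  then show ?thesis
    using assms by simp
qed

lemma measurable_data_algebra_mono:
  assumes "A \<subseteq> B" "F \<in> borel_measurable (data_algebra A)"
  shows "F \<in> borel_measurable (data_algebra B)"
proof -
  have "(\<lambda>\<omega>. \<lambda>n\<in>A. d n \<omega>) \<in> data_algebra B \<rightarrow>\<^sub>M Pi\<^sub>M A (\<lambda>_. borel)"
    using assms(1) by (intro measurable_restrict measurable_data) auto
  then have "id \<in> data_algebra B \<rightarrow>\<^sub>M data_algebra A"
    unfolding data_algebra_def[of A] by (intro measurable_vimage_algebra2) auto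
  from measurable_compose[OF this assms(2)] show ?thesis
    by simp
qed

lemma measurable_data_algebra_imp:
  assumes "A \<subseteq> I" "F \<in> borel_measurable (data_algebra A)"
  shows "F \<in> borel_measurable M"
proof -
  have "(\<lambda>\<omega>. \<lambda>n\<in>A. d n \<omega>) \<in> M \<rightarrow>\<^sub>M Pi\<^sub>M A (\<lambda>_. borel)"
    using assms(1) by (intro measurable_restrict meas_d) auto
  then have "id \<in> M \<rightarrow>\<^sub>M data_algebra A"
    unfolding data_algebra_def[of A] by (intro measurable_vimage_algebra2) auto
  from measurable_compose[OF this assms(2)] show ?thesis
    by simp
qed

text \<open>The independence hypothesis acts only through this product rule. The field is generic
  because covariances need real factors and characteristic functions complex ones.\<close>

lemma expectation_mult_unlinked:
  fixes F G :: "'a \<Rightarrow> 'c::{real_normed_field,banach,second_countable_topology}"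
  assumes "A \<subseteq> I" "B \<subseteq> I" "nb A \<inter> B = {}"
    and F: "F \<in> borel_measurable (data_algebra A)" "integrable M F"
    and G: "G \<in> borel_measurable (data_algebra B)" "integrable M G"
  shows "(\<integral>\<omega>. F \<omega> * G \<omega> \<partial>M) = (\<integral>\<omega>. F \<omega> \<partial>M) * (\<integral>\<omega>. G \<omega> \<partial>M)"
proof (rule indep_var_lebesgue_integral[OF _ F(2) G(2)])
  have unlinked: "\<forall>n\<in>A. \<forall>m\<in>B. \<psi> n \<inter> \<psi> m = {}"
    using assms(2,3) unfolding nb_def by blast
  \<comment> \<open>A common index would be linked to itself, its support being nonempty.\<close>
  moreover have "A \<inter> B = {}"
    using unlinked assms(1) support_nonempty by blast
  ultimately have "indep_set
      (sigma_sets (space M) {(\<lambda>\<omega>. \<lambda>n\<in>A. d n \<omega>) -` X \<inter> space M | X. X \<in> sets (Pi\<^sub>M A (\<lambda>_. borel))})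
      (sigma_sets (space M) {(\<lambda>\<omega>. \<lambda>n\<in>B. d n \<omega>) -` X \<inter> space M | X. X \<in> sets (Pi\<^sub>M B (\<lambda>_. borel))})"
    using indep[of A B] assms(1,2) unfolding indep_var_eq by blast
  then have ind: "indep_set (sets (data_algebra A)) (sets (data_algebra B))"
    by (simp add: data_algebra_def sets_vimage_algebra)
  have sub: "sigma_sets (space M) {H -` X \<inter> space M | X. X \<in> sets borel} \<subseteq> sets (data_algebra C)"
    if "H \<in> borel_measurable (data_algebra C)" for H :: "'a \<Rightarrow> 'c" and C
    using sets.sigma_sets_subset[of "{H -` X \<inter> space M | X. X \<in> sets borel}" "data_algebra C"]
      measurable_sets[OF that] by auto
  show "indep_var borel F borel G"
    unfolding indep_var_eq
  proof (intro conjI)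
    show "random_variable borel F" "random_variable borel G"
      using F(2) G(2) by auto
    show "indep_set (sigma_sets (space M) {F -` X \<inter> space M | X. X \<in> sets borel})
        (sigma_sets (space M) {G -` X \<inter> space M | X. X \<in> sets borel})"
      using ind sub[OF F(1)] sub[OF G(1)] unfolding indep_sets2_eq by blast
  qed
qed

lemma integrable_bounded:
  fixes F :: "'a \<Rightarrow> 'c::{banach,second_countable_topology}"
  assumes "F \<in> borel_measurable M" "\<And>\<omega>. \<omega> \<in> space M \<Longrightarrow> norm (F \<omega>) \<le> B"
  shows "integrable M F"
  using assms by (intro integrable_const_bound[of _ B]) auto

lemma norm_expectation_le:
  fixes F :: "'a \<Rightarrow> 'c::{banach,second_countable_topology}"
  assumes "F \<in> borel_measurable M" "\<And>\<omega>. \<omega> \<in> space M \<Longrightarrow> norm (F \<omega>) \<le> B"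
  shows "norm (\<integral>\<omega>. F \<omega> \<partial>M) \<le> B"
proof -
  have "norm (\<integral>\<omega>. F \<omega> \<partial>M) \<le> (\<integral>\<omega>. norm (F \<omega>) \<partial>M)"
    by (rule integral_norm_bound)
  also have "\<dots> \<le> (\<integral>\<omega>. B \<partial>M)"
    using assms by (intro integral_mono integrable_norm integrable_bounded[of F B]) auto
  finally show ?thesis
    by (simp add: prob_space)
qed

text \<open>Only linked pairs can have nonzero covariance. There are at most
  \<open>card J * L\<close> of them, and each contributes at most (2 b)^2, centring having doubled
  the bound.\<close>

lemma variance_sum_le:
  fixes F :: "'j \<Rightarrow> 'a \<Rightarrow> real"
  assumes J: "finite J" and A: "\<And>j. j \<in> J \<Longrightarrow> A j \<subseteq> I"
    and F: "\<And>j. j \<in> J \<Longrightarrow> F j \<in> borel_measurable (data_algebra (A j))"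
    and b: "\<And>j \<omega>. j \<in> J \<Longrightarrow> \<omega> \<in> space M \<Longrightarrow> \<bar>F j \<omega>\<bar> \<le> b"
    and L: "\<And>j. j \<in> J \<Longrightarrow> card {k\<in>J. nb (A j) \<inter> A k \<noteq> {}} \<le> L"
  shows "expectation (\<lambda>\<omega>. ((\<Sum>j\<in>J. F j \<omega>) - (\<Sum>j\<in>J. expectation (F j)))\<^sup>2) \<le> 4 * b\<^sup>2 * (card J * L)"
proof -
  define H where "H j \<omega> = F j \<omega> - expectation (F j)" for j \<omega>
  have FM: "F j \<in> borel_measurable M" if "j \<in> J" for j
    using measurable_data_algebra_imp[OF A F] that by blast
  have Fint: "integrable M (F j)" if "j \<in> J" for j
    using FM b that by (intro integrable_bounded[of _ b]) auto
  have HA: "H j \<in> borel_measurable (data_algebra (A j))" if "j \<in> J" for j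
    using F[OF that] unfolding H_def by measurable
  have HM: "H j \<in> borel_measurable M" if "j \<in> J" for j
    using FM[OF that] unfolding H_def by measurable
  have Hb: "\<bar>H j \<omega>\<bar> \<le> 2 * b" if "j \<in> J" "\<omega> \<in> space M" for j \<omega>
    using b[OF that] norm_expectation_le[OF FM, of j b] b that(1) by (auto simp: H_def)
  have Hint: "integrable M (H j)" if "j \<in> J" for j
    using HM Hb that by (intro integrable_bounded[of _ "2 * b"]) auto
  have H0: "expectation (H j) = 0" if "j \<in> J" for j
    using Fint[OF that] unfolding H_def[abs_def] by (simp add: prob_space)
  have HHb: "\<bar>H j \<omega> * H k \<omega>\<bar> \<le> 4 * b\<^sup>2" if "j \<in> J" "k \<in> J" "\<omega> \<in> space M" for j k \<omega>
    using mult_mono[OF Hb Hb, of j \<omega> k \<omega>] that Hb[of j \<omega>]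
    by (simp add: abs_mult power2_eq_square)
  have HHint: "integrable M (\<lambda>\<omega>. H j \<omega> * H k \<omega>)" if "j \<in> J" "k \<in> J" for j k
    using HM HHb that by (intro integrable_bounded[of _ "4 * b\<^sup>2"]) auto
  have cov: "expectation (\<lambda>\<omega>. H j \<omega> * H k \<omega>) \<le> (if nb (A j) \<inter> A k \<noteq> {} then 4 * b\<^sup>2 else 0)"
    if "j \<in> J" "k \<in> J" for j k
  proof (cases "nb (A j) \<inter> A k = {}")
    case True
    then show ?thesis
      using expectation_mult_unlinked[OF A A True HA Hint HA Hint] H0 that by simp
  next
    case False
    have "expectation (\<lambda>\<omega>. H j \<omega> * H k \<omega>) \<le> norm (expectation (\<lambda>\<omega>. H j \<omega> * H k \<omega>))"
      by simp
    also have "\<dots> \<le> 4 * b\<^sup>2"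
      using HHb HM that by (intro norm_expectation_le) auto
    finally show ?thesis
      using False by simp
  qed
  have "expectation (\<lambda>\<omega>. ((\<Sum>j\<in>J. F j \<omega>) - (\<Sum>j\<in>J. expectation (F j)))\<^sup>2)
      = expectation (\<lambda>\<omega>. \<Sum>j\<in>J. \<Sum>k\<in>J. H j \<omega> * H k \<omega>)"
    by (simp add: H_def sum_subtractf[symmetric] power2_eq_square sum_product)
  also have "\<dots> = (\<Sum>j\<in>J. \<Sum>k\<in>J. expectation (\<lambda>\<omega>. H j \<omega> * H k \<omega>))"
    by (simp add: Bochner_Integration.integral_sum HHint)
  also have "\<dots> \<le> (\<Sum>j\<in>J. \<Sum>k\<in>J. if nb (A j) \<inter> A k \<noteq> {} then 4 * b\<^sup>2 else 0)"
    by (intro sum_mono cov)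
  also have "\<dots> = (\<Sum>j\<in>J. real (card {k\<in>J. nb (A j) \<inter> A k \<noteq> {}}) * (4 * b\<^sup>2))"
    using J by (intro sum.cong refl) (simp add: sum.If_cases Int_def)
  also have "\<dots> \<le> (\<Sum>j\<in>J. real L * (4 * b\<^sup>2))"
    using L by (intro sum_mono mult_right_mono) auto
  finally show ?thesis
    by (simp add: mult_ac)
qed

end

section \<open>Exponential tilting and leave-out expansions of orders one to three\<close>

lemma exp_remainder:
  fixes w :: complex
  shows "norm (1 - exp (- w)) \<le> norm w * exp (norm w)"
    and "norm (1 - exp (- w) - w) \<le> (norm w)\<^sup>2 * exp (norm w)"
    and "norm (1 - exp (- w) - (w - w\<^sup>2 / 2)) \<le> norm w ^ 3 * exp (norm w)"
proof -
  have T: "norm (exp (- w) - (\<Sum>k\<le>n. (- w) ^ k / fact k)) \<le> exp (norm w) * norm w ^ Suc n" for n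
  proof -
    have "norm (exp (- w) - (\<Sum>k\<le>n. (- w) ^ k / fact k)) \<le> exp (norm (- w)) * norm (- w) ^ Suc n / fact n"
      by (rule Taylor_exp_field)
    also have "\<dots> \<le> exp (norm (- w)) * norm (- w) ^ Suc n / 1"
      by (intro divide_left_mono) (auto simp: fact_ge_1)
    finally show ?thesis
      by simp
  qed
  have "norm (1 - exp (- w)) = norm (exp (- w) - (\<Sum>k\<le>0. (- w) ^ k / fact k))"
    by (simp add: norm_minus_commute)
  with T[of 0] show "norm (1 - exp (- w)) \<le> norm w * exp (norm w)"
    by (simp add: mult.commute)
  have "norm (1 - exp (- w) - w) = norm (exp (- w) - (\<Sum>k\<le>Suc 0. (- w) ^ k / fact k))"
    by (subst norm_minus_commute) (simp add: algebra_simps)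
  with T[of "Suc 0"] show "norm (1 - exp (- w) - w) \<le> (norm w)\<^sup>2 * exp (norm w)"
    by (simp add: power2_eq_square mult.commute)
  have "norm (1 - exp (- w) - (w - w\<^sup>2 / 2)) = norm (exp (- w) - (\<Sum>k\<le>Suc (Suc 0). (- w) ^ k / fact k))"
    by (subst norm_minus_commute) (simp add: algebra_simps power2_eq_square)
  with T[of "Suc (Suc 0)"] show "norm (1 - exp (- w) - (w - w\<^sup>2 / 2)) \<le> norm w ^ 3 * exp (norm w)"
    by (simp add: power3_eq_cube mult.commute mult.left_commute)
qed

lemma norm_add_diff_le:
  "norm p \<le> a \<Longrightarrow> norm q \<le> b \<Longrightarrow> norm r \<le> c \<Longrightarrow> norm (p + q - r) \<le> a + b + c"
  using norm_triangle_ineq4[of "p + q" r] norm_triangle_ineq[of p q] by linarith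

text \<open>\<open>Da_small\<close> makes \<open>Y A\<close> bounded by 1 whenever \<open>A\<close>
  has at most three elements, so the exponentials in the Taylor remainders are absorbed into
  \<open>exp (norm z)\<close>.\<close>

locale bounded_scores = local_dependence M I \<psi> d D
  for M :: "'a measure" and I :: "'i set" and \<psi> :: "'i \<Rightarrow> 'u set"
    and d :: "'i \<Rightarrow> 'a \<Rightarrow> 'b::second_countable_topology" and D :: nat +
  fixes X :: "'i \<Rightarrow> 'a \<Rightarrow> real" and a :: real
  assumes X_meas: "n \<in> I \<Longrightarrow> X n \<in> borel_measurable (data_algebra {n})"
    and X_bound: "n \<in> I \<Longrightarrow> \<omega> \<in> space M \<Longrightarrow> \<bar>X n \<omega>\<bar> \<le> a"
    and X_mean: "n \<in> I \<Longrightarrow> expectation (X n) = 0"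
    and a_nonneg: "a \<ge> 0"
    and Da_small: "3 * D * a \<le> 1"
begin

definition W :: "'a \<Rightarrow> real" where "W \<omega> = (\<Sum>n\<in>I. X n \<omega>)"
definition Y :: "'i set \<Rightarrow> 'a \<Rightarrow> real" where "Y A \<omega> = (\<Sum>m\<in>nb A. X m \<omega>)"
definition Phi :: "complex \<Rightarrow> complex" where "Phi z = (\<integral>\<omega>. exp (z * of_real (W \<omega>)) \<partial>M)"
definition mgf :: "real \<Rightarrow> real" where "mgf s = expectation (\<lambda>\<omega>. exp (s * W \<omega>))"
text \<open>Unnormalised expectation under an exponential tilt: a Fourier integral for imaginary z,
  a moment-generating one for real z. One expansion then serves both uses.\<close>

definition tilted :: "complex \<Rightarrow> ('a \<Rightarrow> complex) \<Rightarrow> complex" where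
  "tilted z H = (\<integral>\<omega>. H \<omega> * exp (z * of_real (W \<omega>)) \<partial>M)"
text \<open>A class closed under all operations needed below, so that integrability and the
  linearity of \<open>tilted\<close> reduce to simplification.\<close>

definition bounded_rv :: "('a \<Rightarrow> complex) \<Rightarrow> bool" where
  "bounded_rv H \<longleftrightarrow> H \<in> borel_measurable M \<and> (\<exists>b. \<forall>\<omega>\<in>space M. norm (H \<omega>) \<le> b)"

lemma X_meas_in: "n \<in> A \<Longrightarrow> A \<subseteq> I \<Longrightarrow> X n \<in> borel_measurable (data_algebra A)"
  by (rule measurable_data_algebra_mono[OF _ X_meas]) auto

lemma X_meas_M [measurable]: "n \<in> I \<Longrightarrow> X n \<in> borel_measurable M"
  using X_meas_in[of n I] measurable_data_algebra_imp[of I] by blast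

lemma W_meas [measurable]: "W \<in> borel_measurable M"
  unfolding W_def by measurable

lemma Y_meas [measurable]: "Y A \<in> borel_measurable M"
  unfolding Y_def using nb_subset[of A] by (intro borel_measurable_sum X_meas_M) auto

lemma abs_W_le: "\<omega> \<in> space M \<Longrightarrow> \<bar>W \<omega>\<bar> \<le> card I * a"
  unfolding W_def using sum_bounded_above[of I "\<lambda>n. \<bar>X n \<omega>\<bar>" a] X_bound
  by (intro order.trans[OF sum_abs]) auto

lemma abs_Y_le: "A \<subseteq> I \<Longrightarrow> \<omega> \<in> space M \<Longrightarrow> \<bar>Y A \<omega>\<bar> \<le> real (card A) * (D * a)"
proof -
  assume A: "A \<subseteq> I" and \<omega>: "\<omega> \<in> space M"
  have "\<bar>Y A \<omega>\<bar> \<le> (\<Sum>m\<in>nb A. \<bar>X m \<omega>\<bar>)"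
    unfolding Y_def by (rule sum_abs)
  also have "\<dots> \<le> real (card (nb A)) * a"
    using sum_bounded_above[of "nb A" "\<lambda>n. \<bar>X n \<omega>\<bar>" a] X_bound nb_subset[of A] \<omega> by auto
  also have "\<dots> \<le> real (card A * D) * a"
    using card_nb_le[OF A] a_nonneg by (intro mult_right_mono) (simp_all del: of_nat_mult)
  finally show ?thesis
    by (simp add: mult_ac)
qed

lemma bounded_rvI: "H \<in> borel_measurable M \<Longrightarrow> (\<And>\<omega>. \<omega> \<in> space M \<Longrightarrow> norm (H \<omega>) \<le> b) \<Longrightarrow> bounded_rv H"
  unfolding bounded_rv_def by blast

lemma bounded_rv_const [simp]: "bounded_rv (\<lambda>\<omega>. c)"
  by (rule bounded_rvI[of _ "norm c"]) auto

lemma bounded_rv_add [simp]: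
  assumes "bounded_rv H" "bounded_rv K"
  shows "bounded_rv (\<lambda>\<omega>. H \<omega> + K \<omega>)"
proof -
  obtain b c where "\<forall>\<omega>\<in>space M. norm (H \<omega>) \<le> b" "\<forall>\<omega>\<in>space M. norm (K \<omega>) \<le> c"
    using assms unfolding bounded_rv_def by blast
  with assms show ?thesis
    by (intro bounded_rvI[of _ "b + c"]) (auto simp: bounded_rv_def intro!: norm_triangle_mono)
qed

lemma bounded_rv_mult [simp]:
  assumes "bounded_rv H" "bounded_rv K"
  shows "bounded_rv (\<lambda>\<omega>. H \<omega> * K \<omega>)"
proof -
  obtain b c where "\<forall>\<omega>\<in>space M. norm (H \<omega>) \<le> b" "\<forall>\<omega>\<in>space M. norm (K \<omega>) \<le> c"
    using assms unfolding bounded_rv_def by blast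
  with assms show ?thesis
    by (intro bounded_rvI[of _ "b * c"]) (auto simp: bounded_rv_def norm_mult intro!: mult_mono')
qed

lemma bounded_rv_minus [simp]: "bounded_rv H \<Longrightarrow> bounded_rv (\<lambda>\<omega>. - H \<omega>)"
  using bounded_rv_mult[of "\<lambda>_. - 1" H] by simp

lemma bounded_rv_divide [simp]: "bounded_rv H \<Longrightarrow> bounded_rv (\<lambda>\<omega>. H \<omega> / c)"
  using bounded_rv_mult[of H "\<lambda>_. 1 / c"] by simp

lemma bounded_rv_diff [simp]: "bounded_rv H \<Longrightarrow> bounded_rv K \<Longrightarrow> bounded_rv (\<lambda>\<omega>. H \<omega> - K \<omega>)"
  using bounded_rv_add[of H "\<lambda>\<omega>. - K \<omega>"] by simp

lemma bounded_rv_power [simp]: "bounded_rv H \<Longrightarrow> bounded_rv (\<lambda>\<omega>. H \<omega> ^ n)"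
  by (induction n) auto

lemma bounded_rv_sum [simp]: "(\<And>j. j \<in> J \<Longrightarrow> bounded_rv (H j)) \<Longrightarrow> bounded_rv (\<lambda>\<omega>. \<Sum>j\<in>J. H j \<omega>)"
  by (induction J rule: infinite_finite_induct) auto

lemma bounded_rv_exp [simp]:
  assumes "bounded_rv H"
  shows "bounded_rv (\<lambda>\<omega>. exp (H \<omega>))"
proof -
  obtain b where b: "\<forall>\<omega>\<in>space M. norm (H \<omega>) \<le> b"
    using assms unfolding bounded_rv_def by blast
  have "norm (exp (H \<omega>)) \<le> exp b" if "\<omega> \<in> space M" for \<omega>
    using b that norm_exp[of "H \<omega>"] by (meson exp_le_cancel_iff order_trans)
  with assms show ?thesis
    by (intro bounded_rvI[of _ "exp b"]) (auto simp: bounded_rv_def)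
qed

lemma bounded_rv_X [simp]: "n \<in> I \<Longrightarrow> bounded_rv (\<lambda>\<omega>. of_real (X n \<omega>))"
  by (rule bounded_rvI[of _ a]) (auto simp: X_bound)

lemma bounded_rv_W [simp]: "bounded_rv (\<lambda>\<omega>. of_real (W \<omega>))"
  unfolding W_def of_real_sum by simp

lemma bounded_rv_Y [simp]: "bounded_rv (\<lambda>\<omega>. of_real (Y A \<omega>))"
  unfolding Y_def of_real_sum using nb_subset[of A] by (intro bounded_rv_sum bounded_rv_X) auto

lemma bounded_rv_integrable [simp]: "bounded_rv H \<Longrightarrow> integrable M H"
  unfolding bounded_rv_def using integrable_bounded[of H] by blast

lemma tilted_diff: "bounded_rv H \<Longrightarrow> bounded_rv K \<Longrightarrow> tilted z (\<lambda>\<omega>. H \<omega> - K \<omega>) = tilted z H - tilted z K"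
  unfolding tilted_def by (simp add: left_diff_distrib)

lemma tilted_cmult: "tilted z (\<lambda>\<omega>. c * H \<omega>) = c * tilted z H"
  unfolding tilted_def by (simp add: mult.assoc)

lemma tilted_sum: "(\<And>j. j \<in> J \<Longrightarrow> bounded_rv (H j)) \<Longrightarrow> tilted z (\<lambda>\<omega>. \<Sum>j\<in>J. H j \<omega>) = (\<Sum>j\<in>J. tilted z (H j))"
  unfolding tilted_def by (simp add: sum_distrib_right Bochner_Integration.integral_sum)

lemma tilted_const: "tilted z (\<lambda>\<omega>. c) = c * Phi z"
  unfolding tilted_def Phi_def by simp

lemma tilted_cong: "(\<And>\<omega>. \<omega> \<in> space M \<Longrightarrow> H \<omega> = K \<omega>) \<Longrightarrow> tilted z H = tilted z K"
  unfolding tilted_def by (intro Bochner_Integration.integral_cong) auto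

lemma integrable_exp_W [simp]: "integrable M (\<lambda>\<omega>. exp (s * W \<omega>))"
  using integrable_norm[OF bounded_rv_integrable[OF bounded_rv_exp[OF bounded_rv_mult[OF bounded_rv_const[of "of_real s"] bounded_rv_W]]]]
  by simp

lemma norm_tilted_le:
  assumes "bounded_rv H" "\<And>\<omega>. \<omega> \<in> space M \<Longrightarrow> norm (H \<omega>) \<le> b"
  shows "norm (tilted z H) \<le> b * mgf (Re z)"
proof -
  have "norm (tilted z H) \<le> (\<integral>\<omega>. norm (H \<omega> * exp (z * of_real (W \<omega>))) \<partial>M)"
    unfolding tilted_def by (rule integral_norm_bound)
  also have "\<dots> \<le> (\<integral>\<omega>. b * exp (Re z * W \<omega>) \<partial>M)"
    using assms by (intro integral_mono integrable_norm integrable_mult_right)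
      (auto simp: norm_mult intro!: mult_right_mono)
  finally show ?thesis
    by (simp add: mgf_def)
qed

lemma mgf_pos: "mgf s > 0"
proof -
  have "exp (- (\<bar>s\<bar> * (card I * a))) \<le> (\<integral>\<omega>. exp (s * W \<omega>) \<partial>M)"
  proof -
    have "(\<integral>\<omega>. exp (- (\<bar>s\<bar> * (card I * a))) \<partial>M) \<le> (\<integral>\<omega>. exp (s * W \<omega>) \<partial>M)"
    proof (rule integral_mono[OF _ integrable_exp_W])
      fix \<omega> assume "\<omega> \<in> space M"
      from mult_left_mono[OF abs_W_le[OF this], of "\<bar>s\<bar>"]
      have "\<bar>s * W \<omega>\<bar> \<le> \<bar>s\<bar> * (card I * a)"
        by (simp add: abs_mult)
      then show "exp (- (\<bar>s\<bar> * (card I * a))) \<le> exp (s * W \<omega>)"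
        by simp
    qed auto
    then show ?thesis
      by (simp add: prob_space)
  qed
  then show ?thesis
    unfolding mgf_def by (rule less_le_trans[rotated]) simp
qed

text \<open>\<open>W - Y A\<close> involves no observation linked to \<open>A\<close>, so a centred \<open>F\<close> built from \<open>A\<close> integrates
  to zero against \<open>exp (z (W - Y A))\<close>.\<close>

lemma leave_out:
  assumes A: "A \<subseteq> I" and F: "F \<in> borel_measurable (data_algebra A)"
    and b: "\<And>\<omega>. \<omega> \<in> space M \<Longrightarrow> \<bar>F \<omega>\<bar> \<le> b" and mean: "expectation F = 0"
  shows "tilted z (\<lambda>\<omega>. of_real (F \<omega>)) = tilted z (\<lambda>\<omega>. of_real (F \<omega>) * (1 - exp (- (z * of_real (Y A \<omega>)))))"
proof -
  have FM [measurable]: "F \<in> borel_measurable M"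
    by (rule measurable_data_algebra_imp[OF A F])
  have bF: "bounded_rv (\<lambda>\<omega>. of_real (F \<omega>))"
    by (rule bounded_rvI[of _ b]) (auto simp: b)
  define V where "V \<omega> = (\<Sum>m\<in>I - nb A. X m \<omega>)" for \<omega>
  have WV: "W \<omega> = V \<omega> + Y A \<omega>" for \<omega>
    unfolding W_def V_def Y_def using sum.subset_diff[OF nb_subset finite_I, of "\<lambda>m. X m \<omega>"] by simp
  have ce: "exp (- (z * of_real (Y A \<omega>))) * exp (z * of_real (W \<omega>)) = exp (z * of_real (V \<omega>))" for \<omega>
    by (simp add: exp_add[symmetric] WV distrib_left)
  have VA: "V \<in> borel_measurable (data_algebra (I - nb A))"
    unfolding V_def by (intro borel_measurable_sum X_meas_in) auto
  have bV: "bounded_rv (\<lambda>\<omega>. exp (z * of_real (V \<omega>)))"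
    unfolding ce[symmetric] by simp
  have "tilted z (\<lambda>\<omega>. of_real (F \<omega>) * exp (- (z * of_real (Y A \<omega>)))) = (\<integral>\<omega>. of_real (F \<omega>) * exp (z * of_real (V \<omega>)) \<partial>M)"
    unfolding tilted_def mult.assoc ce ..
  also have "\<dots> = (\<integral>\<omega>. complex_of_real (F \<omega>) \<partial>M) * (\<integral>\<omega>. exp (z * of_real (V \<omega>)) \<partial>M)"
    using F VA bF bV by (intro expectation_mult_unlinked[OF A, of "I - nb A"]) auto
  also have "\<dots> = 0"
    using mean by simp
  finally show ?thesis
    using bF by (simp add: right_diff_distrib tilted_diff)
qed

context
  fixes A and F :: "'a \<Rightarrow> real" and b :: real and z :: complex
  assumes A: "A \<subseteq> I" and F: "F \<in> borel_measurable (data_algebra A)"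
    and b: "\<And>\<omega>. \<omega> \<in> space M \<Longrightarrow> \<bar>F \<omega>\<bar> \<le> b" and mean: "expectation F = 0" and card_A: "card A \<le> 3"
begin

lemma bounded_rv_F: "bounded_rv (\<lambda>\<omega>. of_real (F \<omega>))"
  using measurable_data_algebra_imp[OF A F] by (intro bounded_rvI[of _ b]) (auto simp: b)

lemma leave_out_F:
  "tilted z (\<lambda>\<omega>. of_real (F \<omega>)) = tilted z (\<lambda>\<omega>. of_real (F \<omega>) * (1 - exp (- (z * of_real (Y A \<omega>)))))"
  by (rule leave_out[OF A F _ mean]) (rule b)

lemma zY_le: "\<omega> \<in> space M \<Longrightarrow> norm (z * of_real (Y A \<omega>)) \<le> norm z * (card A * (D * a))"
  using mult_left_mono[OF abs_Y_le[OF A] norm_ge_zero[of z]] by (simp add: norm_mult)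

lemma exp_zY_le: "\<omega> \<in> space M \<Longrightarrow> exp (norm (z * of_real (Y A \<omega>))) \<le> exp (norm z)"
proof -
  assume "\<omega> \<in> space M"
  have "card A * (D * a) \<le> 3 * (D * a)"
    using card_A a_nonneg by (intro mult_right_mono) auto
  also have "\<dots> \<le> 1"
    using Da_small by simp
  finally have "norm z * (card A * (D * a)) \<le> norm z * 1"
    by (intro mult_left_mono) auto
  with zY_le[OF \<open>\<omega> \<in> space M\<close>] show ?thesis
    by simp
qed

lemma norm_F_mult_le:
  fixes c :: complex
  assumes "\<omega> \<in> space M"
    and "norm c \<le> norm (z * of_real (Y A \<omega>)) ^ k * exp (norm (z * of_real (Y A \<omega>)))"
  shows "norm (of_real (F \<omega>) * c) \<le> b * ((norm z * (card A * (D * a))) ^ k * exp (norm z))"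
proof -
  have "norm c \<le> (norm z * (card A * (D * a))) ^ k * exp (norm z)"
    using zY_le exp_zY_le assms by (elim order.trans) (intro mult_mono' power_mono, auto)
  then show ?thesis
    unfolding norm_mult using b[OF assms(1)] by (intro mult_mono') auto
qed

text \<open>The order of the expansion is matched to the number of observations in \<open>F\<close>:
  three for a single score, two for a pair, one for a triple. Every branch then leaves a remainder
  of the same size a (D a)^3 per observation.\<close>

lemma leave_out_order1:
  "norm (tilted z (\<lambda>\<omega>. of_real (F \<omega>))) \<le> b * ((norm z * (card A * (D * a))) ^ 1 * exp (norm z)) * mgf (Re z)"
  unfolding leave_out_F
proof (intro norm_tilted_le norm_F_mult_le)
  show "bounded_rv (\<lambda>\<omega>. of_real (F \<omega>) * (1 - exp (- (z * of_real (Y A \<omega>)))))"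
    using bounded_rv_F by simp
qed (use exp_remainder(1) in auto)

lemma leave_out_order2:
  "norm (tilted z (\<lambda>\<omega>. of_real (F \<omega>)) - z * tilted z (\<lambda>\<omega>. of_real (F \<omega>) * of_real (Y A \<omega>)))
    \<le> b * ((norm z * (card A * (D * a)))\<^sup>2 * exp (norm z)) * mgf (Re z)"
proof -
  let ?r = "\<lambda>\<omega>. of_real (F \<omega>) * (1 - exp (- (z * of_real (Y A \<omega>))) - z * of_real (Y A \<omega>))"
  have "tilted z ?r = tilted z (\<lambda>\<omega>. of_real (F \<omega>) * (1 - exp (- (z * of_real (Y A \<omega>)))) - z * (of_real (F \<omega>) * of_real (Y A \<omega>)))"
    by (rule tilted_cong) (simp add: algebra_simps)
  also have "\<dots> = tilted z (\<lambda>\<omega>. of_real (F \<omega>)) - z * tilted z (\<lambda>\<omega>. of_real (F \<omega>) * of_real (Y A \<omega>))"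
    unfolding leave_out_F tilted_cmult[symmetric]
    by (rule tilted_diff) (simp_all add: bounded_rv_F)
  finally have eq: "tilted z ?r = \<dots>" .
  have "norm (tilted z ?r) \<le> b * ((norm z * (card A * (D * a)))\<^sup>2 * exp (norm z)) * mgf (Re z)"
  proof (intro norm_tilted_le norm_F_mult_le)
    show "bounded_rv ?r"
      using bounded_rv_F by simp
  qed (use exp_remainder(2) in auto)
  then show ?thesis
    unfolding eq .
qed

lemma leave_out_order3:
  "norm (tilted z (\<lambda>\<omega>. of_real (F \<omega>)) - (z * tilted z (\<lambda>\<omega>. of_real (F \<omega>) * of_real (Y A \<omega>))
      - z\<^sup>2 / 2 * tilted z (\<lambda>\<omega>. of_real (F \<omega>) * (of_real (Y A \<omega>))\<^sup>2)))
    \<le> b * ((norm z * (card A * (D * a))) ^ 3 * exp (norm z)) * mgf (Re z)"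
proof -
  let ?r = "\<lambda>\<omega>. of_real (F \<omega>) * (1 - exp (- (z * of_real (Y A \<omega>)))
      - (z * of_real (Y A \<omega>) - (z * of_real (Y A \<omega>))\<^sup>2 / 2))"
  have "tilted z ?r = tilted z (\<lambda>\<omega>. of_real (F \<omega>) * (1 - exp (- (z * of_real (Y A \<omega>))))
      - (z * (of_real (F \<omega>) * of_real (Y A \<omega>)) - z\<^sup>2 / 2 * (of_real (F \<omega>) * (of_real (Y A \<omega>))\<^sup>2)))"
    by (rule tilted_cong) (simp add: algebra_simps power_mult_distrib)
  also have "\<dots> = tilted z (\<lambda>\<omega>. of_real (F \<omega>)) - (z * tilted z (\<lambda>\<omega>. of_real (F \<omega>) * of_real (Y A \<omega>))
      - z\<^sup>2 / 2 * tilted z (\<lambda>\<omega>. of_real (F \<omega>) * (of_real (Y A \<omega>))\<^sup>2))"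
    unfolding leave_out_F tilted_cmult[symmetric]
    by (subst tilted_diff; (subst tilted_diff)?) (simp_all add: bounded_rv_F)
  finally have eq: "tilted z ?r = \<dots>" .
  have "norm (tilted z ?r) \<le> b * ((norm z * (card A * (D * a))) ^ 3 * exp (norm z)) * mgf (Re z)"
  proof (intro norm_tilted_le norm_F_mult_le)
    show "bounded_rv ?r"
      using bounded_rv_F by simp
  qed (use exp_remainder(3) in auto)
  then show ?thesis
    unfolding eq .
qed

end

lemma bounded_rv_real_integrable: "bounded_rv (\<lambda>\<omega>. of_real (F \<omega>)) \<Longrightarrow> integrable M F"
  using integrable_Re[OF bounded_rv_integrable[of "\<lambda>\<omega>. of_real (F \<omega>)"]] by simp

text \<open>Centring doubles the bound \<open>b\<close>, and \<open>card A \<le> 3\<close> triples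
  the neighbourhood; hence the 6.\<close>

lemma tilted_uncentred:
  assumes A: "A \<subseteq> I" and F: "F \<in> borel_measurable (data_algebra A)"
    and b: "\<And>\<omega>. \<omega> \<in> space M \<Longrightarrow> \<bar>F \<omega>\<bar> \<le> b" and card_A: "card A \<le> 3" 
  shows "norm (tilted z (\<lambda>\<omega>. of_real (F \<omega>)) - of_real (expectation F) * Phi z)
    \<le> 6 * b * (norm z * (D * a)) * (exp (norm z) * mgf (Re z))"
proof -
  have FM [measurable]: "F \<in> borel_measurable M"
    by (rule measurable_data_algebra_imp[OF A F])
  have bF: "bounded_rv (\<lambda>\<omega>. of_real (F \<omega>))"
    by (rule bounded_rvI[of _ b]) (auto simp: b)
  define c where "c = expectation F"
  have c: "\<bar>c\<bar> \<le> b"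
    using norm_expectation_le[OF FM, of b] b by (simp add: c_def)
  have b0: "0 \<le> b"
    using c by linarith
  have "norm (tilted z (\<lambda>\<omega>. of_real (F \<omega> - c))) \<le> 2 * b * ((norm z * (card A * (D * a))) ^ 1 * exp (norm z)) * mgf (Re z)"
  proof (rule leave_out_order1[OF A _ _ _ card_A])
    show "(\<lambda>\<omega>. F \<omega> - c) \<in> borel_measurable (data_algebra A)"
      using F by measurable
    show "expectation (\<lambda>\<omega>. F \<omega> - c) = 0"
      using bounded_rv_real_integrable[OF bF] by (simp add: c_def prob_space)
    fix \<omega> assume "\<omega> \<in> space M"
    from b[OF this] c show "\<bar>F \<omega> - c\<bar> \<le> 2 * b"
      by linarith
  qed
  also have "\<dots> \<le> 2 * b * ((norm z * (3 * (D * a))) ^ 1 * exp (norm z)) * mgf (Re z)"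
    using card_A b0 a_nonneg mgf_pos[of "Re z"]
    by (intro mult_right_mono mult_left_mono power_mono) auto
  also have "tilted z (\<lambda>\<omega>. of_real (F \<omega> - c)) = tilted z (\<lambda>\<omega>. of_real (F \<omega>)) - of_real c * Phi z"
    using bF by (simp add: tilted_diff tilted_const)
  finally show ?thesis
    by (simp add: c_def mult_ac)
qed

text \<open>The coefficient of z for a pair: third-order joint moments of n, m and any l linked to
  one of them, with the product of the pair centred first.\<close>

definition kap1 :: "'i \<Rightarrow> 'i \<Rightarrow> real" where
  "kap1 n m = (\<Sum>l\<in>nb {n, m}. expectation (\<lambda>\<omega>. (X n \<omega> * X m \<omega> - expectation (\<lambda>\<omega>. X n \<omega> * X m \<omega>)) * X l \<omega>))"

lemma abs_XX_le: "n \<in> I \<Longrightarrow> m \<in> I \<Longrightarrow> \<omega> \<in> space M \<Longrightarrow> \<bar>X n \<omega> * X m \<omega>\<bar> \<le> a\<^sup>2"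
  unfolding abs_mult power2_eq_square using X_bound by (intro mult_mono') auto

text \<open>The centred pair is expanded to first order in its neighbourhood sum, and each triple
  that arises is replaced by its expectation. The 32 is 8 + 24: the quadratic remainder gives 2 a^2
  (2 h)^2, and the at most 2 D triples give 12 a^3 h each.\<close>

lemma tilted_pair:
  assumes n: "n \<in> I" and m: "m \<in> I"
  shows "norm (tilted z (\<lambda>\<omega>. of_real (X n \<omega> * X m \<omega>))
      - of_real (expectation (\<lambda>\<omega>. X n \<omega> * X m \<omega>)) * Phi z - z * (of_real (kap1 n m) * Phi z))
    \<le> 32 * a\<^sup>2 * (norm z * (D * a))\<^sup>2 * (exp (norm z) * mgf (Re z))"
proof -
  define c where "c = expectation (\<lambda>\<omega>. X n \<omega> * X m \<omega>)"
  define F where "F \<omega> = X n \<omega> * X m \<omega> - c" for \<omega>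
  define e where "e = exp (norm z) * mgf (Re z)"
  have e0: "e \<ge> 0"
    using mgf_pos[of "Re z"] by (simp add: e_def)
  define h where "h = norm z * (D * a)"
  have h0: "h \<ge> 0"
    using a_nonneg by (simp add: h_def)
  have bXX: "bounded_rv (\<lambda>\<omega>. of_real (X n \<omega> * X m \<omega>))"
    using n m by simp
  have bF: "bounded_rv (\<lambda>\<omega>. of_real (F \<omega>))"
    using n m by (simp add: F_def)
  have A: "{n, m} \<subseteq> I"
    using n m by auto
  have c: "\<bar>c\<bar> \<le> a\<^sup>2"
    using norm_expectation_le[of "\<lambda>\<omega>. X n \<omega> * X m \<omega>" "a\<^sup>2"] n m abs_XX_le by (simp add: c_def)
  have Fb: "\<bar>F \<omega>\<bar> \<le> 2 * a\<^sup>2" if "\<omega> \<in> space M" for \<omega>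
    using abs_XX_le[OF n m that] c unfolding F_def by linarith
  have FA: "F \<in> borel_measurable (data_algebra {n, m})"
    using X_meas_in[of n "{n, m}"] X_meas_in[of m "{n, m}"] A unfolding F_def[abs_def] by measurable
  have F0: "expectation F = 0"
    using bounded_rv_real_integrable[OF bXX] unfolding F_def[abs_def] by (simp add: c_def prob_space)
  have card2: "card {n, m} \<le> 2"
    by (simp add: card_insert_if)
  have "norm (tilted z (\<lambda>\<omega>. of_real (F \<omega>)) - z * tilted z (\<lambda>\<omega>. of_real (F \<omega>) * of_real (Y {n, m} \<omega>)))
      \<le> 2 * a\<^sup>2 * ((norm z * (card {n, m} * (D * a)))\<^sup>2 * exp (norm z)) * mgf (Re z)"
    by (rule leave_out_order2[OF A FA Fb F0]) (use card2 in simp_all)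
  also have "\<dots> \<le> 2 * a\<^sup>2 * ((norm z * (2 * (D * a)))\<^sup>2 * exp (norm z)) * mgf (Re z)"
    using card2 a_nonneg mgf_pos[of "Re z"]
    by (intro mult_right_mono mult_left_mono power_mono) auto
  also have "\<dots> = 8 * a\<^sup>2 * h\<^sup>2 * e"
    by (simp add: h_def e_def power_mult_distrib mult_ac)
  finally have 1: "norm (tilted z (\<lambda>\<omega>. of_real (F \<omega>)) - z * tilted z (\<lambda>\<omega>. of_real (F \<omega>) * of_real (Y {n, m} \<omega>))) \<le> 8 * a\<^sup>2 * h\<^sup>2 * e" .
  have 2: "norm (tilted z (\<lambda>\<omega>. of_real (F \<omega> * X l \<omega>)) - of_real (expectation (\<lambda>\<omega>. F \<omega> * X l \<omega>)) * Phi z) \<le> 12 * a ^ 3 * h * e"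
    if "l \<in> I" for l
  proof -
    have "norm (tilted z (\<lambda>\<omega>. of_real (F \<omega> * X l \<omega>)) - of_real (expectation (\<lambda>\<omega>. F \<omega> * X l \<omega>)) * Phi z)
        \<le> 6 * (2 * a\<^sup>2 * a) * (norm z * (D * a)) * (exp (norm z) * mgf (Re z))"
    proof (rule tilted_uncentred)
      show "{n, m, l} \<subseteq> I"
        using A that by auto
      show "(\<lambda>\<omega>. F \<omega> * X l \<omega>) \<in> borel_measurable (data_algebra {n, m, l})"
        using measurable_data_algebra_mono[OF _ FA, of "{n, m, l}"] X_meas_in[of l "{n, m, l}"] A that
        by (intro borel_measurable_times) auto
      show "\<bar>F \<omega> * X l \<omega>\<bar> \<le> 2 * a\<^sup>2 * a" if "\<omega> \<in> space M" for \<omega>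
        unfolding abs_mult using Fb X_bound \<open>l \<in> I\<close> that by (intro mult_mono') auto
      show "card {n, m, l} \<le> 3"
        by (simp add: card_insert_if)
    qed
    then show ?thesis
      by (simp add: h_def e_def power2_eq_square power3_eq_cube mult_ac)
  qed
  have Y: "tilted z (\<lambda>\<omega>. of_real (F \<omega>) * of_real (Y {n, m} \<omega>)) = (\<Sum>l\<in>nb {n, m}. tilted z (\<lambda>\<omega>. of_real (F \<omega> * X l \<omega>)))"
    unfolding Y_def of_real_sum sum_distrib_left of_real_mult using nb_subset[of "{n, m}"] bF
    by (intro tilted_sum) auto
  have "norm (tilted z (\<lambda>\<omega>. of_real (F \<omega>) * of_real (Y {n, m} \<omega>)) - of_real (kap1 n m) * Phi z)
     = norm (\<Sum>l\<in>nb {n, m}. tilted z (\<lambda>\<omega>. of_real (F \<omega> * X l \<omega>)) - of_real (expectation (\<lambda>\<omega>. F \<omega> * X l \<omega>)) * Phi z)"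
    unfolding Y kap1_def c_def[symmetric] F_def[symmetric] by (simp add: sum_subtractf sum_distrib_right)
  also have "\<dots> \<le> card (nb {n, m}) * (12 * a ^ 3 * h * e)"
    using 2 nb_subset[of "{n, m}"] by (intro sum_norm_bound) auto
  also have "\<dots> \<le> real (2 * D) * (12 * a ^ 3 * h * e)"
  proof (intro mult_right_mono)
    have "card (nb {n, m}) \<le> card {n, m} * D"
      by (rule card_nb_le[OF A])
    also have "\<dots> \<le> 2 * D"
      using card2 by (intro mult_right_mono) auto
    finally show "real (card (nb {n, m})) \<le> real (2 * D)"
      by (rule of_nat_mono)
  qed (use a_nonneg h0 e0 in auto)
  finally have 3: "norm (z * (tilted z (\<lambda>\<omega>. of_real (F \<omega>) * of_real (Y {n, m} \<omega>)) - of_real (kap1 n m) * Phi z)) \<le> norm z * (real (2 * D) * (12 * a ^ 3 * h * e))"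
    unfolding norm_mult by (intro mult_left_mono) auto
  have 4: "norm z * (real (2 * D) * (12 * a ^ 3 * h * e)) = 24 * a\<^sup>2 * h\<^sup>2 * e"
    by (simp add: h_def power2_eq_square power3_eq_cube mult_ac)
  have eq: "tilted z (\<lambda>\<omega>. of_real (X n \<omega> * X m \<omega>)) = tilted z (\<lambda>\<omega>. of_real (F \<omega>)) + of_real c * Phi z"
    using bXX by (simp add: F_def tilted_diff tilted_const)
  have "norm (tilted z (\<lambda>\<omega>. of_real (X n \<omega> * X m \<omega>)) - of_real c * Phi z - z * (of_real (kap1 n m) * Phi z))
     = norm ((tilted z (\<lambda>\<omega>. of_real (F \<omega>)) - z * tilted z (\<lambda>\<omega>. of_real (F \<omega>) * of_real (Y {n, m} \<omega>)))
        + z * (tilted z (\<lambda>\<omega>. of_real (F \<omega>) * of_real (Y {n, m} \<omega>)) - of_real (kap1 n m) * Phi z))"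
    unfolding eq by (simp add: algebra_simps)
  also have "\<dots> \<le> 8 * a\<^sup>2 * h\<^sup>2 * e + 24 * a\<^sup>2 * h\<^sup>2 * e"
    using 1 3 unfolding 4 by (rule norm_triangle_mono)
  finally show ?thesis
    by (simp add: c_def h_def e_def mult_ac)
qed

text \<open>The z^2 coefficient of one score. The first sum comes from the linear term of the
  expansion, the second from its quadratic term, which carries the factor -1/2.\<close>

definition kap :: "'i \<Rightarrow> real" where
  "kap n = (\<Sum>m\<in>nb {n}. kap1 n m) - (\<Sum>m\<in>nb {n}. \<Sum>l\<in>nb {n}. expectation (\<lambda>\<omega>. X n \<omega> * X m \<omega> * X l \<omega>)) / 2"

text \<open>The 36 is 1 + 32 + 3: the cubic remainder, the D tilted pairs of the linear term, and
  the D^2 triples of the quadratic term at 6 / 2 each.\<close>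

lemma tilted_X:
  assumes n: "n \<in> I"
  shows "norm (tilted z (\<lambda>\<omega>. of_real (X n \<omega>))
      - (z * of_real (\<Sum>m\<in>nb {n}. expectation (\<lambda>\<omega>. X n \<omega> * X m \<omega>)) + z\<^sup>2 * of_real (kap n)) * Phi z)
    \<le> 36 * a * (norm z * (D * a)) ^ 3 * (exp (norm z) * mgf (Re z))"
proof -
  define e where "e = exp (norm z) * mgf (Re z)"
  have e0: "e \<ge> 0"
    using mgf_pos[of "Re z"] by (simp add: e_def)
  define h where "h = norm z * (D * a)"
  have h0: "h \<ge> 0"
    using a_nonneg by (simp add: h_def)
  have A: "{n} \<subseteq> I"
    using n by auto
  note nbI = nb_subset[of "{n}", THEN subsetD]
  have cardD: "real (card (nb {n})) \<le> real D"
    using card_nb_le[OF A] by simp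
  have "norm (tilted z (\<lambda>\<omega>. of_real (X n \<omega>)) - (z * tilted z (\<lambda>\<omega>. of_real (X n \<omega>) * of_real (Y {n} \<omega>))
      - z\<^sup>2 / 2 * tilted z (\<lambda>\<omega>. of_real (X n \<omega>) * (of_real (Y {n} \<omega>))\<^sup>2)))
    \<le> a * ((norm z * (card {n} * (D * a))) ^ 3 * exp (norm z)) * mgf (Re z)"
    by (rule leave_out_order3[OF A]) (use n X_meas X_bound X_mean in auto)
  then have 1: "norm (tilted z (\<lambda>\<omega>. of_real (X n \<omega>)) - (z * tilted z (\<lambda>\<omega>. of_real (X n \<omega>) * of_real (Y {n} \<omega>))
      - z\<^sup>2 / 2 * tilted z (\<lambda>\<omega>. of_real (X n \<omega>) * (of_real (Y {n} \<omega>))\<^sup>2))) \<le> a * h ^ 3 * e"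
    by (simp add: h_def e_def mult_ac)
  define c where "c = (\<Sum>m\<in>nb {n}. expectation (\<lambda>\<omega>. X n \<omega> * X m \<omega>))"
  define k1 where "k1 = (\<Sum>m\<in>nb {n}. kap1 n m)"
  define k2 where "k2 = (\<Sum>m\<in>nb {n}. \<Sum>l\<in>nb {n}. expectation (\<lambda>\<omega>. X n \<omega> * X m \<omega> * X l \<omega>))"
  define T1 where "T1 = tilted z (\<lambda>\<omega>. of_real (X n \<omega>) * of_real (Y {n} \<omega>))"
  define T2 where "T2 = tilted z (\<lambda>\<omega>. of_real (X n \<omega>) * (of_real (Y {n} \<omega>))\<^sup>2)"
  have T1: "T1 = (\<Sum>m\<in>nb {n}. tilted z (\<lambda>\<omega>. of_real (X n \<omega> * X m \<omega>)))"
    unfolding T1_def Y_def of_real_sum sum_distrib_left of_real_mult using n nbI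
    by (intro tilted_sum) auto
  have "norm (T1 - of_real c * Phi z - z * (of_real k1 * Phi z)) = norm (\<Sum>m\<in>nb {n}. tilted z (\<lambda>\<omega>. of_real (X n \<omega> * X m \<omega>))
      - of_real (expectation (\<lambda>\<omega>. X n \<omega> * X m \<omega>)) * Phi z - z * (of_real (kap1 n m) * Phi z))"
    unfolding T1 c_def k1_def by (simp add: sum_subtractf sum_distrib_right sum_distrib_left)
  also have "\<dots> \<le> card (nb {n}) * (32 * a\<^sup>2 * h\<^sup>2 * e)"
    using tilted_pair[OF n nbI] unfolding h_def e_def by (intro sum_norm_bound) auto
  also have "\<dots> \<le> real D * (32 * a\<^sup>2 * h\<^sup>2 * e)"
    using cardD e0 by (intro mult_right_mono) auto
  finally have "norm (z * (T1 - of_real c * Phi z - z * (of_real k1 * Phi z))) \<le> norm z * (real D * (32 * a\<^sup>2 * h\<^sup>2 * e))"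
    unfolding norm_mult by (intro mult_left_mono) auto
  also have "\<dots> = 32 * a * h ^ 3 * e"
    by (simp add: h_def power2_eq_square power3_eq_cube mult_ac)
  finally have 2: "norm (z * (T1 - of_real c * Phi z - z * (of_real k1 * Phi z))) \<le> 32 * a * h ^ 3 * e" .
  have "T2 = tilted z (\<lambda>\<omega>. \<Sum>m\<in>nb {n}. \<Sum>l\<in>nb {n}. of_real (X n \<omega> * X m \<omega> * X l \<omega>))"
    unfolding T2_def Y_def of_real_sum power2_eq_square sum_product
    unfolding sum_distrib_left of_real_mult mult.assoc ..
  also have "\<dots> = (\<Sum>m\<in>nb {n}. tilted z (\<lambda>\<omega>. \<Sum>l\<in>nb {n}. of_real (X n \<omega> * X m \<omega> * X l \<omega>)))"
    using n nbI by (intro tilted_sum) auto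
  also have "\<dots> = (\<Sum>m\<in>nb {n}. \<Sum>l\<in>nb {n}. tilted z (\<lambda>\<omega>. of_real (X n \<omega> * X m \<omega> * X l \<omega>)))"
    using n nbI by (intro sum.cong refl tilted_sum) auto
  finally have T2: "T2 = (\<Sum>m\<in>nb {n}. \<Sum>l\<in>nb {n}. tilted z (\<lambda>\<omega>. of_real (X n \<omega> * X m \<omega> * X l \<omega>)))" .
  have triple: "norm (tilted z (\<lambda>\<omega>. of_real (X n \<omega> * X m \<omega> * X l \<omega>)) - of_real (expectation (\<lambda>\<omega>. X n \<omega> * X m \<omega> * X l \<omega>)) * Phi z)
      \<le> 6 * a ^ 3 * h * e" if ml: "m \<in> I" "l \<in> I" for m l
  proof -
    have "norm (tilted z (\<lambda>\<omega>. of_real (X n \<omega> * X m \<omega> * X l \<omega>)) - of_real (expectation (\<lambda>\<omega>. X n \<omega> * X m \<omega> * X l \<omega>)) * Phi z)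
        \<le> 6 * (a\<^sup>2 * a) * (norm z * (D * a)) * (exp (norm z) * mgf (Re z))"
    proof (rule tilted_uncentred)
      show "{n, m, l} \<subseteq> I"
        using n ml by auto
      then show "(\<lambda>\<omega>. X n \<omega> * X m \<omega> * X l \<omega>) \<in> borel_measurable (data_algebra {n, m, l})"
        by (intro borel_measurable_times X_meas_in) auto
      show "\<bar>X n \<omega> * X m \<omega> * X l \<omega>\<bar> \<le> a\<^sup>2 * a" if "\<omega> \<in> space M" for \<omega>
        using mult_mono'[OF abs_XX_le X_bound, of n m \<omega> l \<omega>] n ml that by (simp add: abs_mult mult_ac)
      show "card {n, m, l} \<le> 3"
        by (simp add: card_insert_if)
    qed
    then show ?thesis
      by (simp add: h_def e_def power2_eq_square power3_eq_cube mult_ac)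
  qed
  have "norm (T2 - of_real k2 * Phi z) = norm (\<Sum>m\<in>nb {n}. \<Sum>l\<in>nb {n}. tilted z (\<lambda>\<omega>. of_real (X n \<omega> * X m \<omega> * X l \<omega>))
      - of_real (expectation (\<lambda>\<omega>. X n \<omega> * X m \<omega> * X l \<omega>)) * Phi z)"
    unfolding T2 k2_def by (simp add: sum_subtractf sum_distrib_right)
  also have "\<dots> \<le> card (nb {n}) * (card (nb {n}) * (6 * a ^ 3 * h * e))"
    using triple nbI by (intro sum_norm_bound) auto
  also have "\<dots> \<le> D * (D * (6 * a ^ 3 * h * e))"
    using cardD e0 h0 a_nonneg by (intro mult_mono) auto
  finally have "norm (z\<^sup>2 / 2 * (T2 - of_real k2 * Phi z)) \<le> (norm z)\<^sup>2 / 2 * (D * (D * (6 * a ^ 3 * h * e)))"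
    unfolding norm_mult by (intro mult_mono') (auto simp: norm_power norm_divide)
  also have "\<dots> = 3 * a * h ^ 3 * e"
    by (simp add: h_def power2_eq_square power3_eq_cube mult_ac)
  finally have 3: "norm (z\<^sup>2 / 2 * (T2 - of_real k2 * Phi z)) \<le> 3 * a * h ^ 3 * e" .
  have "tilted z (\<lambda>\<omega>. of_real (X n \<omega>)) - (z * of_real c + z\<^sup>2 * of_real (kap n)) * Phi z
      = (tilted z (\<lambda>\<omega>. of_real (X n \<omega>)) - (z * T1 - z\<^sup>2 / 2 * T2))
        + z * (T1 - of_real c * Phi z - z * (of_real k1 * Phi z)) - z\<^sup>2 / 2 * (T2 - of_real k2 * Phi z)"
    unfolding kap_def k1_def[symmetric] k2_def[symmetric] by (simp add: field_simps power2_eq_square)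
  also have "norm \<dots> \<le> a * h ^ 3 * e + 32 * a * h ^ 3 * e + 3 * a * h ^ 3 * e"
    using 1 2 3 unfolding T1_def[symmetric] T2_def[symmetric] by (rule norm_add_diff_le)
  finally show ?thesis
    unfolding c_def h_def e_def by (simp add: mult_ac)
qed

text \<open>Comparison with the Taylor expansion of E[W e^(sW)] / E[e^(sW)] at s = 0 identifies this
  number as half the third moment of W.\<close>

definition kappa :: real where "kappa = (\<Sum>n\<in>I. kap n)"

lemma variance_W: "expectation (\<lambda>\<omega>. (W \<omega>)\<^sup>2) = (\<Sum>n\<in>I. \<Sum>m\<in>nb {n}. expectation (\<lambda>\<omega>. X n \<omega> * X m \<omega>))"
proof -
  have int: "integrable M (\<lambda>\<omega>. X n \<omega> * X m \<omega>)" if "n \<in> I" "m \<in> I" for n m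
    using that by (intro bounded_rv_real_integrable) simp
  have "expectation (\<lambda>\<omega>. (W \<omega>)\<^sup>2) = (\<Sum>n\<in>I. \<Sum>m\<in>I. expectation (\<lambda>\<omega>. X n \<omega> * X m \<omega>))"
    unfolding W_def power2_eq_square sum_product by (simp add: Bochner_Integration.integral_sum int)
  also have "\<dots> = (\<Sum>n\<in>I. \<Sum>m\<in>nb {n}. expectation (\<lambda>\<omega>. X n \<omega> * X m \<omega>))"
  proof (rule sum.cong[OF refl])
    fix n assume n: "n \<in> I"
    show "(\<Sum>m\<in>I. expectation (\<lambda>\<omega>. X n \<omega> * X m \<omega>)) = (\<Sum>m\<in>nb {n}. expectation (\<lambda>\<omega>. X n \<omega> * X m \<omega>))"
    proof (rule sum.mono_neutral_right[OF finite_I nb_subset], rule ballI)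
      fix m assume m: "m \<in> I - nb {n}"
      have "expectation (\<lambda>\<omega>. X n \<omega> * X m \<omega>) = expectation (X n) * expectation (X m)"
        using n m X_meas[of n] X_meas[of m]
        by (intro expectation_mult_unlinked[of "{n}" "{m}"]) (auto intro!: bounded_rv_real_integrable)
      then show "expectation (\<lambda>\<omega>. X n \<omega> * X m \<omega>) = 0"
        using X_mean[OF n] by simp
    qed
  qed
  finally show ?thesis .
qed

text \<open>The third-order term \<open>kappa\<close> is kept, because the remainder then scales like \<open>N D^3 a^4\<close>.\<close>

theorem stein_expansion:
  "norm (tilted z (\<lambda>\<omega>. of_real (W \<omega>)) - (z * of_real (expectation (\<lambda>\<omega>. (W \<omega>)\<^sup>2)) + z\<^sup>2 * of_real kappa) * Phi z)
    \<le> 36 * (card I * D ^ 3 * a ^ 4) * norm z ^ 3 * exp (norm z) * mgf (Re z)"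
proof -
  have "tilted z (\<lambda>\<omega>. of_real (W \<omega>)) = (\<Sum>n\<in>I. tilted z (\<lambda>\<omega>. of_real (X n \<omega>)))"
    unfolding W_def of_real_sum by (intro tilted_sum) simp
  then have "norm (tilted z (\<lambda>\<omega>. of_real (W \<omega>)) - (z * of_real (expectation (\<lambda>\<omega>. (W \<omega>)\<^sup>2)) + z\<^sup>2 * of_real kappa) * Phi z)
    = norm (\<Sum>n\<in>I. tilted z (\<lambda>\<omega>. of_real (X n \<omega>))
      - (z * of_real (\<Sum>m\<in>nb {n}. expectation (\<lambda>\<omega>. X n \<omega> * X m \<omega>)) + z\<^sup>2 * of_real (kap n)) * Phi z)"
    unfolding variance_W kappa_def
    by (simp add: sum_subtractf sum_distrib_right sum_distrib_left distrib_right sum.distrib)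
  also have "\<dots> \<le> card I * (36 * a * (norm z * (D * a)) ^ 3 * (exp (norm z) * mgf (Re z)))"
    by (intro sum_norm_bound tilted_X)
  finally show ?thesis
    by (simp add: power_mult_distrib mult_ac power3_eq_cube power4_eq_xxxx)
qed

section \<open>Monotonicity of the logarithmic derivative of the moment generating function\<close>

definition mgf1 :: "real \<Rightarrow> real" where "mgf1 s = expectation (\<lambda>\<omega>. W \<omega> * exp (s * W \<omega>))"

lemma integrable_W_exp_W [simp]: "integrable M (\<lambda>\<omega>. W \<omega> * exp (s * W \<omega>))"
proof (rule bounded_rv_real_integrable)
  have "bounded_rv (\<lambda>\<omega>. of_real (W \<omega>) * exp (of_real s * of_real (W \<omega>)))"
    by simp
  then show "bounded_rv (\<lambda>\<omega>. of_real (W \<omega> * exp (s * W \<omega>)))"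
    by (simp flip: exp_of_real)
qed

text \<open>The quotient is the derivative of \<open>ln mgf\<close>. Its monotonicity is a
  correlation inequality: W and e^((t-s)W) are both increasing in W, hence positively correlated
  under the tilt by s.\<close>

lemma mgf_log_convex:
  assumes "s \<le> t"
  shows "mgf1 s / mgf s \<le> mgf1 t / mgf t"
proof -
  \<comment> \<open>The mean of W under the tilt by s. \<open>W \<omega> - c\<close> integrates to
    zero there, and it has the same sign as the difference of the two exponentials.\<close>
  define c where "c = mgf1 s / mgf s"
  have "expectation (\<lambda>\<omega>. exp ((t - s) * c) * ((W \<omega> - c) * exp (s * W \<omega>))) \<le> expectation (\<lambda>\<omega>. (W \<omega> - c) * exp (t * W \<omega>))"
  proof (rule integral_mono)
    show "integrable M (\<lambda>\<omega>. exp ((t - s) * c) * ((W \<omega> - c) * exp (s * W \<omega>)))"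
      by (intro integrable_mult_right) (simp add: left_diff_distrib)
    show "integrable M (\<lambda>\<omega>. (W \<omega> - c) * exp (t * W \<omega>))"
      by (simp add: left_diff_distrib)
    fix \<omega>
    have "0 \<le> (W \<omega> - c) * (exp ((t - s) * W \<omega>) - exp ((t - s) * c))"
    proof (cases "W \<omega> \<le> c")
      case True
      with assms show ?thesis
        by (intro mult_nonpos_nonpos) (auto intro: mult_left_mono)
    next
      case False
      with assms show ?thesis
        by (intro mult_nonneg_nonneg) (auto intro: mult_left_mono)
    qed
    then have "0 \<le> exp (s * W \<omega>) * ((W \<omega> - c) * (exp ((t - s) * W \<omega>) - exp ((t - s) * c)))"
      by simp
    also have "\<dots> = (W \<omega> - c) * (exp (s * W \<omega>) * exp ((t - s) * W \<omega>)) - exp ((t - s) * c) * ((W \<omega> - c) * exp (s * W \<omega>))"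
      by (simp add: algebra_simps)
    also have "exp (s * W \<omega>) * exp ((t - s) * W \<omega>) = exp (t * W \<omega>)"
      by (simp add: exp_add[symmetric] algebra_simps)
    finally show "exp ((t - s) * c) * ((W \<omega> - c) * exp (s * W \<omega>)) \<le> (W \<omega> - c) * exp (t * W \<omega>)"
      by simp
  qed
  also have "expectation (\<lambda>\<omega>. (W \<omega> - c) * exp (t * W \<omega>)) = mgf1 t - c * mgf t"
    by (simp add: left_diff_distrib mgf1_def mgf_def)
  also have "expectation (\<lambda>\<omega>. exp ((t - s) * c) * ((W \<omega> - c) * exp (s * W \<omega>))) = exp ((t - s) * c) * (mgf1 s - c * mgf s)"
    by (simp add: left_diff_distrib mgf1_def mgf_def)
  also have "mgf1 s - c * mgf s = 0"
    using mgf_pos[of s] by (simp add: c_def)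
  finally show ?thesis
    using mgf_pos[of t] by (simp add: c_def[symmetric] field_simps)
qed

lemma mgf_expansion:
  "\<bar>mgf1 s / mgf s - (s * expectation (\<lambda>\<omega>. (W \<omega>)\<^sup>2) + s\<^sup>2 * kappa)\<bar>
    \<le> 36 * (card I * D ^ 3 * a ^ 4) * \<bar>s\<bar> ^ 3 * exp \<bar>s\<bar>"
proof -
  let ?v = "expectation (\<lambda>\<omega>. (W \<omega>)\<^sup>2)"
  have e: "exp (complex_of_real s * of_real (W \<omega>)) = of_real (exp (s * W \<omega>))" for \<omega>
    by (simp only: exp_of_real flip: of_real_mult)
  have "tilted (of_real s) (\<lambda>\<omega>. of_real (W \<omega>)) = of_real (mgf1 s)"
    unfolding tilted_def mgf1_def of_real_mult[symmetric] exp_of_real by (rule integral_complex_of_real)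
  moreover have "Phi (of_real s) = of_real (mgf s)"
    unfolding Phi_def mgf_def e by (rule integral_complex_of_real)
  ultimately have "norm (complex_of_real (mgf1 s - (s * ?v + s\<^sup>2 * kappa) * mgf s))
    \<le> 36 * (card I * D ^ 3 * a ^ 4) * \<bar>s\<bar> ^ 3 * exp \<bar>s\<bar> * mgf s"
    using stein_expansion[of "of_real s"] by simp
  then have "\<bar>mgf1 s - (s * ?v + s\<^sup>2 * kappa) * mgf s\<bar> \<le> 36 * (card I * D ^ 3 * a ^ 4) * \<bar>s\<bar> ^ 3 * exp \<bar>s\<bar> * mgf s"
    by (simp only: norm_of_real)
  moreover have "mgf1 s - (s * ?v + s\<^sup>2 * kappa) * mgf s = (mgf1 s / mgf s - (s * ?v + s\<^sup>2 * kappa)) * mgf s"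
    using mgf_pos[of s] by (simp add: field_simps)
  ultimately show ?thesis
    using mgf_pos[of s] by (simp add: abs_mult)
qed

text \<open>The derivative of \<open>ln mgf\<close> is nondecreasing and close to \<open>s v + s^2 kappa\<close>, which is
  monotone on \<open>[-2 L, 2 L]\<close> only if \<open>kappa\<close> is small.\<close>

lemma kappa_le:
  assumes L: "L > 0"
  shows "3 * L\<^sup>2 * \<bar>kappa\<bar> \<le> L * expectation (\<lambda>\<omega>. (W \<omega>)\<^sup>2) + 576 * (card I * D ^ 3 * a ^ 4) * L ^ 3 * exp (2 * L)"
proof -
  define v where "v = expectation (\<lambda>\<omega>. (W \<omega>)\<^sup>2)"
  define f where "f s = mgf1 s / mgf s" for s
  \<comment> \<open>The error of \<open>f\<close> uniformly over |s| <= 2 L; 288 is 36 times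
    2^3.\<close>
  define r where "r = 288 * (card I * D ^ 3 * a ^ 4) * L ^ 3 * exp (2 * L)"
  have f: "\<bar>f s - (s * v + s\<^sup>2 * kappa)\<bar> \<le> r" if "\<bar>s\<bar> \<le> 2 * L" for s
  proof -
    have "\<bar>f s - (s * v + s\<^sup>2 * kappa)\<bar> \<le> 36 * (card I * D ^ 3 * a ^ 4) * \<bar>s\<bar> ^ 3 * exp \<bar>s\<bar>"
      unfolding f_def v_def by (rule mgf_expansion)
    also have "\<dots> \<le> 36 * (card I * D ^ 3 * a ^ 4) * (2 * L) ^ 3 * exp (2 * L)"
      using that a_nonneg by (intro mult_mono power_mono) auto
    finally show ?thesis
      by (simp add: r_def power_mult_distrib)
  qed
  \<comment> \<open>The step from -2 L to -L bounds \<open>kappa\<close> from above, the step from L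
    to 2 L bounds it from below.\<close>
  have "f (- (2 * L)) \<le> f (- L)" "f L \<le> f (2 * L)"
    unfolding f_def using L by (intro mgf_log_convex; simp)+
  moreover have "\<bar>f (- (2 * L)) - (- 2 * (L * v) + 4 * (L\<^sup>2 * kappa))\<bar> \<le> r" "\<bar>f (- L) - (- (L * v) + L\<^sup>2 * kappa)\<bar> \<le> r"
    "\<bar>f L - (L * v + L\<^sup>2 * kappa)\<bar> \<le> r" "\<bar>f (2 * L) - (2 * (L * v) + 4 * (L\<^sup>2 * kappa))\<bar> \<le> r"
    using f[of "- (2 * L)"] f[of "- L"] f[of L] f[of "2 * L"] L by (simp_all add: power_mult_distrib mult.assoc)
  ultimately have "3 * (L\<^sup>2 * kappa) \<le> L * v + 2 * r" "- (3 * (L\<^sup>2 * kappa)) \<le> L * v + 2 * r"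
    unfolding abs_le_iff by linarith+
  then have "\<bar>3 * (L\<^sup>2 * kappa)\<bar> \<le> L * v + 2 * r"
    by linarith
  then show ?thesis
    by (simp add: abs_mult r_def v_def mult.assoc)
qed

section \<open>The characteristic function as an approximate solution of a differential
  equation\<close>

lemma norm_Phi_imaginary_le: "norm (Phi (\<i> * of_real t)) \<le> 1"
proof -
  have "norm (tilted (\<i> * of_real t) (\<lambda>\<omega>. 1)) \<le> 1 * mgf (Re (\<i> * of_real t))"
    by (rule norm_tilted_le) auto
  then show ?thesis
    by (simp add: tilted_const mgf_def prob_space)
qed

lemma Phi_has_derivative:
  "((\<lambda>t. Phi (\<i> * of_real t)) has_vector_derivative (\<i> * tilted (\<i> * of_real t) (\<lambda>\<omega>. of_real (W \<omega>)))) (at t within S)"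
  unfolding has_vector_derivative_def
proof (rule has_derivativeI_sandwich[of 1])
  let ?z = "\<i> * of_real t"
  let ?B = "(card I * a)\<^sup>2"
  show "bounded_linear (\<lambda>h. h *\<^sub>R (\<i> * tilted ?z (\<lambda>\<omega>. of_real (W \<omega>))))"
    by (rule bounded_linear_scaleR_left)
  show "((\<lambda>u. ?B * norm (u - t)) \<longlongrightarrow> 0) (at t within S)"
    by (rule tendsto_eq_intros | simp)+
  fix u assume "u \<noteq> t"
  define h where "h = u - t"
  let ?r = "\<lambda>\<omega>. iexp (h * W \<omega>) - 1 - \<i> * of_real h * of_real (W \<omega>)"
  have br: "bounded_rv ?r"
    by simp
  have "Phi (\<i> * of_real u) = tilted ?z (\<lambda>\<omega>. iexp (h * W \<omega>))"
    unfolding Phi_def tilted_def by (simp add: exp_add[symmetric] h_def algebra_simps)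
  then have "Phi (\<i> * of_real u) - Phi ?z - (u - t) *\<^sub>R (\<i> * tilted ?z (\<lambda>\<omega>. of_real (W \<omega>))) = tilted ?z ?r"
    by (simp add: tilted_diff tilted_const tilted_cmult scaleR_conv_of_real h_def mult_ac)
  also have "norm \<dots> \<le> h\<^sup>2 * ?B * mgf (Re ?z)"
  proof (rule norm_tilted_le[OF br])
    fix \<omega> assume \<omega>: "\<omega> \<in> space M"
    have "norm (?r \<omega>) \<le> \<bar>h * W \<omega>\<bar>\<^sup>2 / 2"
      using iexp_approx1[of "h * W \<omega>" 1] by (simp add: power2_eq_square algebra_simps)
    also have "\<dots> \<le> \<bar>h * W \<omega>\<bar>\<^sup>2"
      by simp
    also have "\<dots> = h\<^sup>2 * \<bar>W \<omega>\<bar>\<^sup>2"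
      by (simp add: power_mult_distrib)
    also have "\<dots> \<le> h\<^sup>2 * ?B"
      using abs_W_le[OF \<omega>] by (intro mult_left_mono power_mono) auto
    finally show "norm (?r \<omega>) \<le> h\<^sup>2 * ?B" .
  qed
  finally have "norm (Phi (\<i> * of_real u) - Phi ?z - (u - t) *\<^sub>R (\<i> * tilted ?z (\<lambda>\<omega>. of_real (W \<omega>)))) \<le> h\<^sup>2 * ?B"
    by (simp only: mgf_def) (simp add: prob_space)
  then have "norm (Phi (\<i> * of_real u) - Phi ?z - (u - t) *\<^sub>R (\<i> * tilted ?z (\<lambda>\<omega>. of_real (W \<omega>)))) \<le> ?B * norm h * norm h"
    using power2_abs[of h] by (simp only: power2_eq_square real_norm_def mult_ac)
  then show "norm (Phi (\<i> * of_real u) - Phi ?z - (u - t) *\<^sub>R (\<i> * tilted ?z (\<lambda>\<omega>. of_real (W \<omega>)))) / norm (u - t) \<le> ?B * norm (u - t)"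
    using \<open>u \<noteq> t\<close> unfolding h_def[symmetric] by (subst pos_divide_le_eq) (simp_all add: h_def)
qed simp

text \<open>The integrating factor e^(t^2 v / 2) cancels the Gaussian drift, so that the derivative
  of the product contains only the \<open>kappa\<close> term and the Stein remainder. The value at t
  = 1 suffices because a frequency can be absorbed into the scores.\<close>

theorem char_function_close_to_gaussian:
  defines "v \<equiv> expectation (\<lambda>\<omega>. (W \<omega>)\<^sup>2)"
  shows "norm (Phi \<i> - of_real (exp (- v / 2))) \<le> \<bar>kappa\<bar> + 36 * exp 1 * (card I * D ^ 3 * a ^ 4)"
proof -
  define \<Delta> where "\<Delta> = card I * D ^ 3 * a ^ 4"
  have \<Delta>0: "\<Delta> \<ge> 0"
    using a_nonneg by (simp add: \<Delta>_def)
  have v0: "v \<ge> 0"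
    unfolding v_def by (rule integral_nonneg_AE) auto
  define g where "g t = complex_of_real (exp (t\<^sup>2 * v / 2)) * Phi (\<i> * of_real t)" for t :: real
  define T where "T t = tilted (\<i> * of_real t) (\<lambda>\<omega>. of_real (W \<omega>))" for t :: real
  define g' where "g' t = complex_of_real (exp (t\<^sup>2 * v / 2)) * (\<i> * T t) + of_real (exp (t\<^sup>2 * v / 2) * (t * v)) * Phi (\<i> * of_real t)" for t :: real
  have der: "(g has_vector_derivative g' t) (at t)" for t
  proof -
    have "((\<lambda>t. exp (t\<^sup>2 * v / 2)) has_vector_derivative exp (t\<^sup>2 * v / 2) * (t * v)) (at t)"
      by (auto intro!: derivative_eq_intros simp flip: has_real_derivative_iff_has_vector_derivative)
    then have "((\<lambda>t. complex_of_real (exp (t\<^sup>2 * v / 2))) has_vector_derivative of_real (exp (t\<^sup>2 * v / 2) * (t * v))) (at t)"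
      by (rule bounded_linear.has_vector_derivative[OF bounded_linear_of_real])
    from has_vector_derivative_mult[OF this Phi_has_derivative[of t UNIV]] show ?thesis
      unfolding g_def[abs_def] g'_def T_def by simp
  qed
  have bound: "norm (g' t) \<le> exp (v / 2) * (\<bar>kappa\<bar> + 36 * exp 1 * \<Delta>)" if t: "t \<in> {0..1}" for t
  proof -
    let ?z = "\<i> * of_real t" and ?P = "Phi (\<i> * of_real t)"
    have tt: "0 \<le> t" "t \<le> 1" "t\<^sup>2 \<le> 1" "t ^ 3 \<le> 1"
      using t by (auto simp: power_le_one)
    have "norm (T t - (?z * of_real v + ?z\<^sup>2 * of_real kappa) * ?P) \<le> 36 * \<Delta> * norm ?z ^ 3 * exp (norm ?z) * mgf (Re ?z)"
      unfolding T_def v_def \<Delta>_def by (rule stein_expansion)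
    also have "\<dots> = 36 * \<Delta> * t ^ 3 * exp t"
      using tt by (simp add: mgf_def prob_space norm_mult)
    also have "\<dots> \<le> 36 * \<Delta> * 1 * exp 1"
      using tt \<Delta>0 by (intro mult_mono) auto
    finally have 1: "norm (T t - (?z * of_real v + ?z\<^sup>2 * of_real kappa) * ?P) \<le> 36 * exp 1 * \<Delta>"
      by (simp add: mult_ac)
    have 2: "norm (?z\<^sup>2 * of_real kappa * ?P) \<le> \<bar>kappa\<bar>"
    proof -
      have "norm (?z\<^sup>2 * of_real kappa * ?P) = t\<^sup>2 * \<bar>kappa\<bar> * norm ?P"
        by (simp add: norm_mult norm_power)
      also have "\<dots> \<le> 1 * \<bar>kappa\<bar> * 1"
        using tt norm_Phi_imaginary_le by (intro mult_mono) auto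
      finally show ?thesis
        by simp
    qed
    have "g' t = of_real (exp (t\<^sup>2 * v / 2)) * (\<i> * ((T t - (?z * of_real v + ?z\<^sup>2 * of_real kappa) * ?P) + ?z\<^sup>2 * of_real kappa * ?P))"
      by (simp add: g'_def algebra_simps)
    then have "norm (g' t) = exp (t\<^sup>2 * v / 2) * norm ((T t - (?z * of_real v + ?z\<^sup>2 * of_real kappa) * ?P) + ?z\<^sup>2 * of_real kappa * ?P)"
      by (simp only: norm_mult norm_of_real norm_ii abs_exp_cancel mult_1_left)
    also have "\<dots> \<le> exp (v / 2) * (36 * exp 1 * \<Delta> + \<bar>kappa\<bar>)"
      using tt v0 1 2 by (intro mult_mono norm_triangle_mono) (auto simp: mult_left_le_one_le)
    finally show ?thesis
      by (simp add: add.commute)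
  qed
  have "continuous_on {0..1} g"
    using der has_vector_derivative_continuous continuous_at_imp_continuous_on by blast
  \<comment> \<open>For complex values the mean value theorem survives only as an inequality of
    norms.\<close>
  from mvt_general[OF _ this, of "\<lambda>t h. h *\<^sub>R g' t"] der
  obtain t where "t \<in> {0<..<1}" "norm (g 1 - g 0) \<le> norm (g' t)"
    by (auto simp: has_vector_derivative_def)
  with bound[of t] have "norm (g 1 - g 0) \<le> exp (v / 2) * (\<bar>kappa\<bar> + 36 * exp 1 * \<Delta>)"
    by auto
  moreover have "g 0 = 1"
    by (simp add: g_def Phi_def prob_space)
  moreover have "g 1 - 1 = of_real (exp (v / 2)) * (Phi \<i> - of_real (exp (- v / 2)))"
    by (simp add: g_def right_diff_distrib flip: of_real_mult exp_add)
  ultimately have "exp (v / 2) * norm (Phi \<i> - of_real (exp (- v / 2))) \<le> exp (v / 2) * (\<bar>kappa\<bar> + 36 * exp 1 * \<Delta>)"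
    by (simp add: norm_mult)
  then show ?thesis
    by (simp add: \<Delta>_def)
qed

text \<open>\<open>L\<close> is a free parameter: taken large it makes the first term small, and
  once it is fixed the second term vanishes with the rate.\<close>

lemma char_function_bound:
  assumes L: "L > 0"
  defines "v \<equiv> expectation (\<lambda>\<omega>. (W \<omega>)\<^sup>2)"
  shows "norm ((\<integral>\<omega>. iexp (W \<omega>) \<partial>M) - of_real (exp (- v / 2)))
    \<le> v / (3 * L) + (192 * L * exp (2 * L) + 36 * exp 1) * (card I * D ^ 3 * a ^ 4)"
proof -
  have "\<bar>kappa\<bar> = 3 * L\<^sup>2 * \<bar>kappa\<bar> / (3 * L\<^sup>2)"
    using L by simp
  also have "\<dots> \<le> (L * v + 576 * (card I * D ^ 3 * a ^ 4) * L ^ 3 * exp (2 * L)) / (3 * L\<^sup>2)"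
    unfolding v_def by (intro divide_right_mono kappa_le L) simp
  also have "\<dots> = v / (3 * L) + 192 * L * exp (2 * L) * (card I * D ^ 3 * a ^ 4)"
    using L by (simp add: field_simps power2_eq_square power3_eq_cube)
  finally have k: "\<bar>kappa\<bar> \<le> v / (3 * L) + 192 * L * exp (2 * L) * (card I * D ^ 3 * a ^ 4)" .
  have "norm (Phi \<i> - of_real (exp (- v / 2))) \<le> \<bar>kappa\<bar> + 36 * exp 1 * (card I * D ^ 3 * a ^ 4)"
    unfolding v_def by (rule char_function_close_to_gaussian)
  with k show ?thesis
    by (simp add: Phi_def algebra_simps)
qed

end

section \<open>Convergence to the chi-square distribution\<close>

text \<open>All variables live in the compact interval [0, 1], where polynomials approximate
  \<open>g\<close> uniformly; convergence of the moments then passes to \<open>g\<close> by a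
  three-epsilon argument.\<close>

lemma moments_imp_tendsto_continuous:
  fixes U :: "nat \<Rightarrow> 'a \<Rightarrow> real" and V :: "'b \<Rightarrow> real" and g :: "real \<Rightarrow> real"
  assumes M: "\<And>n. prob_space (M n)" and P: "prob_space P"
    and U: "\<And>n. U n \<in> borel_measurable (M n)" "\<And>n \<omega>. \<omega> \<in> space (M n) \<Longrightarrow> U n \<omega> \<in> {0..1}"
    and V: "V \<in> borel_measurable P" "\<And>\<omega>. \<omega> \<in> space P \<Longrightarrow> V \<omega> \<in> {0..1}"
    and moments: "\<And>j. (\<lambda>n. \<integral>\<omega>. U n \<omega> ^ j \<partial>M n) \<longlonglongrightarrow> (\<integral>\<omega>. V \<omega> ^ j \<partial>P)"
    and g: "continuous_on UNIV g"
  shows "(\<lambda>n. \<integral>\<omega>. g (U n \<omega>) \<partial>M n) \<longlonglongrightarrow> (\<integral>\<omega>. g (V \<omega>) \<partial>P)"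
proof (rule LIMSEQ_I)
  fix r :: real assume "r > 0"
  define e where "e = r / 3"
  have e: "e > 0"
    using \<open>r > 0\<close> by (simp add: e_def)
  obtain h where h: "real_polynomial_function h" and gh: "\<And>x. x \<in> {0..1} \<Longrightarrow> \<bar>g x - h x\<bar> < e"
    using Stone_Weierstrass_real_polynomial_function[of "{0..1::real}" g e] e
      continuous_on_subset[OF g subset_UNIV] by auto
  obtain c m where hc: "h = (\<lambda>x. \<Sum>i\<le>m. c i * x ^ i)"
    using h real_polynomial_function_iff_sum by blast
  \<comment> \<open>Stated for an arbitrary probability space since it is applied both along the
    sequence and at the limit.\<close>
  have approx: "integrable L (\<lambda>\<omega>. F \<omega> ^ j)" "\<bar>(\<integral>\<omega>. g (F \<omega>) \<partial>L) - (\<integral>\<omega>. h (F \<omega>) \<partial>L)\<bar> \<le> e"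
    if L: "prob_space L" and F: "F \<in> borel_measurable L" "\<And>\<omega>. \<omega> \<in> space L \<Longrightarrow> F \<omega> \<in> {0..1}"
    for L :: "'c measure" and F j
  proof -
    interpret prob_space L by fact
    show pow: "integrable L (\<lambda>\<omega>. F \<omega> ^ j)" for j
      using F by (intro integrable_const_bound[of _ 1]) (auto intro!: AE_I2 simp: abs_le_iff power_le_one intro: order_trans[of _ 0])
    have ih: "integrable L (\<lambda>\<omega>. h (F \<omega>))"
      unfolding hc using pow by auto
    have gm: "(\<lambda>\<omega>. g (F \<omega>)) \<in> borel_measurable L"
      by (rule measurable_compose[OF F(1)]) (rule borel_measurable_continuous_onI[OF g])
    have b: "\<bar>g (F \<omega>) - h (F \<omega>)\<bar> \<le> e" if "\<omega> \<in> space L" for \<omega>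
      using gh[OF F(2)[OF that]] by simp
    have id: "integrable L (\<lambda>\<omega>. g (F \<omega>) - h (F \<omega>))"
      using b ih gm by (intro integrable_const_bound[of _ e]) auto
    then have ig: "integrable L (\<lambda>\<omega>. g (F \<omega>))"
      using Bochner_Integration.integrable_add[OF id ih] by simp
    have "\<bar>(\<integral>\<omega>. g (F \<omega>) \<partial>L) - (\<integral>\<omega>. h (F \<omega>) \<partial>L)\<bar> = \<bar>\<integral>\<omega>. g (F \<omega>) - h (F \<omega>) \<partial>L\<bar>"
      using ig ih by simp
    also have "\<dots> \<le> (\<integral>\<omega>. \<bar>g (F \<omega>) - h (F \<omega>)\<bar> \<partial>L)"
      by (rule integral_abs_bound)
    also have "\<dots> \<le> (\<integral>\<omega>. e \<partial>L)"
      using id b by (intro integral_mono) auto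
    finally show "\<bar>(\<integral>\<omega>. g (F \<omega>) \<partial>L) - (\<integral>\<omega>. h (F \<omega>) \<partial>L)\<bar> \<le> e"
      by (simp add: prob_space)
  qed
  have "(\<lambda>n. \<integral>\<omega>. h (U n \<omega>) \<partial>M n) \<longlonglongrightarrow> (\<integral>\<omega>. h (V \<omega>) \<partial>P)"
    unfolding hc using approx(1)[OF M U] approx(1)[OF P V] moments
    by (simp add: Bochner_Integration.integral_sum) (intro tendsto_intros)
  from LIMSEQ_D[OF this e] obtain n0
    where n0: "\<forall>n\<ge>n0. norm ((\<integral>\<omega>. h (U n \<omega>) \<partial>M n) - (\<integral>\<omega>. h (V \<omega>) \<partial>P)) < e"
    by blast
  show "\<exists>no. \<forall>n\<ge>no. norm ((\<integral>\<omega>. g (U n \<omega>) \<partial>M n) - (\<integral>\<omega>. g (V \<omega>) \<partial>P)) < r"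
  proof (intro exI allI impI)
    fix n assume "n \<ge> n0"
    with n0 have "norm ((\<integral>\<omega>. h (U n \<omega>) \<partial>M n) - (\<integral>\<omega>. h (V \<omega>) \<partial>P)) < e"
      by blast
    with approx(2)[OF M U, of n] approx(2)[OF P V]
    show "norm ((\<integral>\<omega>. g (U n \<omega>) \<partial>M n) - (\<integral>\<omega>. g (V \<omega>) \<partial>P)) < r"
      unfolding e_def real_norm_def by linarith
  qed
qed

text \<open>Convergence of the Laplace transforms at the integers gives convergence of the moments of
  \<open>exp (- Y)\<close>, a variable on \<open>[0, 1]\<close>.\<close>

lemma laplace_imp_tail_le:
  fixes Y :: "nat \<Rightarrow> 'a \<Rightarrow> real" and Z :: "'b \<Rightarrow> real"
  assumes M: "\<And>n. prob_space (M n)" and P: "prob_space P"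
    and Y: "\<And>n. Y n \<in> borel_measurable (M n)" "\<And>n \<omega>. \<omega> \<in> space (M n) \<Longrightarrow> 0 \<le> Y n \<omega>"
    and Z: "Z \<in> borel_measurable P" "\<And>\<omega>. \<omega> \<in> space P \<Longrightarrow> 0 \<le> Z \<omega>"
    and laplace: "\<And>j::nat. (\<lambda>n. \<integral>\<omega>. exp (- (real j * Y n \<omega>)) \<partial>M n) \<longlonglongrightarrow> (\<integral>\<omega>. exp (- (real j * Z \<omega>)) \<partial>P)"
    and "c1 < c2" "e > 0"
  shows "eventually (\<lambda>n. measure (M n) {\<omega>\<in>space (M n). c2 \<le> Y n \<omega>} \<le> measure P {\<omega>\<in>space P. c1 < Z \<omega>} + e) sequentially"
proof -
  interpret P: prob_space P by fact
  \<comment> \<open>A linear ramp in x = e^(-y): it is 1 once y >= c2 and 0 while y <= c1. The gap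
    between the thresholds is the price of a continuous test function.\<close>
  define g where "g x = max 0 (min 1 ((exp (- c1) - x) / (exp (- c1) - exp (- c2))))" for x :: real
  have pos: "exp (- c1) - exp (- c2) > 0"
    using \<open>c1 < c2\<close> by simp
  have g01: "0 \<le> g x" "g x \<le> 1" for x
    by (auto simp: g_def)
  have g1: "g x = 1" if "x \<le> exp (- c2)" for x
  proof -
    have "(exp (- c1) - x) / (exp (- c1) - exp (- c2)) \<ge> 1"
      using that pos by (subst le_divide_eq_1_pos) auto
    then show ?thesis
      by (simp add: g_def)
  qed
  have g0: "g x = 0" if "x \<ge> exp (- c1)" for x
  proof -
    have "(exp (- c1) - x) / (exp (- c1) - exp (- c2)) \<le> 0"
      using that pos by (intro divide_nonpos_pos) auto
    then show ?thesis
      by (simp add: g_def)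
  qed
  have cg: "continuous_on UNIV g"
    unfolding g_def using pos by (intro continuous_intros) auto
  have gm [measurable]: "g \<in> borel_measurable borel"
    by (rule borel_measurable_continuous_onI[OF cg])
  note [measurable] = Y(1) Z(1)
  have lim: "(\<lambda>n. \<integral>\<omega>. g (exp (- Y n \<omega>)) \<partial>M n) \<longlonglongrightarrow> (\<integral>\<omega>. g (exp (- Z \<omega>)) \<partial>P)"
  proof (rule moments_imp_tendsto_continuous[OF M P _ _ _ _ _ cg])
    show "(\<lambda>n. \<integral>\<omega>. exp (- Y n \<omega>) ^ j \<partial>M n) \<longlonglongrightarrow> (\<integral>\<omega>. exp (- Z \<omega>) ^ j \<partial>P)" for j
      using laplace[of j] by (simp add: exp_of_nat_mult[symmetric])
  qed (use Y Z in auto)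
  have upper: "(\<integral>\<omega>. g (exp (- Z \<omega>)) \<partial>P) \<le> measure P {\<omega>\<in>space P. c1 < Z \<omega>}"
  proof -
    have "(\<integral>\<omega>. g (exp (- Z \<omega>)) \<partial>P) \<le> (\<integral>\<omega>. indicator {\<omega>\<in>space P. c1 < Z \<omega>} \<omega> \<partial>P)"
    proof (rule integral_mono)
      show "integrable P (\<lambda>\<omega>. g (exp (- Z \<omega>)))"
        using g01 by (intro P.integrable_const_bound[of _ 1]) auto
      show "g (exp (- Z \<omega>)) \<le> indicator {\<omega>\<in>space P. c1 < Z \<omega>} \<omega>" if "\<omega> \<in> space P" for \<omega>
        using that g01 g0[of "exp (- Z \<omega>)"] by (auto simp: indicator_def)
    qed (auto simp: P.emeasure_eq_measure)
    then show ?thesis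
      by simp
  qed
  have lower: "measure (M n) {\<omega>\<in>space (M n). c2 \<le> Y n \<omega>} \<le> (\<integral>\<omega>. g (exp (- Y n \<omega>)) \<partial>M n)" for n
  proof -
    interpret prob_space "M n" by (rule M)
    have "(\<integral>\<omega>. indicator {\<omega>\<in>space (M n). c2 \<le> Y n \<omega>} \<omega> \<partial>M n) \<le> (\<integral>\<omega>. g (exp (- Y n \<omega>)) \<partial>M n)"
    proof (rule integral_mono)
      show "integrable (M n) (\<lambda>\<omega>. g (exp (- Y n \<omega>)))"
        using g01 by (intro integrable_const_bound[of _ 1]) auto
      show "indicator {\<omega>\<in>space (M n). c2 \<le> Y n \<omega>} \<omega> \<le> g (exp (- Y n \<omega>))" for \<omega>
        using g01 g1[of "exp (- Y n \<omega>)"] by (auto simp: indicator_def)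
    qed (auto simp: emeasure_eq_measure)
    then show ?thesis
      by simp
  qed
  have "eventually (\<lambda>n. (\<integral>\<omega>. g (exp (- Y n \<omega>)) \<partial>M n) < (\<integral>\<omega>. g (exp (- Z \<omega>)) \<partial>P) + e) sequentially"
    by (rule order_tendstoD(2)[OF lim]) (use \<open>e > 0\<close> in simp)
  then show ?thesis
  proof eventually_elim
    case (elim n)
    with lower[of n] upper show ?case
      by linarith
  qed
qed

section \<open>Gaussian averages of characteristic functions\<close>

abbreviation gauss_product :: "nat \<Rightarrow> (nat \<Rightarrow> real) measure" where
  "gauss_product q \<equiv> Pi\<^sub>M {..<q} (\<lambda>_. std_normal_distribution)"

lemma prob_space_std_normal: "prob_space std_normal_distribution"
  using real_dist_normal_dist by (simp add: real_distribution_def)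

lemma product_prob_space_std_normal: "product_prob_space (\<lambda>_::nat. std_normal_distribution)"
  using prob_space_std_normal by (simp add: product_prob_spaceI)

lemma prob_space_gauss_product: "prob_space (gauss_product q)"
  by (intro prob_space_PiM prob_space_std_normal)

lemma measurable_gauss_component:
  "i < q \<Longrightarrow> (\<lambda>z. z i) \<in> borel_measurable (gauss_product q)"
  using measurable_component_singleton[of i "{..<q}" "\<lambda>_. std_normal_distribution"] by simp

lemma sum_squares_measurable [measurable]:
  "(\<lambda>z. \<Sum>i<q. (z i)\<^sup>2) \<in> borel_measurable (gauss_product q)"
  by (intro borel_measurable_sum borel_measurable_power measurable_gauss_component) auto

lemma integrable_iexp_std_normal: "integrable std_normal_distribution (\<lambda>x. iexp (t * x))"
  by (rule prob_space.integrable_iexp[OF prob_space_std_normal]) simp_all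

lemma char_gauss_product:
  "(\<integral>z. iexp (\<Sum>i<q. z i * t i) \<partial>gauss_product q) = of_real (exp (- (\<Sum>i<q. (t i)\<^sup>2) / 2))"
proof -
  interpret product_prob_space "\<lambda>_::nat. std_normal_distribution"
    by (rule product_prob_space_std_normal)
  have "(\<integral>z. iexp (\<Sum>i<q. z i * t i) \<partial>gauss_product q) = (\<integral>z. (\<Prod>i<q. iexp (t i * z i)) \<partial>gauss_product q)"
    by (simp add: exp_sum[symmetric] sum_distrib_left mult_ac)
  also have "\<dots> = (\<Prod>i<q. \<integral>x. iexp (t i * x) \<partial>std_normal_distribution)"
    by (rule product_integral_prod[OF finite_lessThan integrable_iexp_std_normal])
  also have "\<dots> = (\<Prod>i<q. char std_normal_distribution (t i))"
    by (simp add: char_def)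
  also have "\<dots> = of_real (\<Prod>i<q. exp (- (t i)\<^sup>2 / 2))"
    by (simp only: char_std_normal_distribution of_real_prod)
  also have "(\<Prod>i<q. exp (- (t i)\<^sup>2 / 2)) = exp (\<Sum>i<q. - (t i)\<^sup>2 / 2)"
    by (simp only: exp_sum finite_lessThan)
  also have "(\<Sum>i<q. - (t i)\<^sup>2 / 2) = - (\<Sum>i<q. (t i)\<^sup>2) / 2"
    by (simp add: sum_negf sum_divide_distrib)
  finally show ?thesis .
qed

text \<open>\<open>chi_square\<close> is built on coordinates numbered by naturals, while the
  statistic is indexed by a finite type. Any bijection will do, because the norm and the Gaussian
  product law are invariant under relabelling.\<close>

definition index_vec :: "(nat \<Rightarrow> real) \<Rightarrow> real^'q" where
  "index_vec z = (\<chi> i. z (the_inv_into {..<CARD('q)} (SOME e. bij_betw e {..<CARD('q)} (UNIV :: 'q set)) i))"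

lemma index_vec_inner:
  obtains e where "bij_betw e {..<CARD('q)} (UNIV :: 'q set)"
    "\<And>z (t :: real^'q). index_vec z \<bullet> t = (\<Sum>i<CARD('q). z i * t $ e i)"
    "\<And>z. (norm (index_vec z :: real^'q))\<^sup>2 = (\<Sum>i<CARD('q). (z i)\<^sup>2)"
proof -
  define e where "e = (SOME e. bij_betw e {..<CARD('q)} (UNIV :: 'q set))"
  have "\<exists>e. bij_betw e {..<CARD('q)} (UNIV :: 'q set)"
    by (intro finite_same_card_bij) auto
  then have e: "bij_betw e {..<CARD('q)} (UNIV :: 'q set)"
    unfolding e_def by (rule someI_ex)
  have inv: "the_inv_into {..<CARD('q)} e (e i) = i" if "i < CARD('q)" for i
    using e that by (intro the_inv_into_f_f) (auto simp: bij_betw_def)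
  have inner: "index_vec z \<bullet> t = (\<Sum>i<CARD('q). z i * t $ e i)" for z and t :: "real^'q"
    unfolding inner_vec_def index_vec_def e_def[symmetric]
    by (subst sum.reindex_bij_betw[OF e, symmetric]) (simp add: inv)
  have "(norm (index_vec z :: real^'q))\<^sup>2 = (\<Sum>i<CARD('q). (z i)\<^sup>2)" for z
  proof -
    have "(norm (index_vec z :: real^'q))\<^sup>2 = (\<Sum>i<CARD('q). z i * (index_vec z :: real^'q) $ e i)"
      unfolding power2_norm_eq_inner by (rule inner)
    also have "\<dots> = (\<Sum>i<CARD('q). (z i)\<^sup>2)"
      by (simp add: index_vec_def e_def[symmetric] inv power2_eq_square)
    finally show ?thesis .
  qed
  with e inner show ?thesis
    by (rule that)
qed

lemma measurable_vec_nth: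
  fixes f :: "'a \<Rightarrow> 'b::real_normed_vector^'n"
  assumes "f \<in> borel_measurable L"
  shows "(\<lambda>\<omega>. f \<omega> $ i) \<in> borel_measurable L"
  by (rule measurable_compose[OF assms]) (intro borel_measurable_continuous_onI continuous_intros)

text \<open>Averaging the characteristic function over a Gaussian direction turns it into the Laplace
  transform of the squared norm.\<close>

lemma laplace_norm_sq_tendsto:
  fixes T :: "nat \<Rightarrow> 'a \<Rightarrow> real^'q" and j :: nat
  assumes M: "\<And>n. prob_space (M n)" and T: "\<And>n. T n \<in> borel_measurable (M n)"
    and char: "\<And>\<theta>. (\<lambda>n. \<integral>\<omega>. iexp (\<theta> \<bullet> T n \<omega>) \<partial>M n) \<longlonglongrightarrow> of_real (exp (- (norm \<theta>)\<^sup>2 / 2))"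
  shows "(\<lambda>n. \<integral>\<omega>. exp (- (real j * (norm (T n \<omega>))\<^sup>2)) \<partial>M n)
    \<longlonglongrightarrow> (\<integral>z. exp (- (real j * (\<Sum>i<CARD('q). (z i)\<^sup>2))) \<partial>gauss_product CARD('q))"
proof -
  define P where "P = gauss_product CARD('q)"
  interpret PP: prob_space P
    unfolding P_def by (rule prob_space_gauss_product)
  obtain e where e: "bij_betw e {..<CARD('q)} (UNIV :: 'q set)"
    and inner: "\<And>z (t :: real^'q). index_vec z \<bullet> t = (\<Sum>i<CARD('q). z i * t $ e i)"
    and nrm: "\<And>z. (norm (index_vec z :: real^'q))\<^sup>2 = (\<Sum>i<CARD('q). (z i)\<^sup>2)"
    using index_vec_inner[where 'q = 'q] by blast
  \<comment> \<open>A standard Gaussian vector scaled by c has characteristic function e^(-c^2 |t|^2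
    / 2) at t; this choice makes it e^(-j |t|^2).\<close>
  define c where "c = sqrt (2 * real j)"
  have c2: "c\<^sup>2 = 2 * real j"
    by (simp add: c_def)
  define \<phi> where "\<phi> n z = (\<integral>\<omega>. iexp ((c *\<^sub>R index_vec z) \<bullet> T n \<omega>) \<partial>M n)" for n and z
  have jm: "(\<lambda>(\<omega>, z). iexp ((c *\<^sub>R index_vec z) \<bullet> T n \<omega>)) \<in> borel_measurable (M n \<Otimes>\<^sub>M P)" for n
  proof -
    note [measurable] = T[of n]
    have "(\<lambda>p. \<Sum>i<CARD('q). snd p i * T n (fst p) $ e i) \<in> borel_measurable (M n \<Otimes>\<^sub>M P)"
    proof (intro borel_measurable_sum borel_measurable_times)
      fix i assume "i \<in> {..<CARD('q)}"
      then have "(\<lambda>z. z i) \<in> borel_measurable P"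
        unfolding P_def by (intro measurable_gauss_component) simp
      then show "(\<lambda>p. snd p i) \<in> borel_measurable (M n \<Otimes>\<^sub>M P)"
        by (rule measurable_compose[OF measurable_snd])
      have "(\<lambda>\<omega>. T n \<omega> $ e i) \<in> borel_measurable (M n)"
        by (rule measurable_vec_nth[OF T])
      then show "(\<lambda>p. T n (fst p) $ e i) \<in> borel_measurable (M n \<Otimes>\<^sub>M P)"
        by (rule measurable_compose[OF measurable_fst])
    qed
    then show ?thesis
      unfolding case_prod_beta inner_scaleR_left inner by measurable
  qed
  have fubini: "of_real (\<integral>\<omega>. exp (- (real j * (norm (T n \<omega>))\<^sup>2)) \<partial>M n) = (\<integral>z. \<phi> n z \<partial>P)"
    and \<phi>m: "\<phi> n \<in> borel_measurable P" and \<phi>b: "norm (\<phi> n z) \<le> 1" for n z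
  proof -
    interpret Mn: prob_space "M n" by (rule M)
    interpret pair_prob_space "M n" P ..
    have i: "integrable (M n \<Otimes>\<^sub>M P) (\<lambda>(\<omega>, z). iexp ((c *\<^sub>R index_vec z) \<bullet> T n \<omega>))"
      using jm[of n] by (intro integrable_const_bound[of _ 1]) auto
    have "(\<integral>z. iexp ((c *\<^sub>R index_vec z) \<bullet> T n \<omega>) \<partial>P) = of_real (exp (- (real j * (norm (T n \<omega>))\<^sup>2)))" for \<omega>
    proof -
      have "(\<integral>z. iexp ((c *\<^sub>R index_vec z) \<bullet> T n \<omega>) \<partial>P) = (\<integral>z. iexp (\<Sum>i<CARD('q). z i * (c * T n \<omega> $ e i)) \<partial>P)"
        by (simp add: inner sum_distrib_left mult_ac)
      also have "\<dots> = of_real (exp (- (\<Sum>i<CARD('q). (c * T n \<omega> $ e i)\<^sup>2) / 2))"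
        unfolding P_def by (rule char_gauss_product)
      also have "(\<Sum>i<CARD('q). (c * T n \<omega> $ e i)\<^sup>2) = c\<^sup>2 * (\<Sum>k\<in>UNIV. (T n \<omega> $ k)\<^sup>2)"
        by (subst sum.reindex_bij_betw[OF e, symmetric]) (simp add: power_mult_distrib sum_distrib_left)
      also have "\<dots> = 2 * (real j * (norm (T n \<omega>))\<^sup>2)"
        by (simp add: c2 norm_vec_def L2_set_def sum_nonneg)
      finally show ?thesis
        by simp
    qed
    then have "of_real (\<integral>\<omega>. exp (- (real j * (norm (T n \<omega>))\<^sup>2)) \<partial>M n)
        = (\<integral>\<omega>. (\<integral>z. iexp ((c *\<^sub>R index_vec z) \<bullet> T n \<omega>) \<partial>P) \<partial>M n)"
      by (simp add: integral_complex_of_real)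
    also have "\<dots> = (\<integral>z. \<phi> n z \<partial>P)"
      unfolding \<phi>_def by (rule Fubini_integral[symmetric]) (use i in simp)
    finally show "of_real (\<integral>\<omega>. exp (- (real j * (norm (T n \<omega>))\<^sup>2)) \<partial>M n) = (\<integral>z. \<phi> n z \<partial>P)" .
    show "\<phi> n \<in> borel_measurable P"
      unfolding \<phi>_def using measurable_pair_swap[OF jm[of n]] by (intro Mn.borel_measurable_lebesgue_integral) simp
    have "norm (\<phi> n z) \<le> (\<integral>\<omega>. norm (iexp ((c *\<^sub>R index_vec z) \<bullet> T n \<omega>)) \<partial>M n)"
      unfolding \<phi>_def by (rule integral_norm_bound)
    then show "norm (\<phi> n z) \<le> 1"
      by (simp add: Mn.prob_space)
  qed
  have "(\<lambda>n. \<integral>z. \<phi> n z \<partial>P) \<longlonglongrightarrow> (\<integral>z. complex_of_real (exp (- (real j * (\<Sum>i<CARD('q). (z i)\<^sup>2)))) \<partial>P)"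
  proof (rule integral_dominated_convergence[where w = "\<lambda>_. 1"])
    show "AE z in P. (\<lambda>n. \<phi> n z) \<longlonglongrightarrow> complex_of_real (exp (- (real j * (\<Sum>i<CARD('q). (z i)\<^sup>2))))"
      using char[of "c *\<^sub>R index_vec _"] unfolding \<phi>_def
      by (simp add: power_mult_distrib c2 nrm)
    show "(\<lambda>z. complex_of_real (exp (- (real j * (\<Sum>i<CARD('q). (z i)\<^sup>2))))) \<in> borel_measurable P"
      unfolding P_def by measurable
  qed (use \<phi>m \<phi>b in auto)
  then have "(\<lambda>n. complex_of_real (\<integral>\<omega>. exp (- (real j * (norm (T n \<omega>))\<^sup>2)) \<partial>M n))
    \<longlonglongrightarrow> complex_of_real (\<integral>z. exp (- (real j * (\<Sum>i<CARD('q). (z i)\<^sup>2))) \<partial>P)"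
    unfolding fubini by (simp only: integral_complex_of_real)
  then show ?thesis
    unfolding P_def by (simp only: tendsto_of_real_iff)
qed

section \<open>Tails, continuity and quantiles of the chi-square law\<close>

lemma real_distribution_chi_square: "real_distribution (chi_square q)"
proof -
  interpret prob_space "gauss_product q"
    by (rule prob_space_gauss_product)
  show ?thesis
    unfolding chi_square_def by (rule real_distribution_distr) measurable
qed

lemma norm_sq_tail_le:
  fixes T :: "nat \<Rightarrow> 'a \<Rightarrow> real^'q"
  assumes M: "\<And>n. prob_space (M n)" and T: "\<And>n. T n \<in> borel_measurable (M n)"
    and char: "\<And>\<theta>. (\<lambda>n. \<integral>\<omega>. iexp (\<theta> \<bullet> T n \<omega>) \<partial>M n) \<longlonglongrightarrow> of_real (exp (- (norm \<theta>)\<^sup>2 / 2))"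
    and "c1 < c2" "e > 0"
  shows "eventually (\<lambda>n. measure (M n) {\<omega>\<in>space (M n). c2 \<le> (norm (T n \<omega>))\<^sup>2} \<le> 1 - cdf (chi_square CARD('q)) c1 + e) sequentially"
proof -
  let ?P = "gauss_product CARD('q)" and ?Z = "\<lambda>z. \<Sum>i<CARD('q). (z i)\<^sup>2"
  interpret P: prob_space ?P
    by (rule prob_space_gauss_product)
  note [measurable] = T
  have "eventually (\<lambda>n. measure (M n) {\<omega>\<in>space (M n). c2 \<le> (norm (T n \<omega>))\<^sup>2} \<le> measure ?P {z\<in>space ?P. c1 < ?Z z} + e) sequentially"
    by (rule laplace_imp_tail_le[OF M P.prob_space_axioms _ _ _ _ laplace_norm_sq_tendsto[OF M T char] \<open>c1 < c2\<close> \<open>e > 0\<close>])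
      (auto intro: sum_nonneg)
  moreover have "measure ?P {z\<in>space ?P. c1 < ?Z z} = 1 - cdf (chi_square CARD('q)) c1"
  proof -
    have "cdf (chi_square CARD('q)) c1 = measure ?P {z\<in>space ?P. ?Z z \<le> c1}"
      unfolding cdf_def2 chi_square_def
      by (subst measure_distr) (auto intro!: arg_cong[where f = "measure ?P"])
    also have "{z\<in>space ?P. ?Z z \<le> c1} = space ?P - {z\<in>space ?P. c1 < ?Z z}"
      by auto
    also have "measure ?P \<dots> = 1 - measure ?P {z\<in>space ?P. c1 < ?Z z}"
      by (rule P.prob_compl) measurable
    finally show ?thesis
      by simp
  qed
  ultimately show ?thesis
    by simp
qed

text \<open>With the other coordinates fixed, the last one must hit one of two points, a null set;
  Fubini concludes. The purpose is continuity of the distribution function.\<close>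

lemma chi_square_atomless:
  assumes "q > 0"
  shows "measure (chi_square q) {c} = 0"
proof -
  interpret product_prob_space "\<lambda>_::nat. std_normal_distribution"
    by (rule product_prob_space_std_normal)
  obtain p where q: "q = Suc p"
    using assms gr0_implies_Suc by blast
  have ins: "{..<q} = insert p {..<p}"
    by (auto simp: q)
  let ?P = "gauss_product q"
  define A where "A = {z\<in>space ?P. (\<Sum>i<q. (z i)\<^sup>2) = c}"
  have A: "A \<in> sets ?P"
    unfolding A_def by measurable
  have "emeasure ?P A = (\<integral>\<^sup>+ z. indicator A z \<partial>?P)"
    using A by simp
  also have "\<dots> = (\<integral>\<^sup>+ x. (\<integral>\<^sup>+ y. indicator A (x(p := y)) \<partial>std_normal_distribution) \<partial>gauss_product p)"
    unfolding ins by (rule product_nn_integral_insert) (use A ins in auto)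
  also have "\<dots> = (\<integral>\<^sup>+ x. 0 \<partial>gauss_product p)"
  proof (intro nn_integral_cong)
    fix x :: "nat \<Rightarrow> real"
    let ?s = "\<Sum>i<p. (x i)\<^sup>2"
    have "(\<integral>\<^sup>+ y. indicator A (x(p := y)) \<partial>std_normal_distribution)
        \<le> (\<integral>\<^sup>+ y. indicator {sqrt (c - ?s), - sqrt (c - ?s)} y \<partial>std_normal_distribution)"
    proof (rule nn_integral_mono)
      fix y :: real
      \<comment> \<open>If \<open>c - ?s\<close> is negative, the two points are artefacts of
        \<open>sqrt\<close> on negative numbers, but then no \<open>y\<close> satisfies the
        premise.\<close>
      have "y = sqrt (c - ?s) \<or> y = - sqrt (c - ?s)" if "x(p := y) \<in> A"
      proof -
        from that have "?s + y\<^sup>2 = c"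
          by (simp add: A_def q)
        then have "sqrt (c - ?s) = \<bar>y\<bar>"
          by (metis add_diff_cancel_left' real_sqrt_abs)
        then show ?thesis
          by linarith
      qed
      then show "indicator A (x(p := y)) \<le> (indicator {sqrt (c - ?s), - sqrt (c - ?s)} y :: ennreal)"
        by (auto simp: indicator_def)
    qed
    also have "\<dots> = emeasure std_normal_distribution {sqrt (c - ?s), - sqrt (c - ?s)}"
      by simp
    also have "\<dots> = 0"
    proof -
      let ?S = "{sqrt (c - ?s), - sqrt (c - ?s)}"
      have "?S \<in> null_sets lborel"
        by (intro finite_imp_null_set_lborel) auto
      then have "AE y in lborel. y \<in> ?S \<longrightarrow> ennreal (std_normal_density y) = 0"
        using AE_not_in by fastforce
      then have "?S \<in> null_sets std_normal_distribution"
        by (subst null_sets_density_iff) (simp_all only: sets_lborel, simp_all)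
      then show ?thesis
        by (rule null_setsD1)
    qed
    finally show "(\<integral>\<^sup>+ y. indicator A (x(p := y)) \<partial>std_normal_distribution) = 0"
      by simp
  qed
  finally have "measure ?P A = 0"
    by (simp add: measure_def)
  then show ?thesis
    unfolding chi_square_def by (subst measure_distr) (auto simp: A_def vimage_def Int_def conj_commute)
qed

text \<open>The tail comparison uses two different thresholds, so it needs a point strictly below
  the quantile whose tail is still close to \<gamma>. Continuity provides it: the distribution
  function vanishes at 0, so the set defining the quantile is closed with positive members and
  contains its infimum.\<close>

lemma chi_square_quantile_tail:
  assumes "q > 0" "\<gamma> \<in> {0<..<1}" "e > 0"
  obtains c where "0 \<le> c" "c < chi_square_quantile q (1 - \<gamma>)" "1 - cdf (chi_square q) c \<le> \<gamma> + e"
proof -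
  interpret real_distribution "chi_square q"
    by (rule real_distribution_chi_square)
  let ?F = "cdf (chi_square q)"
  define A where "A = {t. 1 - \<gamma> \<le> ?F t}"
  have cont: "isCont ?F t" for t
    using chi_square_atomless[OF \<open>q > 0\<close>] by (simp add: isCont_cdf)
  have F0: "?F t = 0" if "t < 0" for t
  proof -
    have "?F t = measure (gauss_product q) {z\<in>space (gauss_product q). (\<Sum>i<q. (z i)\<^sup>2) \<le> t}"
      unfolding cdf_def2 chi_square_def
      by (subst measure_distr) (auto intro!: arg_cong[where f = "measure (gauss_product q)"])
    also have "{z\<in>space (gauss_product q). (\<Sum>i<q. (z i)\<^sup>2) \<le> t} = {}"
      using that by (auto simp: not_le intro!: order.strict_trans2[of t 0] sum_nonneg)
    finally show ?thesis
      by simp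
  qed
  have "?F 0 = 0"
  proof (rule tendsto_unique[of "at_left 0"])
    show "(?F \<longlongrightarrow> ?F 0) (at_left 0)"
      using cont[of 0] by (auto simp: isCont_def intro: tendsto_within_subset)
    show "(?F \<longlongrightarrow> 0) (at_left 0)"
      using F0 by (intro tendsto_eventually) (auto simp: eventually_at_left_field intro!: exI[of _ "-1"])
  qed auto
  have A_pos: "t > 0" if "t \<in> A" for t
    using that cdf_nondecreasing[of t 0] \<open>?F 0 = 0\<close> assms(2) by (fastforce simp: A_def not_le[symmetric])
  have "eventually (\<lambda>t. ?F t > 1 - \<gamma>) at_top"
    using cdf_lim_at_top_prob assms(2) by (intro order_tendstoD(1)) auto
  then have "\<exists>t. ?F t > 1 - \<gamma>"
    by (rule eventually_happens'[rotated]) simp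
  then have "A \<noteq> {}"
    by (auto simp: A_def intro: less_imp_le)
  have bdd: "bdd_below A"
    using A_pos by (intro bdd_belowI[of _ 0]) (auto intro: less_imp_le)
  have "closed A"
    unfolding A_def using cont by (intro closed_Collect_le continuous_at_imp_continuous_on) auto
  then have Inf: "Inf A \<in> A"
    using \<open>A \<noteq> {}\<close> bdd by (intro closed_contains_Inf)
  have quant: "chi_square_quantile q (1 - \<gamma>) = Inf A"
    by (simp add: chi_square_quantile_def A_def)
  have "eventually (\<lambda>c. ?F c > 1 - \<gamma> - e) (at_left (Inf A))"
  proof (rule order_tendstoD(1))
    show "(?F \<longlongrightarrow> ?F (Inf A)) (at_left (Inf A))"
      using cont[of "Inf A"] by (auto simp: isCont_def intro: tendsto_within_subset)
    show "1 - \<gamma> - e < ?F (Inf A)"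
      using Inf \<open>e > 0\<close> by (simp add: A_def)
  qed
  moreover have "eventually (\<lambda>c. 0 < c) (at_left (Inf A))"
    using A_pos[OF Inf] by (rule eventually_at_left_real[THEN eventually_mono]) auto
  moreover have "eventually (\<lambda>c. c < Inf A) (at_left (Inf A))"
    by (simp add: eventually_at_filter)
  ultimately have "eventually (\<lambda>c. ?F c > 1 - \<gamma> - e \<and> 0 < c \<and> c < Inf A) (at_left (Inf A))"
    by eventually_elim auto
  then have "\<exists>c. ?F c > 1 - \<gamma> - e \<and> 0 < c \<and> c < Inf A"
    by (rule eventually_happens'[rotated]) simp
  then obtain c where "?F c > 1 - \<gamma> - e" "0 < c" "c < Inf A"
    by blast
  then show ?thesis
    by (intro that[of c]) (auto simp: quant)
qed

section \<open>The jackknife for fixed data\<close>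

lemma L2_set_le_sqrt:
  assumes "\<And>i. i \<in> A \<Longrightarrow> \<bar>f i\<bar> \<le> c * h i" "c \<ge> 0"
  shows "L2_set f A \<le> c * L2_set h A"
proof -
  have "(\<Sum>i\<in>A. (f i)\<^sup>2) \<le> (\<Sum>i\<in>A. (c * h i)\<^sup>2)"
    using assms by (intro sum_mono) (metis abs_ge_zero power2_abs power_mono)
  then have "L2_set f A \<le> L2_set (\<lambda>i. c * h i) A"
    unfolding L2_set_def by (rule real_sqrt_le_mono)
  also have "\<dots> = c * L2_set h A"
    using L2_set_right_distrib[OF assms(2)] by metis
  finally show ?thesis .
qed

text \<open>Centring is the orthogonal projection off the constants, hence a contraction in
  l2.\<close>

lemma L2_set_centred_le:
  fixes f :: "'i \<Rightarrow> real"
  assumes "finite A"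
  shows "L2_set (\<lambda>i. f i - (\<Sum>i\<in>A. f i) / card A) A \<le> L2_set f A"
proof (cases "A = {}")
  case False
  define c where "c = (\<Sum>i\<in>A. f i) / card A"
  have n: "real (card A) > 0"
    using False assms by (simp add: card_gt_0_iff)
  have "(\<Sum>i\<in>A. (f i - c)\<^sup>2) = (\<Sum>i\<in>A. (f i)\<^sup>2) - 2 * c * (\<Sum>i\<in>A. f i) + card A * c\<^sup>2"
  proof -
    have "(f i - c)\<^sup>2 = (f i)\<^sup>2 - 2 * c * f i + c\<^sup>2" for i
      by (simp add: power2_diff mult_ac)
    then show ?thesis
      by (simp add: sum.distrib sum_subtractf sum_distrib_left)
  qed
  also have "\<dots> = (\<Sum>i\<in>A. (f i)\<^sup>2) - card A * c\<^sup>2"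
    using n by (simp add: c_def power2_eq_square)
  also have "\<dots> \<le> (\<Sum>i\<in>A. (f i)\<^sup>2)"
    by simp
  finally show ?thesis
    unfolding L2_set_def c_def by (rule real_sqrt_le_mono)
qed auto

lemma quadratic_form_ge:
  fixes B :: "real^'n^'n"
  shows "\<bar>v \<bullet> (B *v v)\<bar> \<le> norm B * (norm v)\<^sup>2"
proof -
  have "\<bar>v \<bullet> (B *v v)\<bar> \<le> norm v * norm (B *v v)"
    by (rule Cauchy_Schwarz_ineq2)
  also have "\<dots> \<le> norm v * (norm B * norm v)"
    by (intro mult_left_mono norm_matrix_vector_le) auto
  finally show ?thesis
    by (simp add: power2_eq_square mult_ac)
qed

lemma transpose_gram: "transpose (gram X S) = gram X S"
  by (simp add: gram_def transpose_sum transpose_outer)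

lemma gram_mult_vector: "gram X S *v v = (\<Sum>n\<in>S. (X n \<bullet> v) *\<^sub>R X n)"
  by (simp add: gram_def matrix_sum_mult_vector outer_mult_vector)

lemma jackknife_var_form:
  assumes "\<forall>g\<in>{1..G}. invertible (loo_gram N \<psi> X g)"
  shows "v \<bullet> (jackknife_var G N \<psi> X Y *v v)
    = (real G - 1) / G * (\<Sum>g\<in>{1..G}. (v \<bullet> (loo_ols N \<psi> X Y g - loo_mean G N \<psi> X Y))\<^sup>2)"
  unfolding jackknife_var_def if_P[OF assms]
  by (simp add: scaleR_matrix_vector_assoc[symmetric] matrix_sum_mult_vector outer_mult_vector
      inner_sum_right inner_commute power2_eq_square)

text \<open>Includes the default 0 for singular leave-one-out matrices, so the bound is available on
  every outcome.\<close>

lemma jackknife_form_nonneg: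
  assumes "G \<ge> 1"
  shows "0 \<le> v \<bullet> (jackknife_var G N \<psi> X Y *v v)"
proof (cases "\<forall>g\<in>{1..G}. invertible (loo_gram N \<psi> X g)")
  case True
  show ?thesis
    unfolding jackknife_var_form[OF True] using assms by (intro mult_nonneg_nonneg sum_nonneg) auto
next
  case False
  then show ?thesis
    by (simp only: jackknife_var_def if_False matrix_vector_mult_0 inner_zero_right)
qed

lemma transpose_jackknife_var: "transpose (jackknife_var G N \<psi> X Y) = jackknife_var G N \<psi> X Y"
  by (simp add: jackknife_var_def transpose_scalar transpose_sum transpose_outer) (simp add: transpose_def vec_eq_iff)

section \<open>Dyadic configurations and the leave-one-out algebra for fixed data\<close>

locale dyads =
  fixes G N :: nat and \<psi> :: "nat \<Rightarrow> nat set"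
  assumes support: "n \<in> {1..N} \<Longrightarrow> \<psi> n \<subseteq> {1..G} \<and> card (\<psi> n) = 2"
begin

abbreviation "P \<equiv> max_degree G N \<psi>"
abbreviation "obs \<equiv> obs_of N \<psi>"
abbreviation "deg \<equiv> unit_degree N \<psi>"

lemma obs_subset: "obs g \<subseteq> {1..N}"
  by (auto simp: obs_of_def)

lemma finite_obs [simp]: "finite (obs g)"
  using finite_subset[OF obs_subset] by blast

lemma deg_le: "g \<in> {1..G} \<Longrightarrow> deg g \<le> P"
  unfolding max_degree_def by (intro Max_ge) auto

lemma sum_over_units:
  fixes f :: "nat \<Rightarrow> 'v::real_vector"
  shows "(\<Sum>g\<in>{1..G}. \<Sum>n\<in>obs g. f n) = 2 *\<^sub>R (\<Sum>n\<in>{1..N}. f n)"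
proof -
  have "(\<Sum>g\<in>{1..G}. \<Sum>n\<in>obs g. f n) = (\<Sum>n\<in>{1..N}. \<Sum>g\<in>{g\<in>{1..G}. g \<in> \<psi> n}. f n)"
    unfolding obs_of_def by (rule sum.swap_restrict) auto
  also have "\<dots> = (\<Sum>n\<in>{1..N}. 2 *\<^sub>R f n)"
  proof (rule sum.cong[OF refl])
    fix n assume n: "n \<in> {1..N}"
    then have "{g\<in>{1..G}. g \<in> \<psi> n} = \<psi> n"
      using support by blast
    then show "(\<Sum>g\<in>{g\<in>{1..G}. g \<in> \<psi> n}. f n) = 2 *\<^sub>R f n"
      using support[OF n] by (simp add: sum_constant_scaleR)
  qed
  finally show ?thesis
    by (simp add: scaleR_sum_right)
qed

lemma sum_deg: "(\<Sum>g\<in>{1..G}. real (deg g)) = 2 * real N"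
  using sum_over_units[of "\<lambda>_. 1::real"] by (simp add: unit_degree_def)

text \<open>One factor of the squared degree is bounded by the maximum, the other is summed exactly,
  each observation having two units. This is the origin of the l2 scale sqrt(N P) of the errors that
  grow with the degree.\<close>

lemma L2_deg_le: "L2_set (\<lambda>g. real (deg g)) {1..G} \<le> sqrt (2 * N * P)"
proof -
  have "(\<Sum>g\<in>{1..G}. (real (deg g))\<^sup>2) \<le> (\<Sum>g\<in>{1..G}. real P * real (deg g))"
    unfolding power2_eq_square using deg_le by (intro sum_mono mult_right_mono) auto
  also have "\<dots> = 2 * N * P"
    by (simp add: sum_distrib_left[symmetric] sum_deg del: One_nat_def)
  finally show ?thesis
    unfolding L2_set_def by (rule real_sqrt_le_mono)
qed

end

text \<open>One realisation, without probability. \<open>Q\<close> is unnormalised and stands for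
  the mean of the Gram matrix. Deleting a unit changes the Gram matrix by at most
  \<open>C_x\<^sup>2 * P\<close>, so \<open>small\<close> keeps every leave-one-out matrix within c
  / 2 of \<open>Q\<close>, hence coercive with constant c / 2.\<close>

locale jackknife_data = dyads G N \<psi> for G N \<psi> +
  fixes X :: "nat \<Rightarrow> real^'k" and U Y :: "nat \<Rightarrow> real" and b :: "real^'k"
    and C_x C_u c :: real and Q :: "real^'k^'k"
  assumes G: "G \<ge> 1"
    and model: "n \<in> {1..N} \<Longrightarrow> Y n = b \<bullet> X n + U n"
    and X_le: "n \<in> {1..N} \<Longrightarrow> norm (X n) \<le> C_x"
    and U_le: "n \<in> {1..N} \<Longrightarrow> \<bar>U n\<bar> \<le> C_u"
    and C_nonneg: "C_x \<ge> 0" "C_u \<ge> 0"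
    and c_pos: "c > 0"
    and Q_sym: "transpose Q = Q"
    and Q_coercive: "c * (norm v)\<^sup>2 \<le> v \<bullet> (Q *v v)"
    and small: "norm (gram X {1..N} - Q) + C_x\<^sup>2 * P \<le> c / 2"
begin

definition A where "A = gram X {1..N}"
definition A_unit where "A_unit g = gram X (obs g)"
definition S where "S = cross X U {1..N}"
definition S_unit where "S_unit g = cross X U (obs g)"
text \<open>\<open>bh\<close> is the estimation error of OLS, \<open>r g\<close> the score of unit g
  formed with OLS residuals in place of the true errors, and \<open>Dv g\<close> the full-sample
  estimate minus the one without unit g.\<close>

definition bh where "bh = matrix_inv A *v S"
definition r where "r g = S_unit g - A_unit g *v bh"
definition Dv where "Dv g = matrix_inv (A - A_unit g) *v r g"
definition err where
  "err = sqrt (2 * N * P) * (2 / c) * ((norm (A - Q) + C_x\<^sup>2 * P) * (C_x * C_u) + 2 * C_x\<^sup>2 * norm S)"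

lemma norm_A_unit_le: "norm (A_unit g) \<le> C_x\<^sup>2 * deg g"
proof -
  have "norm (A_unit g) \<le> (\<Sum>n\<in>obs g. norm (outer (X n) (X n)))"
    unfolding A_unit_def gram_def by (rule norm_sum)
  also have "\<dots> \<le> (\<Sum>n\<in>obs g. C_x\<^sup>2)"
    unfolding norm_outer power2_eq_square using X_le obs_subset[of g]
    by (intro sum_mono mult_mono') auto
  finally show ?thesis
    by (simp add: unit_degree_def mult.commute)
qed

lemma norm_S_unit_le: "norm (S_unit g) \<le> C_x * C_u * deg g"
proof -
  have "norm (S_unit g) \<le> (\<Sum>n\<in>obs g. norm (U n *\<^sub>R X n))"
    unfolding S_unit_def cross_def by (rule norm_sum)
  also have "\<dots> \<le> (\<Sum>n\<in>obs g. C_u * C_x)"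
    unfolding norm_scaleR using X_le U_le obs_subset[of g]
    by (intro sum_mono mult_mono') auto
  finally show ?thesis
    by (simp add: unit_degree_def mult_ac)
qed

lemma coercive_perturb:
  assumes "norm (B - Q) \<le> c / 2"
  shows "c / 2 * (norm v)\<^sup>2 \<le> v \<bullet> (B *v v)"
proof -
  have "v \<bullet> (B *v v) = v \<bullet> (Q *v v) + v \<bullet> ((B - Q) *v v)"
    by (simp add: matrix_vector_mult_diff_rdistrib inner_diff_right)
  moreover have "\<bar>v \<bullet> ((B - Q) *v v)\<bar> \<le> c / 2 * (norm v)\<^sup>2"
    using quadratic_form_ge[of v "B - Q"] mult_right_mono[OF assms, of "(norm v)\<^sup>2"] by simp
  ultimately show ?thesis
    using Q_coercive[of v] by linarith
qed

lemma A_close: "norm (A - Q) \<le> c / 2"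
proof -
  have "0 \<le> C_x\<^sup>2 * P"
    by simp
  with small show ?thesis
    unfolding A_def by linarith
qed

lemma A_minus_close:
  assumes "g \<in> {1..G}"
  shows "norm (A - A_unit g - Q) \<le> norm (A - Q) + C_x\<^sup>2 * P" "norm (A - A_unit g - Q) \<le> c / 2"
proof -
  have "C_x\<^sup>2 * deg g \<le> C_x\<^sup>2 * P"
    using deg_le[OF assms] by (intro mult_left_mono) auto
  moreover have "norm (A - A_unit g - Q) \<le> norm (A - Q) + norm (A_unit g)"
    using norm_triangle_ineq4[of "A - Q" "A_unit g"] by (simp add: algebra_simps)
  ultimately show "norm (A - A_unit g - Q) \<le> norm (A - Q) + C_x\<^sup>2 * P"
    using norm_A_unit_le[of g] by linarith
  with small show "norm (A - A_unit g - Q) \<le> c / 2"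
    unfolding A_def by linarith
qed

lemma A_invertible: "invertible A"
  by (rule coercive_imp_invertible[of "c / 2", OF _ coercive_perturb[OF A_close]]) (use c_pos in simp)

lemma norm_A_inv_le: "norm (matrix_inv A *v z) \<le> norm z / (c / 2)"
  by (rule coercive_norm_inv_le[of "c / 2", OF _ coercive_perturb[OF A_close]]) (use c_pos in simp)

lemma A_minus_invertible: "g \<in> {1..G} \<Longrightarrow> invertible (A - A_unit g)"
  by (rule coercive_imp_invertible[of "c / 2", OF _ coercive_perturb[OF A_minus_close(2)]]) (use c_pos in simp_all)

lemma norm_A_minus_inv_le: "g \<in> {1..G} \<Longrightarrow> norm (matrix_inv (A - A_unit g) *v z) \<le> norm z / (c / 2)"
  by (rule coercive_norm_inv_le[of "c / 2", OF _ coercive_perturb[OF A_minus_close(2)]]) (use c_pos in simp_all)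

lemma norm_bh_le: "norm bh \<le> 2 / c * norm S"
  using norm_A_inv_le[of S] by (simp add: bh_def field_simps)

lemma A_bh: "A *v bh = S"
  unfolding bh_def by (rule matrix_inv_mult_vector(1)[OF A_invertible])

lemma cross_model:
  assumes "T \<subseteq> {1..N}"
  shows "cross X Y T = gram X T *v b + cross X U T"
proof -
  have "cross X Y T = (\<Sum>n\<in>T. (X n \<bullet> b) *\<^sub>R X n + U n *\<^sub>R X n)"
    unfolding cross_def using assms model by (intro sum.cong refl) (auto simp: scaleR_left_distrib inner_commute)
  then show ?thesis
    by (simp add: sum.distrib gram_mult_vector cross_def)
qed

lemma ols_eq: "ols N X Y = b + bh"
proof -
  have "ols N X Y = matrix_inv A *v (A *v b + S)"
    using A_invertible by (simp add: ols_def A_def S_def cross_model)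
  then show ?thesis
    by (simp add: matrix_vector_right_distrib matrix_inv_mult_vector(2)[OF A_invertible] bh_def)
qed

lemma loo_gram_eq: "loo_gram N \<psi> X g = A - A_unit g"
  by (simp add: loo_gram_def A_def A_unit_def)

text \<open>An exact deletion formula: the full-sample estimate violates the normal equations of the
  reduced sample by precisely \<open>r g\<close>, and one solve removes the violation.\<close>

lemma loo_ols_eq:
  assumes g: "g \<in> {1..G}"
  shows "loo_ols N \<psi> X Y g = b + bh - Dv g"
proof -
  note inv = A_minus_invertible[OF g]
  have gram: "gram X ({1..N} - obs g) = A - A_unit g"
    unfolding A_def A_unit_def gram_def using sum.subset_diff[OF obs_subset, of "\<lambda>n. outer (X n) (X n)" g] by simp
  have S: "cross X U ({1..N} - obs g) = S - S_unit g"
    unfolding S_def S_unit_def cross_def using sum.subset_diff[OF obs_subset, of "\<lambda>n. U n *\<^sub>R X n" g] by simp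
  have "S - S_unit g = (A - A_unit g) *v bh - r g"
    by (simp add: r_def A_bh matrix_vector_mult_diff_rdistrib)
  then have "cross X Y ({1..N} - obs g) = (A - A_unit g) *v (b + bh) - r g"
    by (subst cross_model) (auto simp: gram S matrix_vector_right_distrib simp del: One_nat_def)
  then show ?thesis
    by (simp add: loo_ols_def loo_gram_eq Dv_def matrix_vector_mult_diff_distrib
        matrix_inv_mult_vector(2)[OF inv])
qed

definition Dbar where "Dbar = (1 / real G) *\<^sub>R (\<Sum>g\<in>{1..G}. Dv g)"

lemma loo_mean_eq: "loo_mean G N \<psi> X Y = b + bh - Dbar"
proof -
  have "(\<Sum>g\<in>{1..G}. loo_ols N \<psi> X Y g) = (\<Sum>g\<in>{1..G}. b + bh - Dv g)"
    by (intro sum.cong refl loo_ols_eq)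
  also have "\<dots> = real G *\<^sub>R (b + bh) - (\<Sum>g\<in>{1..G}. Dv g)"
    by (simp add: sum_subtractf sum_constant_scaleR del: sum_constant)
  finally show ?thesis
    using G by (simp add: loo_mean_def Dbar_def scaleR_diff_right)
qed

definition dev where "dev v g = v \<bullet> Dv g - (\<Sum>g\<in>{1..G}. v \<bullet> Dv g) / G"

lemma jackknife_form:
  "v \<bullet> (jackknife_var G N \<psi> X Y *v v) = (real G - 1) / G * (L2_set (dev v) {1..G})\<^sup>2"
proof -
  have inv: "\<forall>g\<in>{1..G}. invertible (loo_gram N \<psi> X g)"
    using A_minus_invertible by (simp add: loo_gram_eq)
  have dev: "v \<bullet> (loo_ols N \<psi> X Y g - loo_mean G N \<psi> X Y) = - dev v g" if "g \<in> {1..G}" for g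
    using loo_ols_eq[OF that] by (simp add: loo_mean_eq dev_def Dbar_def inner_diff_right inner_add_right inner_sum_right)
  have "v \<bullet> (jackknife_var G N \<psi> X Y *v v)
      = (real G - 1) / G * (\<Sum>g\<in>{1..G}. (v \<bullet> (loo_ols N \<psi> X Y g - loo_mean G N \<psi> X Y))\<^sup>2)"
    by (rule jackknife_var_form[OF inv])
  also have "(\<Sum>g\<in>{1..G}. (v \<bullet> (loo_ols N \<psi> X Y g - loo_mean G N \<psi> X Y))\<^sup>2) = (\<Sum>g\<in>{1..G}. (dev v g)\<^sup>2)"
    using dev by (intro sum.cong refl) simp
  finally show ?thesis
    by (simp add: L2_set_def sum_nonneg)
qed

text \<open>The residual scores \<open>r g\<close> sum to zero by the normal equations, so centring the
  leave-out estimates only affects the remainder.\<close>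

lemma sum_r: "(\<Sum>g\<in>{1..G}. r g) = 0"
proof -
  have "(\<Sum>g\<in>{1..G}. S_unit g) = 2 *\<^sub>R S"
    unfolding S_unit_def S_def cross_def by (rule sum_over_units)
  moreover have "(\<Sum>g\<in>{1..G}. A_unit g) = 2 *\<^sub>R A"
    unfolding A_unit_def A_def gram_def by (rule sum_over_units)
  ultimately show ?thesis
    unfolding r_def sum_subtractf matrix_sum_mult_vector[symmetric]
    by (simp add: scaleR_matrix_vector_assoc[symmetric] A_bh)
qed

lemma norm_r_le: "norm (r g) \<le> (C_x * C_u + C_x\<^sup>2 * norm bh) * deg g"
proof -
  have "norm (A_unit g *v bh) \<le> C_x\<^sup>2 * deg g * norm bh"
    using norm_matrix_vector_le[of "A_unit g" bh] mult_right_mono[OF norm_A_unit_le[of g], of "norm bh"] by simp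
  then show ?thesis
    using norm_triangle_ineq4[of "S_unit g" "A_unit g *v bh"] norm_S_unit_le[of g]
    by (simp add: r_def algebra_simps)
qed

text \<open>The direction \<open>Q *v w\<close> undoes the inverse in \<open>Dv g\<close>, which is
  close to that of \<open>Q\<close>, and leaves nearly \<open>w \<bullet> r g\<close>. What
  separates the true unit scores from the centred deviations is the error of this replacement and
  the residual correction \<open>A_unit g *v bh\<close>. Both are bounded by multiples of the
  degree, and the triangle inequality in l2 over units collects them.\<close>

theorem jackknife_deviation_ge:
  "L2_set (\<lambda>g. w \<bullet> S_unit g) {1..G} \<le> L2_set (dev (Q *v w)) {1..G} + norm w * err"
proof -
  define e where "e g = w \<bullet> ((Q - (A - A_unit g)) *v Dv g)" for g
  define a0 where "a0 = norm (A - Q) + C_x\<^sup>2 * P"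
  have a0: "0 \<le> a0" "a0 \<le> c / 2"
    using small by (auto simp: a0_def A_def)
  have split: "(Q *v w) \<bullet> Dv g = w \<bullet> r g + e g" if "g \<in> {1..G}" for g
    using matrix_inv_mult_vector(1)[OF A_minus_invertible[OF that], of "r g"] symmetric_matrixD[OF Q_sym, of w "Dv g"]
    by (simp add: e_def Dv_def matrix_vector_mult_diff_rdistrib inner_diff_right)
  have sum_wr: "(\<Sum>g\<in>{1..G}. w \<bullet> r g) = 0"
    by (simp add: inner_sum_right[symmetric] sum_r del: One_nat_def)
  have dev: "dev (Q *v w) g = w \<bullet> r g + (e g - (\<Sum>g\<in>{1..G}. e g) / G)" if "g \<in> {1..G}" for g
    using that by (simp add: dev_def split sum.distrib sum_wr del: One_nat_def)
  have e_le: "\<bar>e g\<bar> \<le> (norm w * (a0 * (2 / c) * (C_x * C_u + C_x\<^sup>2 * norm bh))) * real (deg g)" if g: "g \<in> {1..G}" for g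
  proof -
    have "norm (Dv g) \<le> 2 / c * norm (r g)"
      using norm_A_minus_inv_le[OF g, of "r g"] by (simp add: Dv_def field_simps)
    also have "\<dots> \<le> 2 / c * ((C_x * C_u + C_x\<^sup>2 * norm bh) * deg g)"
      using c_pos by (intro mult_left_mono norm_r_le) auto
    finally have D: "norm (Dv g) \<le> 2 / c * ((C_x * C_u + C_x\<^sup>2 * norm bh) * deg g)" .
    have "\<bar>e g\<bar> \<le> norm w * norm ((Q - (A - A_unit g)) *v Dv g)"
      unfolding e_def by (rule Cauchy_Schwarz_ineq2)
    also have "\<dots> \<le> norm w * (norm (Q - (A - A_unit g)) * norm (Dv g))"
      by (intro mult_left_mono norm_matrix_vector_le) auto
    also have "norm (Q - (A - A_unit g)) \<le> a0"
      using A_minus_close(1)[OF g] by (simp add: a0_def norm_minus_commute)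
    then have "norm w * (norm (Q - (A - A_unit g)) * norm (Dv g))
        \<le> norm w * (a0 * (2 / c * ((C_x * C_u + C_x\<^sup>2 * norm bh) * deg g)))"
      using D a0 by (intro mult_left_mono mult_mono) auto
    finally show ?thesis
      by (simp add: mult_ac)
  qed
  have wA_le: "\<bar>w \<bullet> (A_unit g *v bh)\<bar> \<le> (norm w * (C_x\<^sup>2 * norm bh)) * real (deg g)" for g
  proof -
    have "\<bar>w \<bullet> (A_unit g *v bh)\<bar> \<le> norm w * norm (A_unit g *v bh)"
      by (rule Cauchy_Schwarz_ineq2)
    also have "\<dots> \<le> norm w * (norm (A_unit g) * norm bh)"
      by (intro mult_left_mono norm_matrix_vector_le) auto
    also have "\<dots> \<le> norm w * ((C_x\<^sup>2 * deg g) * norm bh)"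
      by (intro mult_left_mono mult_right_mono norm_A_unit_le) auto
    finally show ?thesis
      by (simp add: mult_ac)
  qed
  have "L2_set (\<lambda>g. w \<bullet> S_unit g) {1..G} = L2_set (\<lambda>g. (dev (Q *v w) g + - (e g - (\<Sum>g\<in>{1..G}. e g) / G)) + w \<bullet> (A_unit g *v bh)) {1..G}"
    by (intro L2_set_cong refl) (simp add: dev r_def inner_diff_right)
  also have "\<dots> \<le> (L2_set (dev (Q *v w)) {1..G} + L2_set (\<lambda>g. - (e g - (\<Sum>g\<in>{1..G}. e g) / G)) {1..G})
      + L2_set (\<lambda>g. w \<bullet> (A_unit g *v bh)) {1..G}"
    by (intro order.trans[OF L2_set_triangle_ineq] add_mono order.refl)
  also have "L2_set (\<lambda>g. - (e g - (\<Sum>g\<in>{1..G}. e g) / G)) {1..G} = L2_set (\<lambda>g. e g - (\<Sum>g\<in>{1..G}. e g) / card {1..G}) {1..G}"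
    by (simp add: L2_set_def power2_commute)
  also have "\<dots> \<le> L2_set e {1..G}"
    by (rule L2_set_centred_le) simp
  also have "\<dots> \<le> (norm w * (a0 * (2 / c) * (C_x * C_u + C_x\<^sup>2 * norm bh))) * L2_set (\<lambda>g. real (deg g)) {1..G}"
    using e_le a0 c_pos C_nonneg by (intro L2_set_le_sqrt) auto
  also have "\<dots> \<le> (norm w * (a0 * (2 / c) * (C_x * C_u + C_x\<^sup>2 * norm bh))) * sqrt (2 * N * P)"
    using a0 c_pos C_nonneg by (intro mult_left_mono L2_deg_le) auto
  also have "L2_set (\<lambda>g. w \<bullet> (A_unit g *v bh)) {1..G} \<le> (norm w * (C_x\<^sup>2 * norm bh)) * L2_set (\<lambda>g. real (deg g)) {1..G}"
    using wA_le by (intro L2_set_le_sqrt) auto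
  also have "\<dots> \<le> (norm w * (C_x\<^sup>2 * norm bh)) * sqrt (2 * N * P)"
    by (intro mult_left_mono L2_deg_le) auto
  finally have main: "L2_set (\<lambda>g. w \<bullet> S_unit g) {1..G} \<le> L2_set (dev (Q *v w)) {1..G}
      + (norm w * (a0 * (2 / c) * (C_x * C_u + C_x\<^sup>2 * norm bh))) * sqrt (2 * N * P)
      + (norm w * (C_x\<^sup>2 * norm bh)) * sqrt (2 * N * P)"
    by simp
  \<comment> \<open>Since a0 <= c / 2, the product of the matrix error with the residual correction
    costs at most one more copy of that correction; hence the inner factor 2 in
    \<open>err\<close>.\<close>
  have "a0 * (2 / c) \<le> 1"
    using a0 c_pos by (simp add: field_simps)
  then have "a0 * (2 / c) * (C_x\<^sup>2 * norm bh) \<le> 1 * (C_x\<^sup>2 * norm bh)"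
    by (intro mult_right_mono) auto
  then have "a0 * (2 / c) * (C_x * C_u + C_x\<^sup>2 * norm bh) + C_x\<^sup>2 * norm bh \<le> a0 * (2 / c) * (C_x * C_u) + 2 * (C_x\<^sup>2 * norm bh)"
    by (simp add: distrib_left)
  also have "\<dots> \<le> a0 * (2 / c) * (C_x * C_u) + 2 * (C_x\<^sup>2 * (2 / c * norm S))"
    by (intro add_left_mono mult_left_mono norm_bh_le) auto
  also have "\<dots> = 2 / c * (a0 * (C_x * C_u) + 2 * C_x\<^sup>2 * norm S)"
    by (simp add: algebra_simps)
  finally have "(norm w * sqrt (2 * N * P)) * (a0 * (2 / c) * (C_x * C_u + C_x\<^sup>2 * norm bh) + C_x\<^sup>2 * norm bh)
      \<le> (norm w * sqrt (2 * N * P)) * (2 / c * (a0 * (C_x * C_u) + 2 * C_x\<^sup>2 * norm S))"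
    by (intro mult_left_mono) auto
  also have "\<dots> = norm w * err"
    by (simp add: err_def a0_def)
  finally show ?thesis
    using main by (simp add: algebra_simps)
qed

lemma err_nonneg: "err \<ge> 0"
  using C_nonneg c_pos by (simp add: err_def)

text \<open>\<open>K\<close> stands for a matrix dominating \<open>\<Omega>\<close>, later the mean
  of the unit-score outer products. The relative loss has three sources: \<open>d\<close> for the
  fluctuation around \<open>K\<close>, \<open>err\<close> for the change of scores, and 1 / G for
  the prefactor (G - 1) / G. The factor 2 comes from squaring an l2 bound.\<close>

lemma jackknife_form_ge:
  fixes \<Omega> K :: "real^'k^'k"
  assumes K: "w \<bullet> (\<Omega> *v w) \<le> w \<bullet> (K *v w)" and \<Omega>: "l * (norm w)\<^sup>2 \<le> w \<bullet> (\<Omega> *v w)" and l: "l > 0"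
  defines "d \<equiv> norm ((\<Sum>g\<in>{1..G}. outer (S_unit g) (S_unit g)) - K) / l"
  shows "(1 - (2 * (d + err / sqrt l) + 1 / G)) * (w \<bullet> (\<Omega> *v w))
    \<le> (Q *v w) \<bullet> (jackknife_var G N \<psi> X Y *v (Q *v w))"
proof -
  define o2 where "o2 = w \<bullet> (\<Omega> *v w)"
  define t where "t = L2_set (dev (Q *v w)) {1..G}"
  define e where "e = err / sqrt l"
  have t0: "t \<ge> 0"
    by (simp add: t_def L2_set_nonneg)
  have d0: "d \<ge> 0" and e0: "e \<ge> 0"
    using l err_nonneg by (auto simp: d_def e_def)
  have lw: "l * (norm w)\<^sup>2 \<le> o2"
    using \<Omega> by (simp add: o2_def)
  moreover have "0 \<le> l * (norm w)\<^sup>2"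
    using l by simp
  ultimately have o0: "o2 \<ge> 0"
    by linarith
  have J: "(Q *v w) \<bullet> (jackknife_var G N \<psi> X Y *v (Q *v w)) = (1 - 1 / G) * t\<^sup>2"
    using G by (simp add: jackknife_form t_def diff_divide_distrib)
  show ?thesis
  \<comment> \<open>When \<open>d\<close> and \<open>e\<close> together exceed one half, the factor
    on the left is nonpositive and the claim is trivial; otherwise square roots may be
    taken.\<close>
  proof (cases "2 * (d + e) \<le> 1")
    case False
    then have "1 - (2 * (d + e) + 1 / G) \<le> 0"
      using divide_nonneg_nonneg[of 1 "real G"] by linarith
    then have "(1 - (2 * (d + e) + 1 / G)) * o2 \<le> 0"
      using o0 by (rule mult_nonpos_nonneg)
    also have "0 \<le> (1 - 1 / G) * t\<^sup>2"
      using G by (intro mult_nonneg_nonneg) auto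
    finally show ?thesis
      unfolding J o2_def e_def .
  next
    case True
    define p where "p = (\<Sum>g\<in>{1..G}. (w \<bullet> S_unit g)\<^sup>2)"
    let ?B = "\<Sum>g\<in>{1..G}. outer (S_unit g) (S_unit g)"
    have "p = w \<bullet> (?B *v w)"
      by (simp add: p_def matrix_sum_mult_vector outer_mult_vector inner_sum_right inner_commute power2_eq_square)
    also have "\<dots> = w \<bullet> (K *v w) + w \<bullet> ((?B - K) *v w)"
      by (simp add: matrix_vector_mult_diff_rdistrib inner_diff_right)
    also have "\<dots> \<ge> o2 - norm (?B - K) * (norm w)\<^sup>2"
      using K quadratic_form_ge[of w "?B - K"] unfolding o2_def abs_le_iff by linarith
    also have "norm (?B - K) * (norm w)\<^sup>2 = d * (l * (norm w)\<^sup>2)"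
      using l by (simp add: d_def)
    finally have "o2 - d * (l * (norm w)\<^sup>2) \<le> p" .
    moreover have "d * (l * (norm w)\<^sup>2) \<le> d * o2"
      using lw d0 by (rule mult_left_mono)
    ultimately have p: "(1 - d) * o2 \<le> p"
      by (simp add: algebra_simps)
    \<comment> \<open>Replacing 1 - d by its smaller square lets the root come out as 1 - d, so that
      it can be combined additively with the l2 error.\<close>
    have "(1 - d)\<^sup>2 \<le> 1 - d"
      using True d0 e0 mult_left_mono[of "1 - d" 1 "1 - d"] by (simp add: power2_eq_square)
    then have "(1 - d)\<^sup>2 * o2 \<le> p"
      using mult_right_mono[of "(1 - d)\<^sup>2" "1 - d" o2] o0 p by linarith
    then have "sqrt ((1 - d)\<^sup>2 * o2) \<le> sqrt p"
      by (rule real_sqrt_le_mono)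
    then have 1: "(1 - d) * sqrt o2 \<le> sqrt p"
      using True d0 e0 by (simp add: real_sqrt_mult)
    have "sqrt p \<le> t + norm w * err"
      using jackknife_deviation_ge[of w] by (simp add: p_def t_def L2_set_def)
    moreover have "norm w * err \<le> e * sqrt o2"
    proof -
      have "sqrt l * norm w \<le> sqrt o2"
        using real_sqrt_le_mono[OF lw] by (simp add: real_sqrt_mult)
      from mult_left_mono[OF this e0] show ?thesis
        using l by (simp add: e_def mult_ac)
    qed
    ultimately have "(1 - d - e) * sqrt o2 \<le> t"
      using 1 by (simp add: algebra_simps)
    moreover have "0 \<le> (1 - d - e) * sqrt o2"
      using True d0 e0 o0 by (intro mult_nonneg_nonneg) auto
    ultimately have "((1 - d - e) * sqrt o2)\<^sup>2 \<le> t\<^sup>2"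
      by (intro power_mono) auto
    then have 2: "(1 - d - e)\<^sup>2 * o2 \<le> t\<^sup>2"
      using o0 by (simp add: power_mult_distrib)
    have 3: "1 - 2 * (d + e) \<le> (1 - d - e)\<^sup>2"
      using zero_le_power2[of "d + e"] by (simp add: power2_eq_square algebra_simps)
    have "(1 - (2 * (d + e) + 1 / G)) \<le> (1 - 1 / G) * (1 - 2 * (d + e))"
    proof -
      have "(1 - 1 / G) * (1 - x) = 1 - (x + 1 / G) + 1 / G * x" for x :: real
        by (simp add: algebra_simps diff_divide_distrib)
      moreover have "0 \<le> 1 / real G * (2 * (d + e))"
        using d0 e0 by (intro mult_nonneg_nonneg) auto
      ultimately show ?thesis
        by simp
    qed
    also have "\<dots> \<le> (1 - 1 / G) * (1 - d - e)\<^sup>2"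
      using 3 G by (intro mult_left_mono) auto
    finally have "(1 - (2 * (d + e) + 1 / G)) * o2 \<le> (1 - 1 / G) * (1 - d - e)\<^sup>2 * o2"
      using o0 by (rule mult_right_mono)
    also have "\<dots> \<le> (1 - 1 / G) * t\<^sup>2"
      using 2 G unfolding mult.assoc by (intro mult_left_mono) auto
    finally show ?thesis
      unfolding J o2_def e_def .
  qed
qed

text \<open>Linearises the estimator: replacing the random Gram matrix by its mean costs a product
  of two small quantities.\<close>

lemma norm_Q_bh_minus_S_le: "norm (Q *v bh - S) \<le> norm (A - Q) * (2 / c * norm S)"
proof -
  have "Q *v bh - S = (Q - A) *v bh"
    by (simp add: matrix_vector_mult_diff_rdistrib A_bh)
  also have "norm \<dots> \<le> norm (A - Q) * norm bh"
    using norm_matrix_vector_le[of "Q - A" bh] by (simp add: norm_minus_commute)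
  also have "\<dots> \<le> norm (A - Q) * (2 / c * norm S)"
    by (intro mult_left_mono norm_bh_le) auto
  finally show ?thesis .
qed

end

section \<open>Measurability and integration of matrix-valued functions\<close>

lemma outer_measurable [measurable]:
  fixes f :: "'a \<Rightarrow> real^'n" and g :: "'a \<Rightarrow> real^'m"
  assumes "f \<in> borel_measurable M" "g \<in> borel_measurable M"
  shows "(\<lambda>\<omega>. outer (f \<omega>) (g \<omega>)) \<in> borel_measurable M"
  using assms
  by (rule borel_measurable_continuous_Pair)
    (auto simp: outer_def intro!: continuous_on_vec_lambda continuous_intros)

lemma integral_quadratic_form:
  fixes F :: "'a \<Rightarrow> real^'n^'n"
  assumes "integrable M F"
  shows "w \<bullet> ((\<integral>\<omega>. F \<omega> \<partial>M) *v w) = (\<integral>\<omega>. w \<bullet> (F \<omega> *v w) \<partial>M)"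
proof -
  have "linear (\<lambda>B :: real^'n^'n. w \<bullet> (B *v w))"
    by (intro linearI) (simp_all add: matrix_vector_mult_add_rdistrib inner_add_right scaleR_matrix_vector_assoc[symmetric])
  then have "bounded_linear (\<lambda>B :: real^'n^'n. w \<bullet> (B *v w))"
    by (rule linear_conv_bounded_linear[THEN iffD1])
  from integral_bounded_linear[OF this assms] show ?thesis
    by simp
qed

lemma integral_matrix_nth:
  fixes F :: "'a \<Rightarrow> real^'n^'m"
  assumes "integrable M F"
  shows "(\<integral>\<omega>. F \<omega> \<partial>M) $ i $ j = (\<integral>\<omega>. F \<omega> $ i $ j \<partial>M)"
proof -
  have "bounded_linear (\<lambda>B :: real^'n^'m. B $ i $ j)"
    by (intro bounded_linear_compose[OF bounded_linear_vec_nth, of "\<lambda>B. B $ i"] bounded_linear_vec_nth)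
  from integral_bounded_linear[OF this assms] show ?thesis
    by simp
qed

lemma integral_double_sum:
  fixes f :: "'i \<Rightarrow> 'j \<Rightarrow> 'a \<Rightarrow> real"
  assumes "\<And>i j. i \<in> A \<Longrightarrow> j \<in> B i \<Longrightarrow> integrable M (f i j)"
  shows "(\<integral>\<omega>. (\<Sum>i\<in>A. \<Sum>j\<in>B i. f i j \<omega>) \<partial>M) = (\<Sum>i\<in>A. \<Sum>j\<in>B i. \<integral>\<omega>. f i j \<omega> \<partial>M)"
  using assms by (simp add: Bochner_Integration.integral_sum)

lemma transpose_integral:
  fixes F :: "'a \<Rightarrow> real^'n^'n"
  assumes "integrable M F" "\<And>\<omega>. transpose (F \<omega>) = F \<omega>"
  shows "transpose (\<integral>\<omega>. F \<omega> \<partial>M) = (\<integral>\<omega>. F \<omega> \<partial>M)"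
proof -
  have "F \<omega> $ i $ j = F \<omega> $ j $ i" for \<omega> i j
    using arg_cong[OF assms(2)[of \<omega>], of "\<lambda>B. B $ j $ i"] by (simp add: transpose_def)
  then show ?thesis
    by (simp add: vec_eq_iff transpose_def integral_matrix_nth[OF assms(1)])
qed

section \<open>The dyadic regression model\<close>

locale dyadic_model = prob_space M + dyads G N \<psi> for M :: "'a measure" and G N \<psi> +
  fixes x :: "nat \<Rightarrow> 'a \<Rightarrow> real^'k" and u :: "nat \<Rightarrow> 'a \<Rightarrow> real" and C_x C_u c_Q :: real
  assumes G: "G \<ge> 2"
    and meas_x: "n \<in> {1..N} \<Longrightarrow> x n \<in> borel_measurable M"
    and meas_u: "n \<in> {1..N} \<Longrightarrow> u n \<in> borel_measurable M"
    and dependence: "\<lbrakk>S1 \<subseteq> {1..N}; S2 \<subseteq> {1..N}; S1 \<inter> S2 = {}; \<forall>n\<in>S1. \<forall>m\<in>S2. \<psi> n \<inter> \<psi> m = {}\<rbrakk> \<Longrightarrow>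
        indep_var (Pi\<^sub>M S1 (\<lambda>_. borel)) (\<lambda>\<omega>. \<lambda>n\<in>S1. (x n \<omega>, u n \<omega>))
          (Pi\<^sub>M S2 (\<lambda>_. borel)) (\<lambda>\<omega>. \<lambda>m\<in>S2. (x m \<omega>, u m \<omega>))"
    and bounded_x: "n \<in> {1..N} \<Longrightarrow> AE \<omega> in M. norm (x n \<omega>) \<le> C_x"
    and bounded_u: "n \<in> {1..N} \<Longrightarrow> AE \<omega> in M. \<bar>u n \<omega>\<bar> \<le> C_u"
    and C_nonneg: "C_x \<ge> 0" "C_u \<ge> 0"
    and exogeneity: "n \<in> {1..N} \<Longrightarrow> (\<integral>\<omega>. u n \<omega> *\<^sub>R x n \<omega> \<partial>M) = 0"
    and c_Q_pos: "c_Q > 0"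
    and identification: "c_Q \<le> lambda_min (Q_mat M N x)"
    and Omega_pos_def: "pos_def (Omega_mat M N x u)"
begin

text \<open>\<open>xt\<close> and \<open>ut\<close> agree almost surely with the data and satisfy the bounds everywhere.\<close>

definition bnd where "bnd n \<omega> \<longleftrightarrow> norm (x n \<omega>) \<le> C_x \<and> \<bar>u n \<omega>\<bar> \<le> C_u"
definition xt where "xt n \<omega> = (if bnd n \<omega> then x n \<omega> else 0)"
definition ut where "ut n \<omega> = (if bnd n \<omega> then u n \<omega> else 0)"
definition s where "s n \<omega> = ut n \<omega> *\<^sub>R xt n \<omega>"
definition Cs where "Cs = C_x * C_u"
definition Bd where "Bd = {\<omega>\<in>space M. \<forall>n\<in>{1..N}. bnd n \<omega>}"
definition d where "d n \<omega> = (x n \<omega>, u n \<omega>)"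

definition At where "At \<omega> = gram (\<lambda>n. xt n \<omega>) {1..N}"
definition St where "St \<omega> = (\<Sum>n\<in>{1..N}. s n \<omega>)"
definition Su where "Su g \<omega> = (\<Sum>n\<in>obs g. s n \<omega>)"
definition Bt where "Bt \<omega> = (\<Sum>g\<in>{1..G}. outer (Su g \<omega>) (Su g \<omega>))"
text \<open>This is N times \<open>Q_mat\<close>. In this scale all powers of N cancel from the
  sandwich variance, see \<open>V_eq\<close>.\<close>

definition Qn where "Qn = (\<Sum>n\<in>{1..N}. \<integral>\<omega>. outer (xt n \<omega>) (xt n \<omega>) \<partial>M)"
definition K where "K = (\<integral>\<omega>. Bt \<omega> \<partial>M)"
definition Om where "Om = Omega_mat M N x u"
definition lam where "lam = lambda_min Om"

lemma meas_d: "n \<in> {1..N} \<Longrightarrow> d n \<in> borel_measurable M"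
  unfolding d_def using meas_x[of n] meas_u[of n] by measurable

lemma card_linked_le:
  assumes n: "n \<in> {1..N}"
  shows "card {m\<in>{1..N}. \<psi> n \<inter> \<psi> m \<noteq> {}} \<le> 2 * P"
proof -
  have fin: "finite (\<psi> n)"
    using support[OF n] by (metis card.infinite zero_neq_numeral)
  have "{m\<in>{1..N}. \<psi> n \<inter> \<psi> m \<noteq> {}} = (\<Union>g\<in>\<psi> n. obs g)"
    by (auto simp: obs_of_def)
  also have "card \<dots> \<le> (\<Sum>g\<in>\<psi> n. card (obs g))"
    by (rule card_UN_le[OF fin])
  also have "\<dots> \<le> (\<Sum>g\<in>\<psi> n. P)"
    using support[OF n] deg_le unfolding unit_degree_def by (intro sum_mono) auto
  finally show ?thesis
    using support[OF n] by simp
qed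

sublocale local_dependence M "{1..N}" \<psi> d "2 * P"
proof unfold_locales
  show "\<psi> n \<noteq> {}" if "n \<in> {1..N}" for n
    using support[OF that] by auto
  show "card {m\<in>{1..N}. \<psi> n \<inter> \<psi> m \<noteq> {}} \<le> 2 * P" if "n \<in> {1..N}" for n
    by (rule card_linked_le[OF that])
qed (use meas_d dependence in \<open>auto simp: d_def[abs_def]\<close>)

text \<open>Whether observation n is truncated depends on its own data alone. The truncated
  variables thus inherit the dyadic dependence, which truncation on a joint event would
  destroy.\<close>

lemma xt_data:
  assumes "n \<in> {1..N}"
  shows "xt n \<in> borel_measurable (data_algebra {n})" "ut n \<in> borel_measurable (data_algebra {n})"
proof -
  have d: "d n \<in> borel_measurable (data_algebra {n})"
    by (rule measurable_data) simp
  have x: "x n \<in> borel_measurable (data_algebra {n})"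
    using measurable_compose[OF d borel_measurable_continuous_onI[OF continuous_on_fst[OF continuous_on_id]]]
    by (simp add: d_def)
  have u: "u n \<in> borel_measurable (data_algebra {n})"
    using measurable_compose[OF d borel_measurable_continuous_onI[OF continuous_on_snd[OF continuous_on_id]]]
    by (simp add: d_def)
  show "xt n \<in> borel_measurable (data_algebra {n})" "ut n \<in> borel_measurable (data_algebra {n})"
    unfolding xt_def[abs_def] ut_def[abs_def] bnd_def using x u by measurable
qed

lemma s_data: "n \<in> {1..N} \<Longrightarrow> s n \<in> borel_measurable (data_algebra {n})"
  unfolding s_def[abs_def] using xt_data[of n] by measurable

lemma xt_meas: "n \<in> {1..N} \<Longrightarrow> xt n \<in> borel_measurable M"
  by (rule measurable_data_algebra_imp[OF _ xt_data(1)]) auto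

lemma s_meas: "n \<in> {1..N} \<Longrightarrow> s n \<in> borel_measurable M"
  by (rule measurable_data_algebra_imp[OF _ s_data]) auto

lemma norm_xt_le: "norm (xt n \<omega>) \<le> C_x"
  using C_nonneg by (simp add: xt_def bnd_def)

lemma abs_ut_le: "\<bar>ut n \<omega>\<bar> \<le> C_u"
  using C_nonneg by (simp add: ut_def bnd_def)

lemma norm_s_le: "norm (s n \<omega>) \<le> Cs"
  unfolding s_def norm_scaleR Cs_def using mult_mono'[OF abs_ut_le norm_xt_le, of n \<omega> n \<omega>] by (simp add: mult.commute)

lemma Cs_nonneg: "Cs \<ge> 0"
  using C_nonneg by (simp add: Cs_def)

lemma AE_bnd: "n \<in> {1..N} \<Longrightarrow> AE \<omega> in M. bnd n \<omega>"
  using bounded_x[of n] bounded_u[of n] unfolding bnd_def by (auto elim: eventually_elim2)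

lemma Bd_sets: "Bd \<in> sets M"
proof -
  have "{\<omega>\<in>space M. bnd n \<omega>} \<in> sets M" if "n \<in> {1..N}" for n
    using meas_x[OF that] meas_u[OF that] unfolding bnd_def by measurable
  then show ?thesis
    unfolding Bd_def by (intro sets.sets_Collect_finite_All) auto
qed

lemma prob_Bd: "prob Bd = 1"
proof -
  have "AE \<omega> in M. \<forall>n\<in>{1..N}. bnd n \<omega>"
    using AE_bnd by (intro AE_finite_allI) auto
  then have "AE \<omega> in M. \<omega> \<in> Bd"
    by (rule AE_mp) (auto simp: Bd_def)
  then show ?thesis
    by (simp add: prob_eq_1[OF Bd_sets])
qed

lemma s_mean: "n \<in> {1..N} \<Longrightarrow> (\<integral>\<omega>. s n \<omega> \<partial>M) = 0"
proof -
  assume n: "n \<in> {1..N}"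
  have "(\<integral>\<omega>. s n \<omega> \<partial>M) = (\<integral>\<omega>. u n \<omega> *\<^sub>R x n \<omega> \<partial>M)"
  proof (rule integral_cong_AE)
    show "AE \<omega> in M. s n \<omega> = u n \<omega> *\<^sub>R x n \<omega>"
      using AE_bnd[OF n] by eventually_elim (simp add: s_def xt_def ut_def)
  qed (use s_meas[OF n] meas_x[OF n] meas_u[OF n] in measurable)
  then show ?thesis
    using exogeneity[OF n] by simp
qed

lemma s_integrable: "n \<in> {1..N} \<Longrightarrow> integrable M (s n)"
  using s_meas norm_s_le by (intro integrable_bounded[of _ Cs]) auto

lemma inner_s_mean: "n \<in> {1..N} \<Longrightarrow> expectation (\<lambda>\<omega>. w \<bullet> s n \<omega>) = 0"
  using s_mean s_integrable by simp

lemma abs_inner_s_le: "\<bar>w \<bullet> s n \<omega>\<bar> \<le> norm w * Cs"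
  using Cauchy_Schwarz_ineq2[of w "s n \<omega>"] mult_left_mono[OF norm_s_le[of n \<omega>], of "norm w"] by simp

lemma inner_s_data: "n \<in> {1..N} \<Longrightarrow> (\<lambda>\<omega>. w \<bullet> s n \<omega>) \<in> borel_measurable (data_algebra {n})"
  using s_data[of n] by measurable

lemma St_meas [measurable]: "St \<in> borel_measurable M"
  unfolding St_def[abs_def] by (intro borel_measurable_sum s_meas)

lemma norm_St_le: "norm (St \<omega>) \<le> N * Cs"
  unfolding St_def using sum_norm_bound[of "{1..N}" "\<lambda>n. s n \<omega>" Cs] norm_s_le by simp

lemma St_outer_integrable: "integrable M (\<lambda>\<omega>. outer (St \<omega>) (St \<omega>))"
  using norm_St_le Cs_nonneg
  by (intro integrable_bounded[of _ "N * Cs * (N * Cs)"]) (auto simp: norm_outer intro!: mult_mono)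

text \<open>The score sum is centred, so its covariance is a plain second moment, and truncation
  alters it only on a null set.\<close>

lemma Om_eq: "Om = (\<integral>\<omega>. outer (St \<omega>) (St \<omega>) \<partial>M)"
proof -
  let ?S = "score_sum N x u"
  have S: "?S \<in> borel_measurable M"
    unfolding score_sum_def[abs_def] using meas_x meas_u by (intro borel_measurable_sum borel_measurable_scaleR) auto
  have eq: "AE \<omega> in M. ?S \<omega> = St \<omega>"
  proof -
    have "AE \<omega> in M. \<forall>n\<in>{1..N}. bnd n \<omega>"
      using AE_bnd by (intro AE_finite_allI) auto
    then show ?thesis
      by eventually_elim (simp add: score_sum_def St_def s_def xt_def ut_def)
  qed
  have "integral\<^sup>L M ?S = (\<integral>\<omega>. St \<omega> \<partial>M)"
    using eq S by (intro integral_cong_AE) auto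
  also have "\<dots> = 0"
    unfolding St_def using s_mean s_integrable by (simp add: Bochner_Integration.integral_sum)
  finally have "Om = (\<integral>\<omega>. outer (?S \<omega>) (?S \<omega>) \<partial>M)"
    by (simp add: Om_def Omega_mat_def cov_matrix_def)
  also have "\<dots> = (\<integral>\<omega>. outer (St \<omega>) (St \<omega>) \<partial>M)"
    using eq S by (intro integral_cong_AE) auto
  finally show ?thesis .
qed

lemma Om_form: "w \<bullet> (Om *v w) = expectation (\<lambda>\<omega>. (w \<bullet> St \<omega>)\<^sup>2)"
  unfolding Om_eq integral_quadratic_form[OF St_outer_integrable]
  by (simp add: outer_mult_vector inner_commute power2_eq_square)

lemma Om_lower: "lam * (norm w)\<^sup>2 \<le> w \<bullet> (Om *v w)"
  unfolding lam_def using Omega_pos_def by (intro lambda_min_rayleigh pos_defD) (simp add: Om_def)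

lemma lam_pos: "lam > 0"
  unfolding lam_def Om_def by (rule pos_def_lambda_min_pos[OF Omega_pos_def])

lemma card_nb_singleton_le: "n \<in> {1..N} \<Longrightarrow> card (nb {n}) \<le> 2 * P"
  using card_nb_le[of "{n}"] by simp

lemma singleton_linked_card:
  assumes "n \<in> {1..N}"
  shows "card {m\<in>{1..N}. nb {n} \<inter> {m} \<noteq> {}} \<le> 2 * P"
proof -
  have "{m\<in>{1..N}. nb {n} \<inter> {m} \<noteq> {}} \<subseteq> nb {n}"
    by auto
  then have "card {m\<in>{1..N}. nb {n} \<inter> {m} \<noteq> {}} \<le> card (nb {n})"
    by (intro card_mono finite_nb)
  then show ?thesis
    using card_nb_singleton_le[OF assms] by linarith
qed

section \<open>Second moments of the score, the Gram matrix and the unit-score outer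
  products\<close>

lemma second_moment_St: "expectation (\<lambda>\<omega>. (norm (St \<omega>))\<^sup>2) \<le> CARD('k) * (8 * Cs\<^sup>2 * (N * P))"
proof -
  have comp: "expectation (\<lambda>\<omega>. (St \<omega> $ i)\<^sup>2) \<le> 8 * Cs\<^sup>2 * (N * P)" for i
  proof -
    have "expectation (\<lambda>\<omega>. ((\<Sum>n\<in>{1..N}. s n \<omega> $ i) - (\<Sum>n\<in>{1..N}. expectation (\<lambda>\<omega>. s n \<omega> $ i)))\<^sup>2)
        \<le> 4 * Cs\<^sup>2 * (card {1..N} * (2 * P))"
    proof (rule variance_sum_le[where A = "\<lambda>n. {n}"])
      show "(\<lambda>\<omega>. s n \<omega> $ i) \<in> borel_measurable (data_algebra {n})" if "n \<in> {1..N}" for n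
        by (rule measurable_vec_nth[OF s_data[OF that]])
      show "\<bar>s n \<omega> $ i\<bar> \<le> Cs" for n \<omega>
        using component_le_norm_cart[of "s n \<omega>" i] norm_s_le[of n \<omega>] by simp
    qed (use singleton_linked_card in auto)
    moreover have "expectation (\<lambda>\<omega>. s n \<omega> $ i) = 0" if "n \<in> {1..N}" for n
      using inner_s_mean[OF that, of "axis i 1"] by (simp add: inner_axis')
    ultimately show ?thesis
      by (simp add: St_def)
  qed
  have int: "integrable M (\<lambda>\<omega>. (St \<omega> $ i)\<^sup>2)" for i
  proof (rule integrable_bounded)
    show "(\<lambda>\<omega>. (St \<omega> $ i)\<^sup>2) \<in> borel_measurable M"
      using measurable_vec_nth[OF St_meas] by measurable
    show "norm ((St \<omega> $ i)\<^sup>2) \<le> (N * Cs)\<^sup>2" for \<omega>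
      using component_le_norm_cart[of "St \<omega>" i] norm_St_le[of \<omega>]
      by (simp add: abs_le_square_iff[symmetric] abs_of_nonneg Cs_nonneg del: abs_mult)
  qed
  have "expectation (\<lambda>\<omega>. (norm (St \<omega>))\<^sup>2) = (\<Sum>i\<in>UNIV. expectation (\<lambda>\<omega>. (St \<omega> $ i)\<^sup>2))"
    by (simp add: norm_vec_def L2_set_def sum_nonneg Bochner_Integration.integral_sum int)
  also have "\<dots> \<le> (\<Sum>i\<in>(UNIV :: 'k set). 8 * Cs\<^sup>2 * (N * P))"
    by (intro sum_mono comp)
  finally show ?thesis
    by simp
qed

lemma second_moment_matrix_le:
  fixes F :: "'a \<Rightarrow> real^'k^'k"
  assumes F: "F \<in> borel_measurable M" "\<And>\<omega>. norm (F \<omega>) \<le> b"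
    and le: "\<And>i j. expectation (\<lambda>\<omega>. (F \<omega> $ i $ j - expectation (\<lambda>\<omega>. F \<omega> $ i $ j))\<^sup>2) \<le> c"
  shows "expectation (\<lambda>\<omega>. (norm (F \<omega> - (\<integral>\<omega>. F \<omega> \<partial>M)))\<^sup>2) \<le> (real CARD('k))\<^sup>2 * c"
proof -
  have iF: "integrable M F"
    using F by (intro integrable_bounded[of _ b])
  have b0: "b \<ge> 0"
    using F(2) norm_ge_zero order_trans by blast
  let ?m = "\<integral>\<omega>. F \<omega> \<partial>M"
  have m: "norm ?m \<le> b"
    using F by (intro norm_expectation_le)
  have int: "integrable M (\<lambda>\<omega>. (F \<omega> $ i $ j - ?m $ i $ j)\<^sup>2)" for i j
  proof (rule integrable_bounded)
    show "(\<lambda>\<omega>. (F \<omega> $ i $ j - ?m $ i $ j)\<^sup>2) \<in> borel_measurable M"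
      using measurable_vec_nth[OF measurable_vec_nth[OF F(1)]] by measurable
    fix \<omega>
    have "\<bar>(F \<omega> - ?m) $ i $ j\<bar> \<le> norm (F \<omega> - ?m)"
      using component_le_norm_cart[of "(F \<omega> - ?m) $ i" j] Finite_Cartesian_Product.norm_nth_le[of "F \<omega> - ?m" i] by linarith
    also have "\<dots> \<le> 2 * b"
      using norm_triangle_ineq4[of "F \<omega>" ?m] F(2)[of \<omega>] m by linarith
    finally have "\<bar>F \<omega> $ i $ j - ?m $ i $ j\<bar> \<le> 2 * b"
      by simp
    from power_mono[OF this abs_ge_zero, of 2] show "norm ((F \<omega> $ i $ j - ?m $ i $ j)\<^sup>2) \<le> (2 * b)\<^sup>2"
      by simp
  qed
  have "expectation (\<lambda>\<omega>. (norm (F \<omega> - ?m))\<^sup>2) = (\<Sum>i\<in>UNIV. \<Sum>j\<in>UNIV. expectation (\<lambda>\<omega>. (F \<omega> $ i $ j - ?m $ i $ j)\<^sup>2))"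
    by (simp add: norm_matrix_sq Bochner_Integration.integral_sum int)
  also have "\<dots> \<le> (\<Sum>i\<in>(UNIV :: 'k set). \<Sum>j\<in>(UNIV :: 'k set). c)"
    unfolding integral_matrix_nth[OF iF] by (intro sum_mono le)
  finally show ?thesis
    by (simp add: power2_eq_square)
qed

lemma At_meas [measurable]: "At \<in> borel_measurable M"
  unfolding At_def[abs_def] gram_def using xt_meas by (intro borel_measurable_sum outer_measurable) auto

lemma At_nth: "At \<omega> $ i $ j = (\<Sum>n\<in>{1..N}. xt n \<omega> $ i * xt n \<omega> $ j)"
  by (simp add: At_def gram_def outer_def)

lemma norm_At_le: "norm (At \<omega>) \<le> N * (C_x * C_x)"
proof -
  have "norm (outer (xt n \<omega>) (xt n \<omega>)) \<le> C_x * C_x" for n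
    unfolding norm_outer using norm_xt_le[of n \<omega>] by (intro mult_mono') auto
  then show ?thesis
    unfolding At_def gram_def using sum_norm_bound[of "{1..N}" "\<lambda>n. outer (xt n \<omega>) (xt n \<omega>)" "C_x * C_x"] by simp
qed

lemma outer_xt_integrable: "n \<in> {1..N} \<Longrightarrow> integrable M (\<lambda>\<omega>. outer (xt n \<omega>) (xt n \<omega>))"
proof (rule integrable_bounded)
  assume "n \<in> {1..N}"
  then show "(\<lambda>\<omega>. outer (xt n \<omega>) (xt n \<omega>)) \<in> borel_measurable M"
    using xt_meas by measurable
  show "norm (outer (xt n \<omega>) (xt n \<omega>)) \<le> C_x * C_x" for \<omega>
    unfolding norm_outer using norm_xt_le[of n \<omega>] by (intro mult_mono') auto
qed

lemma Qn_eq: "Qn = (\<integral>\<omega>. At \<omega> \<partial>M)"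
  unfolding Qn_def At_def gram_def using outer_xt_integrable by (simp add: Bochner_Integration.integral_sum)

lemma second_moment_At: "expectation (\<lambda>\<omega>. (norm (At \<omega> - Qn))\<^sup>2) \<le> (real CARD('k))\<^sup>2 * (8 * C_x ^ 4 * (N * P))"
  unfolding Qn_eq
proof (rule second_moment_matrix_le[OF At_meas norm_At_le])
  fix i j
  have "expectation (\<lambda>\<omega>. ((\<Sum>n\<in>{1..N}. xt n \<omega> $ i * xt n \<omega> $ j) - (\<Sum>n\<in>{1..N}. expectation (\<lambda>\<omega>. xt n \<omega> $ i * xt n \<omega> $ j)))\<^sup>2)
      \<le> 4 * (C_x\<^sup>2)\<^sup>2 * (card {1..N} * (2 * P))"
  proof (rule variance_sum_le[where A = "\<lambda>n. {n}"])
    show "(\<lambda>\<omega>. xt n \<omega> $ i * xt n \<omega> $ j) \<in> borel_measurable (data_algebra {n})" if "n \<in> {1..N}" for n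
      using measurable_vec_nth[OF xt_data(1)[OF that]] by measurable
    show "\<bar>xt n \<omega> $ i * xt n \<omega> $ j\<bar> \<le> C_x\<^sup>2" for n \<omega>
      unfolding abs_mult power2_eq_square
      using component_le_norm_cart[of "xt n \<omega>"] norm_xt_le[of n \<omega>] by (intro mult_mono') (auto intro: order_trans)
  qed (use singleton_linked_card in auto)
  moreover have "expectation (\<lambda>\<omega>. At \<omega> $ i $ j) = (\<Sum>n\<in>{1..N}. expectation (\<lambda>\<omega>. xt n \<omega> $ i * xt n \<omega> $ j))"
  proof -
    have "integrable M (\<lambda>\<omega>. xt n \<omega> $ i * xt n \<omega> $ j)" if "n \<in> {1..N}" for n
    proof (rule integrable_bounded)
      show "(\<lambda>\<omega>. xt n \<omega> $ i * xt n \<omega> $ j) \<in> borel_measurable M"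
        using measurable_vec_nth[OF xt_meas[OF that]] by measurable
      show "norm (xt n \<omega> $ i * xt n \<omega> $ j) \<le> C_x\<^sup>2" for \<omega>
        unfolding real_norm_def abs_mult power2_eq_square
        using component_le_norm_cart[of "xt n \<omega>"] norm_xt_le[of n \<omega>] by (intro mult_mono') (auto intro: order_trans)
    qed
    then show ?thesis
      unfolding At_nth by (rule Bochner_Integration.integral_sum)
  qed
  ultimately show "expectation (\<lambda>\<omega>. (At \<omega> $ i $ j - expectation (\<lambda>\<omega>. At \<omega> $ i $ j))\<^sup>2) \<le> 8 * C_x ^ 4 * (N * P)"
    unfolding At_nth by simp
qed

declare One_nat_def [simp del]

text \<open>Indexes the scalar summands of an entry of \<open>Bt\<close>: ordered pairs of
  observations together with a unit they share. A pair on one common dyad appears once for each of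
  its two units.\<close>

definition J where "J = (SIGMA g:{1..G}. obs g \<times> obs g)"

lemma finite_J: "finite J"
  unfolding J_def by (intro finite_SigmaI finite_cartesian_product finite_obs) auto

lemma card_J_le: "real (card J) \<le> 2 * N * P"
proof -
  have "real (card J) = (\<Sum>g\<in>{1..G}. real (deg g) * real (deg g))"
    unfolding J_def by (subst card_SigmaI) (auto simp: unit_degree_def card_cartesian_product)
  also have "\<dots> \<le> (\<Sum>g\<in>{1..G}. real P * real (deg g))"
    using deg_le by (intro sum_mono mult_right_mono) auto
  finally show ?thesis
    using sum_deg by (simp add: sum_distrib_left[symmetric] mult_ac del: One_nat_def)
qed

lemma sum_J: "(\<Sum>(g, n, m)\<in>J. f n m) = (\<Sum>g\<in>{1..G}. \<Sum>n\<in>obs g. \<Sum>m\<in>obs g. f n m)"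
  unfolding J_def by (subst sum.Sigma[symmetric]) (auto simp: sum.cartesian_product)

text \<open>At most 4 P observations are linked to n or m. Each has two units with at most P
  partners, which gives 8 P^2 triples with the linked observation in first place and as many with it
  in second place.\<close>

lemma linked_J_card_le:
  assumes n: "n \<in> {1..N}" and m: "m \<in> {1..N}"
  shows "card {k\<in>J. nb {n, m} \<inter> (case k of (g, n', m') \<Rightarrow> {n', m'}) \<noteq> {}} \<le> 16 * P\<^sup>2"
proof -
  let ?T = "SIGMA n':nb {n, m}. SIGMA g':\<psi> n'. obs g'"
  have fin\<psi>: "finite (\<psi> n')" if "n' \<in> nb {n, m}" for n'
    using support[of n'] nb_subset[of "{n, m}"] that by (metis card.infinite subsetD zero_neq_numeral)
  have finT: "finite ?T"
    by (intro finite_SigmaI finite_nb finite_obs fin\<psi>)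
  have "card {n, m} \<le> 2"
    by (simp add: card_insert_if)
  then have "card {n, m} * (2 * P) \<le> 2 * (2 * P)"
    by (rule mult_right_mono) simp
  moreover have "card (nb {n, m}) \<le> card {n, m} * (2 * P)"
    by (rule card_nb_le) (use n m in auto)
  ultimately have nb4: "card (nb {n, m}) \<le> 4 * P"
    by linarith
  have "card ?T = (\<Sum>n'\<in>nb {n, m}. \<Sum>g'\<in>\<psi> n'. card (obs g'))"
    using fin\<psi> by (subst card_SigmaI) (auto intro!: sum.cong)
  also have "\<dots> \<le> (\<Sum>n'\<in>nb {n, m}. 2 * P)"
  proof (rule sum_mono)
    fix n' assume "n' \<in> nb {n, m}"
    then have n': "n' \<in> {1..N}"
      using nb_subset by blast
    have "(\<Sum>g'\<in>\<psi> n'. card (obs g')) \<le> (\<Sum>g'\<in>\<psi> n'. P)"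
      using support[OF n'] deg_le unfolding unit_degree_def by (intro sum_mono) auto
    then show "(\<Sum>g'\<in>\<psi> n'. card (obs g')) \<le> 2 * P"
      using support[OF n'] by simp
  qed
  also have "\<dots> \<le> 4 * P * (2 * P)"
    using nb4 by (simp add: mult_right_mono)
  finally have cardT: "card ?T \<le> 8 * P\<^sup>2"
    by (simp add: power2_eq_square)
  have "{k\<in>J. nb {n, m} \<inter> (case k of (g, n', m') \<Rightarrow> {n', m'}) \<noteq> {}}
      \<subseteq> (\<lambda>(n', g', m'). (g', n', m')) ` ?T \<union> (\<lambda>(n', g', m'). (g', m', n')) ` ?T"
    by (force simp: J_def obs_of_def image_iff)
  then have "card {k\<in>J. nb {n, m} \<inter> (case k of (g, n', m') \<Rightarrow> {n', m'}) \<noteq> {}}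
      \<le> card ((\<lambda>(n', g', m'). (g', n', m')) ` ?T \<union> (\<lambda>(n', g', m'). (g', m', n')) ` ?T)"
    using finT by (intro card_mono) auto
  also have "\<dots> \<le> card ?T + card ?T"
    by (intro order.trans[OF card_Un_le] add_mono card_image_le finT)
  finally show ?thesis
    using cardT by simp
qed

lemma Su_meas [measurable]: "Su g \<in> borel_measurable M"
  unfolding Su_def[abs_def] using obs_subset[of g] by (intro borel_measurable_sum s_meas) auto

lemma norm_Su_le: "norm (Su g \<omega>) \<le> N * Cs"
proof -
  have "norm (Su g \<omega>) \<le> card (obs g) * Cs"
    unfolding Su_def using norm_s_le by (intro sum_norm_bound) auto
  also have "\<dots> \<le> N * Cs"
    using card_mono[OF _ obs_subset[of g]] Cs_nonneg by (intro mult_right_mono) auto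
  finally show ?thesis .
qed

lemma Bt_meas [measurable]: "Bt \<in> borel_measurable M"
  unfolding Bt_def[abs_def] by (intro borel_measurable_sum outer_measurable) auto

lemma norm_Bt_le: "norm (Bt \<omega>) \<le> G * ((N * Cs) * (N * Cs))"
proof -
  have "norm (outer (Su g \<omega>) (Su g \<omega>)) \<le> (N * Cs) * (N * Cs)" for g
    unfolding norm_outer using norm_Su_le by (intro mult_mono') auto
  then show ?thesis
    unfolding Bt_def using sum_norm_bound[of "{1..G}" "\<lambda>g. outer (Su g \<omega>) (Su g \<omega>)" "(N * Cs) * (N * Cs)"] by simp
qed

lemma Bt_integrable: "integrable M Bt"
  by (rule integrable_bounded[OF Bt_meas norm_Bt_le])

lemma Bt_nth: "Bt \<omega> $ i $ j = (\<Sum>(g, n, m)\<in>J. s n \<omega> $ i * s m \<omega> $ j)"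
  unfolding sum_J by (simp add: Bt_def Su_def outer_def sum_product)

lemma abs_s_nth_mult_le: "\<bar>s n \<omega> $ i * s m \<omega> $ j\<bar> \<le> Cs\<^sup>2"
  unfolding abs_mult power2_eq_square
  using component_le_norm_cart[of "s n \<omega>"] norm_s_le[of n \<omega>] component_le_norm_cart[of "s m \<omega>"] norm_s_le[of m \<omega>]
  by (intro mult_mono') (auto intro: order_trans)

lemma J_obs: "(g, n, m) \<in> J \<Longrightarrow> n \<in> {1..N} \<and> m \<in> {1..N}"
  by (auto simp: J_def obs_of_def)

lemma s_pair_data:
  assumes "n \<in> {1..N}" "m \<in> {1..N}"
  shows "(\<lambda>\<omega>. s n \<omega> $ i * s m \<omega> $ j) \<in> borel_measurable (data_algebra {n, m})"
  using measurable_data_algebra_mono[OF _ measurable_vec_nth[OF s_data[OF assms(1)]], of "{n, m}"]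
    measurable_data_algebra_mono[OF _ measurable_vec_nth[OF s_data[OF assms(2)]], of "{n, m}"]
  by (intro borel_measurable_times) auto

text \<open>128 is 4 * 2 * 16: the constant of \<open>variance_sum_le\<close>, the 2 N P triples,
  and the 16 P^2 triples linked to each. The resulting N P^3 is the numerator of the assumed rate,
  so the fluctuation is negligible against lambda_min.\<close>

lemma second_moment_Bt: "expectation (\<lambda>\<omega>. (norm (Bt \<omega> - K))\<^sup>2) \<le> (real CARD('k))\<^sup>2 * (128 * Cs ^ 4 * (N * P ^ 3))"
  unfolding K_def
proof (rule second_moment_matrix_le[OF Bt_meas norm_Bt_le])
  fix i j
  let ?F = "\<lambda>k \<omega>. case k of (g, n, m) \<Rightarrow> s n \<omega> $ i * s m \<omega> $ j"
  have F: "?F k \<in> borel_measurable (data_algebra (case k of (g, n, m) \<Rightarrow> {n, m}))" if "k \<in> J" for k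
    using that s_pair_data J_obs by (auto split: prod.splits)
  have "expectation (\<lambda>\<omega>. ((\<Sum>k\<in>J. ?F k \<omega>) - (\<Sum>k\<in>J. expectation (?F k)))\<^sup>2)
      \<le> 4 * (Cs\<^sup>2)\<^sup>2 * (card J * (16 * P\<^sup>2))"
    using variance_sum_le[where J = J and A = "\<lambda>(g, n, m). {n, m}" and F = ?F and b = "Cs\<^sup>2" and L = "16 * P\<^sup>2"]
      finite_J F J_obs linked_J_card_le abs_s_nth_mult_le by (auto split: prod.splits)
  also have "\<dots> \<le> 4 * (Cs\<^sup>2)\<^sup>2 * (2 * N * P * (16 * P\<^sup>2))"
  proof (rule mult_left_mono)
    show "real (card J * (16 * P\<^sup>2)) \<le> 2 * N * P * (16 * P\<^sup>2)"
      using mult_right_mono[OF card_J_le, of "16 * (real P)\<^sup>2"] by simp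
  qed simp
  also have "\<dots> = 128 * Cs ^ 4 * (N * P ^ 3)"
    by (simp add: power2_eq_square power3_eq_cube power4_eq_xxxx)
  also have "(\<Sum>k\<in>J. expectation (?F k)) = expectation (\<lambda>\<omega>. Bt \<omega> $ i $ j)"
  proof -
    have "integrable M (?F k)" if k: "k \<in> J" for k
    proof (rule integrable_bounded)
      have "(case k of (g, n, m) \<Rightarrow> {n, m}) \<subseteq> {1..N}"
        using k J_obs by (auto split: prod.splits)
      then show "?F k \<in> borel_measurable M"
        using F[OF k] by (rule measurable_data_algebra_imp)
      show "norm (?F k \<omega>) \<le> Cs\<^sup>2" for \<omega>
        using abs_s_nth_mult_le by (auto split: prod.splits)
    qed
    then show ?thesis
      unfolding Bt_nth by (rule Bochner_Integration.integral_sum[symmetric])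
  qed
  finally show "expectation (\<lambda>\<omega>. (Bt \<omega> $ i $ j - expectation (\<lambda>\<omega>. Bt \<omega> $ i $ j))\<^sup>2) \<le> 128 * Cs ^ 4 * (N * P ^ 3)"
    unfolding Bt_nth .
qed

text \<open>Each linked pair is counted \<open>|\<psi> n \<inter> \<psi> m|\<close> times in \<open>K\<close>; the excess over \<open>Om\<close>, coming from
  pairs with the same dyad, is a sum of squares.\<close>

lemma K_ge_Om: "w \<bullet> (Om *v w) \<le> w \<bullet> (K *v w)"
proof -
  define X where "X n \<omega> = w \<bullet> s n \<omega>" for n \<omega>
  define c where "c n m = expectation (\<lambda>\<omega>. X n \<omega> * X m \<omega>)" for n m
  have XX: "integrable M (\<lambda>\<omega>. X n \<omega> * X m \<omega>)" if "n \<in> {1..N}" "m \<in> {1..N}" for n m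
  proof (rule integrable_bounded)
    show "(\<lambda>\<omega>. X n \<omega> * X m \<omega>) \<in> borel_measurable M"
      unfolding X_def using s_meas that by measurable
    show "norm (X n \<omega> * X m \<omega>) \<le> (norm w * Cs) * (norm w * Cs)" for \<omega>
      unfolding X_def real_norm_def abs_mult by (intro mult_mono' abs_inner_s_le) auto
  qed
  have c0: "c n m = 0" if "n \<in> {1..N}" "m \<in> {1..N}" "\<psi> n \<inter> \<psi> m = {}" for n m
  proof -
    have X1: "X n \<in> borel_measurable (data_algebra {n})" "integrable M (X n)" "expectation (X n) = 0"
      if "n \<in> {1..N}" for n
      using inner_s_data[OF that, of w] s_integrable[OF that] inner_s_mean[OF that, of w]
      unfolding X_def[abs_def] by auto
    have "nb {n} \<inter> {m} = {}"
      using that(3) unfolding nb_def by blast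
    then have "c n m = expectation (X n) * expectation (X m)"
      unfolding c_def using that(1,2)
      by (intro expectation_mult_unlinked[of "{n}" "{m}"] X1) auto
    then show ?thesis
      using X1(3)[OF that(1)] by simp
  qed
  have Om: "w \<bullet> (Om *v w) = (\<Sum>n\<in>{1..N}. \<Sum>m\<in>{1..N}. c n m)"
    unfolding Om_form St_def inner_sum_right power2_eq_square sum_product c_def X_def[symmetric]
    by (intro integral_double_sum XX)
  have "w \<bullet> (Bt \<omega> *v w) = (\<Sum>g\<in>{1..G}. \<Sum>n\<in>obs g. \<Sum>m\<in>obs g. X n \<omega> * X m \<omega>)" for \<omega>
  proof -
    have "w \<bullet> (Bt \<omega> *v w) = (\<Sum>g\<in>{1..G}. (w \<bullet> Su g \<omega>) * (w \<bullet> Su g \<omega>))"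
      by (simp add: Bt_def matrix_sum_mult_vector outer_mult_vector inner_sum_right inner_commute)
    then show ?thesis
      by (simp add: Su_def inner_sum_right sum_product X_def)
  qed
  then have "w \<bullet> (K *v w) = expectation (\<lambda>\<omega>. \<Sum>g\<in>{1..G}. \<Sum>n\<in>obs g. \<Sum>m\<in>obs g. X n \<omega> * X m \<omega>)"
    unfolding K_def by (simp add: integral_quadratic_form[OF Bt_integrable])
  also have "\<dots> = (\<Sum>g\<in>{1..G}. \<Sum>n\<in>obs g. \<Sum>m\<in>obs g. c n m)"
  proof -
    have XXo: "integrable M (\<lambda>\<omega>. X n \<omega> * X m \<omega>)" if "n \<in> obs g" "m \<in> obs g" for g n m
      using XX obs_subset that by blast
    have "expectation (\<lambda>\<omega>. \<Sum>g\<in>{1..G}. \<Sum>n\<in>obs g. \<Sum>m\<in>obs g. X n \<omega> * X m \<omega>)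
        = (\<Sum>g\<in>{1..G}. \<Sum>n\<in>obs g. expectation (\<lambda>\<omega>. \<Sum>m\<in>obs g. X n \<omega> * X m \<omega>))"
      by (intro integral_double_sum Bochner_Integration.integrable_sum XXo)
    then show ?thesis
      unfolding c_def using XXo by (simp add: Bochner_Integration.integral_sum)
  qed
  also have "\<dots> = (\<Sum>n\<in>{1..N}. \<Sum>m\<in>{1..N}. real (card (\<psi> n \<inter> \<psi> m)) * c n m)"
  proof -
    have "(\<Sum>g\<in>{1..G}. \<Sum>n\<in>obs g. \<Sum>m\<in>obs g. c n m)
        = (\<Sum>g\<in>{1..G}. \<Sum>n\<in>{1..N}. \<Sum>m\<in>{1..N}. if g \<in> \<psi> n \<inter> \<psi> m then c n m else 0)"
      unfolding obs_of_def sum.inter_filter[OF finite_atLeastAtMost] by (intro sum.cong refl) auto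
    also have "\<dots> = (\<Sum>n\<in>{1..N}. \<Sum>m\<in>{1..N}. \<Sum>g\<in>{1..G}. if g \<in> \<psi> n \<inter> \<psi> m then c n m else 0)"
      by (subst sum.swap, rule sum.cong[OF refl], rule sum.swap)
    also have "\<dots> = (\<Sum>n\<in>{1..N}. \<Sum>m\<in>{1..N}. real (card (\<psi> n \<inter> \<psi> m)) * c n m)"
    proof (intro sum.cong refl)
      fix n m assume "n \<in> {1..N}" "m \<in> {1..N}"
      then have "{g\<in>{1..G}. g \<in> \<psi> n \<inter> \<psi> m} = \<psi> n \<inter> \<psi> m"
        using support by blast
      then show "(\<Sum>g\<in>{1..G}. if g \<in> \<psi> n \<inter> \<psi> m then c n m else 0) = real (card (\<psi> n \<inter> \<psi> m)) * c n m"
        by (subst sum.inter_filter[symmetric]) simp_all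
    qed
    finally show ?thesis .
  qed
  \<comment> \<open>Two dyads share 0, 1 or 2 units. The covariance is then zero, counted once, or
    counted twice, and the last case means that the dyads coincide.\<close>
  also have "\<dots> = (\<Sum>n\<in>{1..N}. \<Sum>m\<in>{1..N}. c n m + (if \<psi> m = \<psi> n then c n m else 0))"
  proof (intro sum.cong refl)
    fix n m assume n: "n \<in> {1..N}" and m: "m \<in> {1..N}"
    have fin: "finite (\<psi> n)" "finite (\<psi> m)"
      using support[OF n] support[OF m] by (metis card.infinite zero_neq_numeral)+
    consider "\<psi> n \<inter> \<psi> m = {}" | "\<psi> m = \<psi> n" | "\<psi> n \<inter> \<psi> m \<noteq> {}" "\<psi> m \<noteq> \<psi> n"
      by blast
    then show "real (card (\<psi> n \<inter> \<psi> m)) * c n m = c n m + (if \<psi> m = \<psi> n then c n m else 0)"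
    proof cases
      case 1
      then show ?thesis
        using c0[OF n m] by simp
    next
      case 2
      then show ?thesis
        using support[OF n] by simp
    next
      case 3
      have "card (\<psi> n \<inter> \<psi> m) < card (\<psi> n)"
      proof (rule psubset_card_mono[OF fin(1)])
        show "\<psi> n \<inter> \<psi> m \<subset> \<psi> n"
          using 3(2) card_subset_eq[OF fin(2), of "\<psi> n"] support[OF n] support[OF m] by auto
      qed
      then have "card (\<psi> n \<inter> \<psi> m) = 1"
        using 3(1) fin support[OF n] card_gt_0_iff[of "\<psi> n \<inter> \<psi> m"] by auto
      then show ?thesis
        using 3 by simp
    qed
  qed
  also have "\<dots> = w \<bullet> (Om *v w) + (\<Sum>n\<in>{1..N}. \<Sum>m\<in>{m\<in>{1..N}. \<psi> m = \<psi> n}. c n m)"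
    unfolding Om sum.inter_filter[OF finite_atLeastAtMost] by (simp add: sum.distrib)
  finally have "w \<bullet> (K *v w) = w \<bullet> (Om *v w) + (\<Sum>n\<in>{1..N}. \<Sum>m\<in>{m\<in>{1..N}. \<psi> m = \<psi> n}. c n m)" .
  moreover have "(\<Sum>n\<in>{1..N}. \<Sum>m\<in>{m\<in>{1..N}. \<psi> m = \<psi> n}. c n m) \<ge> 0"
  proof -
    have "(\<Sum>n\<in>{1..N}. \<Sum>m\<in>{m\<in>{1..N}. \<psi> m = \<psi> n}. c n m)
        = expectation (\<lambda>\<omega>. \<Sum>n\<in>{1..N}. \<Sum>m\<in>{m\<in>{1..N}. \<psi> m = \<psi> n}. X n \<omega> * X m \<omega>)"
      unfolding c_def by (intro integral_double_sum[symmetric] XX) auto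
    also have "\<dots> \<ge> 0"
    proof (rule integral_nonneg_AE, rule AE_I2)
      fix \<omega>
      \<comment> \<open>\<open>T D\<close> gathers all scores on the dyad \<open>D\<close>;
        regrouped by dyads, the double sum becomes the sum of the squares of the
        \<open>T D\<close>.\<close>
      define T where "T D = (\<Sum>m\<in>{m\<in>{1..N}. \<psi> m = D}. X m \<omega>)" for D
      have "(\<Sum>n\<in>{1..N}. \<Sum>m\<in>{m\<in>{1..N}. \<psi> m = \<psi> n}. X n \<omega> * X m \<omega>) = (\<Sum>n\<in>{1..N}. X n \<omega> * T (\<psi> n))"
        by (simp add: T_def sum_distrib_left)
      also have "\<dots> = (\<Sum>D\<in>\<psi> ` {1..N}. \<Sum>n\<in>{n\<in>{1..N}. \<psi> n = D}. X n \<omega> * T (\<psi> n))"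
        by (rule sum.image_gen) simp
      also have "\<dots> = (\<Sum>D\<in>\<psi> ` {1..N}. T D * T D)"
        by (intro sum.cong refl) (simp add: T_def sum_distrib_right)
      finally show "0 \<le> (\<Sum>n\<in>{1..N}. \<Sum>m\<in>{m\<in>{1..N}. \<psi> m = \<psi> n}. X n \<omega> * X m \<omega>)"
        by (simp add: sum_nonneg)
    qed
    finally show ?thesis .
  qed
  ultimately show ?thesis
    by linarith
qed

section \<open>Characteristic function of the score; size of lambda_min; the sandwich
  variance\<close>

lemma char_score_bound:
  assumes small: "6 * P * (norm w * Cs) \<le> 1" and L: "L > 0"
  shows "norm ((\<integral>\<omega>. iexp (w \<bullet> St \<omega>) \<partial>M) - of_real (exp (- (w \<bullet> (Om *v w)) / 2)))
    \<le> w \<bullet> (Om *v w) / (3 * L) + (192 * L * exp (2 * L) + 36 * exp 1) * (N * (2 * P) ^ 3 * (norm w * Cs) ^ 4)"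
proof -
  interpret B: bounded_scores M "{1..N}" \<psi> d "2 * P" "\<lambda>n \<omega>. w \<bullet> s n \<omega>" "norm w * Cs"
  proof unfold_locales
    show "(\<lambda>\<omega>. w \<bullet> s n \<omega>) \<in> borel_measurable (data_algebra {n})" if "n \<in> {1..N}" for n
      by (rule inner_s_data[OF that])
    show "\<bar>w \<bullet> s n \<omega>\<bar> \<le> norm w * Cs" for n \<omega>
      by (rule abs_inner_s_le)
    show "expectation (\<lambda>\<omega>. w \<bullet> s n \<omega>) = 0" if "n \<in> {1..N}" for n
      by (rule inner_s_mean[OF that])
    show "0 \<le> norm w * Cs"
      using Cs_nonneg by simp
    show "real (3 * (2 * P)) * (norm w * Cs) \<le> 1"
      using small by simp
  qed
  have W: "B.W = (\<lambda>\<omega>. w \<bullet> St \<omega>)"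
    by (simp add: B.W_def[abs_def] St_def inner_sum_right)
  show ?thesis
    using B.char_function_bound[OF L] unfolding W Om_form by simp
qed

text \<open>Tested in one coordinate direction. Combined with \<open>lam_pos\<close> it excludes
  degenerate configurations, and later it turns the assumed rate into P / N -> 0.\<close>

lemma lam_le: "lam \<le> CARD('k) * (8 * Cs\<^sup>2 * (N * P))"
proof -
  define w :: "real^'k" where "w = axis (SOME i. True) 1"
  have w: "norm w = 1"
    by (simp add: w_def)
  have "lam \<le> w \<bullet> (Om *v w)"
    using Om_lower[of w] w by simp
  also have "\<dots> \<le> expectation (\<lambda>\<omega>. (norm (St \<omega>))\<^sup>2)"
    unfolding Om_form
  proof (rule integral_mono)
    have b: "(w \<bullet> St \<omega>)\<^sup>2 \<le> (norm (St \<omega>))\<^sup>2" for \<omega>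
      using Cauchy_Schwarz_ineq2[of w "St \<omega>"] w by (simp add: abs_le_square_iff[symmetric])
    have c: "(norm (St \<omega>))\<^sup>2 \<le> (N * Cs)\<^sup>2" for \<omega>
      using norm_St_le by (intro power_mono) auto
    show "integrable M (\<lambda>\<omega>. (w \<bullet> St \<omega>)\<^sup>2)"
      using order_trans[OF b c] by (intro integrable_bounded[of _ "(N * Cs)\<^sup>2"]) auto
    show "integrable M (\<lambda>\<omega>. (norm (St \<omega>))\<^sup>2)"
      using c by (intro integrable_bounded[of _ "(N * Cs)\<^sup>2"]) auto
    show "(w \<bullet> St \<omega>)\<^sup>2 \<le> (norm (St \<omega>))\<^sup>2" for \<omega>
      by (rule b)
  qed
  also have "\<dots> \<le> CARD('k) * (8 * Cs\<^sup>2 * (N * P))"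
    by (rule second_moment_St)
  finally show ?thesis .
qed

lemma N_P_pos: "N > 0" "P > 0" "Cs > 0"
proof -
  have "0 < real CARD('k) * (8 * Cs\<^sup>2 * (N * P))"
    using lam_pos lam_le by linarith
  then have "N \<noteq> 0 \<and> P \<noteq> 0 \<and> Cs \<noteq> 0"
    by (auto simp: zero_less_mult_iff)
  then show "N > 0" "P > 0" "Cs > 0"
    using Cs_nonneg by auto
qed

lemma P_le_N: "P \<le> N"
proof -
  have "unit_degree N \<psi> g \<le> N" for g
    unfolding unit_degree_def using card_mono[OF _ obs_subset[of g]] by simp
  then show ?thesis
    unfolding max_degree_def using G by (subst Max_le_iff) auto
qed

lemma Q_eq: "Q_mat M N x = (1 / real N) *\<^sub>R Qn"
proof -
  have "(\<integral>\<omega>. outer (x n \<omega>) (x n \<omega>) \<partial>M) = (\<integral>\<omega>. outer (xt n \<omega>) (xt n \<omega>) \<partial>M)" if n: "n \<in> {1..N}" for n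
  proof (rule integral_cong_AE)
    show "AE \<omega> in M. outer (x n \<omega>) (x n \<omega>) = outer (xt n \<omega>) (xt n \<omega>)"
      using AE_bnd[OF n] by eventually_elim (simp add: xt_def)
  qed (use meas_x[OF n] xt_meas[OF n] in measurable)
  then show ?thesis
    unfolding Q_mat_def Qn_def by simp
qed

lemma transpose_At: "transpose (At \<omega>) = At \<omega>"
  by (simp add: At_def transpose_gram)

lemma transpose_Qn: "transpose Qn = Qn"
  unfolding Qn_eq using norm_At_le by (intro transpose_integral transpose_At integrable_bounded[OF At_meas])

definition c where "c = c_Q * N"

lemma c_pos: "c > 0"
  using c_Q_pos N_P_pos by (simp add: c_def)

lemma Qn_coercive: "c * (norm v)\<^sup>2 \<le> v \<bullet> (Qn *v v)"
proof -
  have "transpose (Q_mat M N x) = Q_mat M N x"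
    by (simp add: Q_eq transpose_scalar transpose_Qn)
  from lambda_min_rayleigh(1)[OF this, of v]
  have "c_Q * (norm v)\<^sup>2 \<le> v \<bullet> (Q_mat M N x *v v)"
    using mult_right_mono[OF identification, of "(norm v)\<^sup>2"] by simp
  also have "\<dots> = (v \<bullet> (Qn *v v)) / N"
    by (simp add: Q_eq scaleR_matrix_vector_assoc[symmetric])
  finally show ?thesis
    using N_P_pos by (simp add: c_def field_simps)
qed

lemma Qn_invertible: "invertible Qn"
  by (rule coercive_imp_invertible[OF c_pos Qn_coercive])

lemma V_eq: "V_mat M N x u = matrix_inv Qn ** Om ** matrix_inv Qn"
proof -
  have "matrix_inv (Q_mat M N x) = real N *\<^sub>R matrix_inv Qn"
    using N_P_pos by (intro matrix_inv_eqI)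
      (simp add: Q_eq matrix_scalar_ac scalar_matrix_assoc[symmetric] matrix_inv_mult[OF Qn_invertible])
  then show ?thesis
    using N_P_pos by (simp add: V_mat_def Om_def[symmetric] matrix_scalar_ac scalar_matrix_assoc[symmetric] power2_eq_square)
qed

abbreviation "V \<equiv> V_mat M N x u"

lemma V_form: "v \<bullet> (V *v v) = (matrix_inv Qn *v v) \<bullet> (Om *v (matrix_inv Qn *v v))"
  using symmetric_matrixD[OF transpose_matrix_inv[OF Qn_invertible transpose_Qn], of v "Om *v (matrix_inv Qn *v v)"]
  by (simp add: V_eq matrix_vector_mul_assoc matrix_mul_assoc)

lemma Om_pos_def: "pos_def Om"
  unfolding Om_def by (rule Omega_pos_def)

lemma V_pos_def: "pos_def V"
  unfolding pos_def_def
proof (intro conjI allI impI)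
  show "transpose V = V"
    by (simp add: V_eq matrix_transpose_mul pos_defD(1)[OF Om_pos_def] transpose_matrix_inv[OF Qn_invertible transpose_Qn] matrix_mul_assoc)
  fix v :: "real^'k" assume "v \<noteq> 0"
  then have "matrix_inv Qn *v v \<noteq> 0"
    using matrix_inv_mult_vector(1)[OF Qn_invertible, of v] by auto
  then show "v \<bullet> (V *v v) > 0"
    unfolding V_form by (rule pos_defD(2)[OF Om_pos_def])
qed

section \<open>The good event, the error variable and the comparison of variances\<close>

definition a0 where "a0 \<omega> = norm (At \<omega> - Qn)"
definition h where "h \<omega> = norm (Bt \<omega> - K)"
definition errt where
  "errt \<omega> = sqrt (2 * N * P) * (2 / c) * ((a0 \<omega> + C_x\<^sup>2 * P) * Cs + 2 * C_x\<^sup>2 * norm (St \<omega>))"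
text \<open>A bound, free of \<open>R\<close>, for the linearisation error of the standardised
  estimator.\<close>

definition rem where "rem \<omega> = a0 \<omega> * (2 / c * norm (St \<omega>)) / sqrt lam"
definition good where "good \<omega> \<longleftrightarrow> \<omega> \<in> Bd \<and> a0 \<omega> + C_x\<^sup>2 * P \<le> c / 2"
text \<open>Neither \<open>R\<close> nor \<beta> enters, which is the source of the uniformity. Off
  the good event the value 1 reduces the claim to nonnegativity of the jackknife form.\<close>

definition eps where
  "eps \<omega> = (if good \<omega> then 2 * (h \<omega> / lam + errt \<omega> / sqrt lam) + 1 / G else 1)"

lemma a0_meas [measurable]: "a0 \<in> borel_measurable M"
  unfolding a0_def[abs_def] by measurable

lemma h_meas [measurable]: "h \<in> borel_measurable M"
  unfolding h_def[abs_def] by measurable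

lemma errt_meas [measurable]: "errt \<in> borel_measurable M"
  unfolding errt_def[abs_def] by measurable

lemma rem_meas [measurable]: "rem \<in> borel_measurable M"
  unfolding rem_def[abs_def] by measurable

lemma good_sets [measurable]: "Measurable.pred M good"
proof -
  have "Measurable.pred M (\<lambda>\<omega>. \<omega> \<in> Bd)"
    using Bd_sets by (rule pred_sets2) simp
  then show ?thesis
    unfolding good_def[abs_def] by measurable
qed

lemma eps_meas [measurable]: "eps \<in> borel_measurable M"
  unfolding eps_def[abs_def] by measurable

lemma good_bnd: "good \<omega> \<Longrightarrow> n \<in> {1..N} \<Longrightarrow> bnd n \<omega>"
  by (auto simp: good_def Bd_def)

lemma good_eqs:
  assumes "good \<omega>"
  shows "gram (\<lambda>n. x n \<omega>) {1..N} = At \<omega>"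
    and "cross (\<lambda>n. x n \<omega>) (\<lambda>n. u n \<omega>) {1..N} = St \<omega>"
    and "cross (\<lambda>n. x n \<omega>) (\<lambda>n. u n \<omega>) (obs g) = Su g \<omega>"
proof -
  have xt: "xt n \<omega> = x n \<omega>" "s n \<omega> = u n \<omega> *\<^sub>R x n \<omega>" if "n \<in> {1..N}" for n
    using good_bnd[OF assms that] by (auto simp: xt_def ut_def s_def)
  show "gram (\<lambda>n. x n \<omega>) {1..N} = At \<omega>"
    by (simp add: At_def gram_def xt)
  show "cross (\<lambda>n. x n \<omega>) (\<lambda>n. u n \<omega>) {1..N} = St \<omega>"
    by (simp add: St_def cross_def xt)
  show "cross (\<lambda>n. x n \<omega>) (\<lambda>n. u n \<omega>) (obs g) = Su g \<omega>"
    unfolding Su_def cross_def using obs_subset[of g] by (intro sum.cong refl) (auto simp: xt)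
qed

lemma jackknife_data_good:
  assumes "good \<omega>" and model: "\<And>n. n \<in> {1..N} \<Longrightarrow> Y n = \<beta> \<bullet> x n \<omega> + u n \<omega>"
  shows "jackknife_data G N \<psi> (\<lambda>n. x n \<omega>) (\<lambda>n. u n \<omega>) Y \<beta> C_x C_u c Qn"
proof unfold_locales
  show "norm (gram (\<lambda>n. x n \<omega>) {1..N} - Qn) + C_x\<^sup>2 * P \<le> c / 2"
    using assms(1) by (simp add: good_eqs[OF assms(1)] good_def a0_def)
qed (use G good_bnd[OF assms(1)] C_nonneg c_pos transpose_Qn Qn_coercive model in \<open>auto simp: bnd_def\<close>)

text \<open>Writing v = \<open>Qn *v w\<close> turns the form of \<open>V\<close> at v into that of
  \<open>Om\<close> at w, to which the fixed-data bound applies. As v is arbitrary, every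
  \<open>R\<close> is covered at once.\<close>

theorem jackknife_conservative:
  assumes model: "\<And>n. n \<in> {1..N} \<Longrightarrow> Y n = \<beta> \<bullet> x n \<omega> + u n \<omega>"
  shows "(1 - eps \<omega>) * (v \<bullet> (V *v v)) \<le> v \<bullet> (jackknife_var G N \<psi> (\<lambda>n. x n \<omega>) Y *v v)"
proof (cases "good \<omega>")
  case False
  then show ?thesis
    using jackknife_form_nonneg[of G v N \<psi> "\<lambda>n. x n \<omega>" Y] G by (simp add: eps_def)
next
  case True
  interpret J: jackknife_data G N \<psi> "\<lambda>n. x n \<omega>" "\<lambda>n. u n \<omega>" Y \<beta> C_x C_u c Qn
    by (rule jackknife_data_good[OF True model])
  note eqs = good_eqs[OF True]
  define w where "w = matrix_inv Qn *v v"
  have v: "Qn *v w = v"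
    by (simp add: w_def matrix_inv_mult_vector(1)[OF Qn_invertible])
  have "(1 - (2 * (norm ((\<Sum>g\<in>{1..G}. outer (J.S_unit g) (J.S_unit g)) - K) / lam + J.err / sqrt lam) + 1 / G)) * (w \<bullet> (Om *v w))
      \<le> (Qn *v w) \<bullet> (jackknife_var G N \<psi> (\<lambda>n. x n \<omega>) Y *v (Qn *v w))"
    by (rule J.jackknife_form_ge[OF K_ge_Om Om_lower lam_pos])
  moreover have "J.err = errt \<omega>"
    by (simp add: J.err_def errt_def J.A_def J.S_def eqs a0_def Cs_def)
  moreover have "norm ((\<Sum>g\<in>{1..G}. outer (J.S_unit g) (J.S_unit g)) - K) = h \<omega>"
    by (simp add: J.S_unit_def eqs h_def Bt_def)
  ultimately show ?thesis
    using True unfolding v by (simp add: eps_def V_form w_def)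
qed

context
  fixes R :: "real^'q^'k"
  assumes R: "rank R = CARD('q)"
begin

abbreviation "VR \<equiv> sandwich R V"

lemma VR_pos_def: "pos_def VR"
  by (rule sandwich_pos_def[OF V_pos_def R])

text \<open>The estimator with the Gram matrix replaced by its mean, standardised by its exact
  variance. It is linear in the score and has identity covariance.\<close>

definition Tstat :: "'a \<Rightarrow> real^'q" where
  "Tstat \<omega> = mat_inv_sqrt VR *v (transpose R *v (matrix_inv Qn *v St \<omega>))"

text \<open>With \<open>C = VR^(-1/2)\<close>, the matrix \<open>V^(1/2) R C\<close> has orthonormal columns.\<close>

lemma norm_standardised_le:
  "(norm (mat_inv_sqrt VR *v (transpose R *v z)))\<^sup>2 \<le> (norm (Qn *v z))\<^sup>2 / lam"
proof -
  let ?C = "mat_inv_sqrt VR"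
  define t where "t = ?C *v (transpose R *v z)"
  define w where "w = matrix_inv Qn *v (R *v (?C *v t))"
  have Qw: "Qn *v w = R *v (?C *v t)"
    by (simp add: w_def matrix_inv_mult_vector(1)[OF Qn_invertible])
  have o: "w \<bullet> (Om *v w) = (norm t)\<^sup>2"
    using norm_mat_inv_sqrt_sq[OF VR_pos_def, of t] unfolding sandwich_form V_form w_def .
  have "(norm t)\<^sup>2 = t \<bullet> (?C *v (transpose R *v z))"
    by (simp add: power2_norm_eq_inner t_def)
  also have "\<dots> = (?C *v t) \<bullet> (transpose R *v z)"
    by (rule symmetric_matrixD[OF pos_defD(1)[OF mat_inv_sqrt_pos_def(1)[OF VR_pos_def]], symmetric])
  also have "\<dots> = (R *v (?C *v t)) \<bullet> z"
    using inner_matrix_transpose[of "?C *v t" "transpose R" z] by simp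
  also have "\<dots> = w \<bullet> (Qn *v z)"
    unfolding Qw[symmetric] by (rule symmetric_matrixD[OF transpose_Qn])
  also have "\<dots> \<le> norm w * norm (Qn *v z)"
    by (rule norm_cauchy_schwarz)
  finally have 1: "(norm t)\<^sup>2 \<le> norm w * norm (Qn *v z)" .
  have "lam * (norm w)\<^sup>2 \<le> (norm t)\<^sup>2"
    using Om_lower[of w] by (simp add: o)
  then have 2: "sqrt lam * norm w \<le> norm t"
    using real_sqrt_le_mono by (fastforce simp: real_sqrt_mult)
  have "sqrt lam * (norm t)\<^sup>2 \<le> sqrt lam * (norm w * norm (Qn *v z))"
    using 1 lam_pos by (intro mult_left_mono) auto
  also have "\<dots> \<le> norm t * norm (Qn *v z)"
    using mult_right_mono[OF 2, of "norm (Qn *v z)"] by (simp add: mult_ac)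
  finally have "sqrt lam * norm t \<le> norm (Qn *v z)"
    by (cases "t = 0") (auto simp: power2_eq_square)
  then have "(sqrt lam * norm t)\<^sup>2 \<le> (norm (Qn *v z))\<^sup>2"
    using lam_pos by (intro power_mono) auto
  then show ?thesis
    using lam_pos by (simp add: power_mult_distrib t_def field_simps)
qed

lemma Tstat_meas: "Tstat \<in> borel_measurable M"
proof -
  have "linear (\<lambda>z. mat_inv_sqrt VR *v (transpose R *v (matrix_inv Qn *v z)))"
    by (intro linearI) (simp_all add: matrix_vector_right_distrib matrix_vector_mult_scaleR)
  then have "(\<lambda>z. mat_inv_sqrt VR *v (transpose R *v (matrix_inv Qn *v z))) \<in> borel_measurable borel"
    by (intro borel_measurable_continuous_onI linear_continuous_on) (simp add: linear_conv_bounded_linear)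
  from measurable_compose[OF St_meas this] show ?thesis
    by (simp add: Tstat_def[abs_def])
qed

text \<open>The \<theta>-component is \<open>w \<bullet> St\<close> with w' Om w = |\<theta>|^2, so
  that |w| <= |\<theta>| / sqrt(lam) whatever \<open>R\<close> is. The right-hand side is therefore
  free of \<open>R\<close>.\<close>

lemma char_Tstat_bound:
  assumes small: "6 * P * (norm \<theta> / sqrt lam * Cs) \<le> 1" and L: "L > 0"
  shows "norm ((\<integral>\<omega>. iexp (\<theta> \<bullet> Tstat \<omega>) \<partial>M) - of_real (exp (- (norm \<theta>)\<^sup>2 / 2)))
    \<le> (norm \<theta>)\<^sup>2 / (3 * L) + (192 * L * exp (2 * L) + 36 * exp 1) * (N * (2 * P) ^ 3 * (norm \<theta> / sqrt lam * Cs) ^ 4)"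
proof -
  let ?C = "mat_inv_sqrt VR"
  define w where "w = matrix_inv Qn *v (R *v (?C *v \<theta>))"
  have o: "w \<bullet> (Om *v w) = (norm \<theta>)\<^sup>2"
    using norm_mat_inv_sqrt_sq[OF VR_pos_def, of \<theta>] unfolding sandwich_form V_form w_def .
  have "lam * (norm w)\<^sup>2 \<le> (norm \<theta>)\<^sup>2"
    using Om_lower[of w] by (simp add: o)
  then have "sqrt lam * norm w \<le> norm \<theta>"
    using real_sqrt_le_mono by (fastforce simp: real_sqrt_mult)
  then have w: "norm w \<le> norm \<theta> / sqrt lam"
    using lam_pos by (simp add: field_simps)
  then have wC: "norm w * Cs \<le> norm \<theta> / sqrt lam * Cs"
    using Cs_nonneg by (rule mult_right_mono)
  have T: "\<theta> \<bullet> Tstat \<omega> = w \<bullet> St \<omega>" for \<omega>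
  proof -
    have "\<theta> \<bullet> Tstat \<omega> = (?C *v \<theta>) \<bullet> (transpose R *v (matrix_inv Qn *v St \<omega>))"
      unfolding Tstat_def
      by (rule symmetric_matrixD[OF pos_defD(1)[OF mat_inv_sqrt_pos_def(1)[OF VR_pos_def]], symmetric])
    also have "\<dots> = (R *v (?C *v \<theta>)) \<bullet> (matrix_inv Qn *v St \<omega>)"
      using inner_matrix_transpose[of "?C *v \<theta>" "transpose R" "matrix_inv Qn *v St \<omega>"] by simp
    also have "\<dots> = w \<bullet> St \<omega>"
      unfolding w_def by (rule symmetric_matrixD[OF transpose_matrix_inv[OF Qn_invertible transpose_Qn], symmetric])
    finally show ?thesis .
  qed
  have "6 * P * (norm w * Cs) \<le> 6 * P * (norm \<theta> / sqrt lam * Cs)"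
    using wC by (intro mult_left_mono) auto
  with small have "6 * P * (norm w * Cs) \<le> 1"
    by linarith
  from char_score_bound[OF this L]
  have "norm ((\<integral>\<omega>. iexp (\<theta> \<bullet> Tstat \<omega>) \<partial>M) - of_real (exp (- (norm \<theta>)\<^sup>2 / 2)))
    \<le> (norm \<theta>)\<^sup>2 / (3 * L) + (192 * L * exp (2 * L) + 36 * exp 1) * (N * (2 * P) ^ 3 * (norm w * Cs) ^ 4)"
    by (simp add: T o)
  also have "\<dots> \<le> (norm \<theta>)\<^sup>2 / (3 * L) + (192 * L * exp (2 * L) + 36 * exp 1) * (N * (2 * P) ^ 3 * (norm \<theta> / sqrt lam * Cs) ^ 4)"
    using wC L Cs_nonneg by (intro add_left_mono mult_left_mono power_mono) auto
  finally show ?thesis .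
qed

text \<open>The estimated variance dominates (1 - eps) times the true one, so inverting it inflates
  the true standardised square by at most 1 / (1 - eps); linearisation moves the standardised
  estimator by at most \<open>rem\<close>.\<close>

theorem wald_le:
  assumes model: "\<And>n. n \<in> {1..N} \<Longrightarrow> Y n = \<beta> \<bullet> x n \<omega> + u n \<omega>"
    and good: "good \<omega>" and eps: "eps \<omega> < 1"
  shows "wald R (transpose R *v \<beta>) (ols N (\<lambda>n. x n \<omega>) Y) (jackknife_var G N \<psi> (\<lambda>n. x n \<omega>) Y)
    \<le> (norm (Tstat \<omega>) + rem \<omega>)\<^sup>2 / (1 - eps \<omega>)"
proof -
  interpret J: jackknife_data G N \<psi> "\<lambda>n. x n \<omega>" "\<lambda>n. u n \<omega>" Y \<beta> C_x C_u c Qn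
    by (rule jackknife_data_good[OF good model])
  note eqs = good_eqs[OF good]
  let ?V = "jackknife_var G N \<psi> (\<lambda>n. x n \<omega>) Y" and ?C = "mat_inv_sqrt VR"
  have S: "J.S = St \<omega>" and A: "J.A = At \<omega>"
    by (simp_all add: J.S_def J.A_def eqs)
  define t where "t = transpose R *v J.bh"
  have t: "transpose R *v ols N (\<lambda>n. x n \<omega>) Y - transpose R *v \<beta> = t"
    by (simp add: J.ols_eq t_def matrix_vector_right_distrib del: transpose_matrix_vector)
  have "t \<bullet> (matrix_inv (sandwich R ?V) *v t) \<le> (norm (?C *v t))\<^sup>2 / (1 - eps \<omega>)"
  proof (rule quadratic_form_inverse_le[OF VR_pos_def])
    show "1 - eps \<omega> > 0"
      using eps by simp
    show "(1 - eps \<omega>) * (z \<bullet> (VR *v z)) \<le> z \<bullet> (sandwich R ?V *v z)" for z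
      unfolding sandwich_form by (rule jackknife_conservative[OF model])
  qed
  also have "norm (?C *v t) \<le> norm (Tstat \<omega>) + rem \<omega>"
  proof -
    define z where "z = J.bh - matrix_inv Qn *v St \<omega>"
    have "?C *v t - Tstat \<omega> = ?C *v (transpose R *v z)"
      by (simp add: t_def Tstat_def z_def matrix_vector_mult_diff_distrib del: transpose_matrix_vector)
    moreover have "norm (?C *v (transpose R *v z)) \<le> rem \<omega>"
    proof (rule power2_le_imp_le)
      have "norm (Qn *v z) \<le> a0 \<omega> * (2 / c * norm (St \<omega>))"
        using J.norm_Q_bh_minus_S_le
        by (simp add: z_def matrix_vector_mult_diff_distrib matrix_inv_mult_vector(1)[OF Qn_invertible] S A a0_def)
      then have "(norm (Qn *v z))\<^sup>2 / lam \<le> (a0 \<omega> * (2 / c * norm (St \<omega>)))\<^sup>2 / lam"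
        using lam_pos by (intro divide_right_mono power_mono) auto
      also have "\<dots> = (rem \<omega>)\<^sup>2"
        using lam_pos by (simp add: rem_def power_divide power_mult_distrib)
      finally show "(norm (?C *v (transpose R *v z)))\<^sup>2 \<le> (rem \<omega>)\<^sup>2"
        using norm_standardised_le[of z] by linarith
      show "rem \<omega> \<ge> 0"
        using c_pos lam_pos by (simp add: rem_def a0_def)
    qed
    ultimately show ?thesis
      using norm_triangle_ineq2[of "?C *v t" "Tstat \<omega>"] by simp
  qed
  then have "(norm (?C *v t))\<^sup>2 / (1 - eps \<omega>) \<le> (norm (Tstat \<omega>) + rem \<omega>)\<^sup>2 / (1 - eps \<omega>)"
    using eps by (intro divide_right_mono power_mono) auto
  finally have main: "t \<bullet> (matrix_inv (sandwich R ?V) *v t) \<le> (norm (Tstat \<omega>) + rem \<omega>)\<^sup>2 / (1 - eps \<omega>)" .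
  \<comment> \<open>Covers the default value 0 of \<open>wald\<close>.\<close>
  have "0 \<le> (norm (Tstat \<omega>) + rem \<omega>)\<^sup>2 / (1 - eps \<omega>)"
    using eps by simp
  with main show ?thesis
    unfolding wald_def t by simp
qed

end

section \<open>Probability of the good event\<close>

lemma chebyshev:
  assumes f: "f \<in> borel_measurable M" and b: "\<And>\<omega>. \<bar>f \<omega>\<bar> \<le> b" and t: "t > 0"
    and m: "expectation (\<lambda>\<omega>. (f \<omega>)\<^sup>2) \<le> m"
  shows "prob {\<omega>\<in>space M. t < (f \<omega>)\<^sup>2} \<le> m / t"
proof -
  have b2: "(f \<omega>)\<^sup>2 \<le> b\<^sup>2" for \<omega>
    using power_mono[OF b[of \<omega>] abs_ge_zero, of 2] by simp
  have i: "integrable M (\<lambda>\<omega>. (f \<omega>)\<^sup>2)"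
    using f b2 by (intro integrable_bounded[of _ "b\<^sup>2"]) auto
  have "prob {\<omega>\<in>space M. t < (f \<omega>)\<^sup>2} \<le> prob {\<omega>\<in>space M. t \<le> (f \<omega>)\<^sup>2}"
    using f by (intro finite_measure_mono) auto
  also have "\<dots> \<le> expectation (\<lambda>\<omega>. (f \<omega>)\<^sup>2) / t"
    by (rule integral_Markov_inequality_measure[OF i, of "{}"]) (use t in auto)
  also have "\<dots> \<le> m / t"
    using m t by (intro divide_right_mono) auto
  finally show ?thesis .
qed

lemma eps_nonneg: "eps \<omega> \<ge> 0"
proof -
  have "errt \<omega> \<ge> 0" "h \<omega> \<ge> 0"
    using c_pos Cs_nonneg by (simp_all add: errt_def h_def a0_def)
  then show ?thesis
    using lam_pos by (simp add: eps_def)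
qed

text \<open>\<open>B\<close> is a free cut-off for two quantities living on the scale sqrt(N P);
  \<open>h\<close> is measured against \<open>lam\<close>.\<close>

lemma tails:
  fixes B \<eta> :: real
  assumes B: "B > 0" and \<eta>: "\<eta> > 0"
  shows "prob {\<omega>\<in>space M. B * (N * P) < (a0 \<omega>)\<^sup>2} \<le> 8 * (real CARD('k))\<^sup>2 * C_x ^ 4 / B"
    and "prob {\<omega>\<in>space M. B * (N * P) < (norm (St \<omega>))\<^sup>2} \<le> 8 * real CARD('k) * Cs\<^sup>2 / B"
    and "prob {\<omega>\<in>space M. (\<eta> * lam)\<^sup>2 < (h \<omega>)\<^sup>2} \<le> 128 * (real CARD('k))\<^sup>2 * Cs ^ 4 * (N * P ^ 3 / lam\<^sup>2) / \<eta>\<^sup>2"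
proof -
  have pos: "B * (N * P) > 0" "(\<eta> * lam)\<^sup>2 > 0"
    using B \<eta> N_P_pos lam_pos by auto
  have "\<bar>a0 \<omega>\<bar> \<le> N * (C_x * C_x) + norm Qn" for \<omega>
    using norm_triangle_ineq4[of "At \<omega>" Qn] norm_At_le[of \<omega>] by (simp add: a0_def)
  from chebyshev[OF a0_meas this pos(1) second_moment_At[folded a0_def]]
  show "prob {\<omega>\<in>space M. B * (N * P) < (a0 \<omega>)\<^sup>2} \<le> 8 * (real CARD('k))\<^sup>2 * C_x ^ 4 / B"
    using N_P_pos by (simp add: field_simps)
  have "\<bar>norm (St \<omega>)\<bar> \<le> N * Cs" for \<omega>
    using norm_St_le by simp
  from chebyshev[OF _ this pos(1) second_moment_St]
  show "prob {\<omega>\<in>space M. B * (N * P) < (norm (St \<omega>))\<^sup>2} \<le> 8 * real CARD('k) * Cs\<^sup>2 / B"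
    using N_P_pos by (simp add: field_simps)
  have "\<bar>h \<omega>\<bar> \<le> G * ((N * Cs) * (N * Cs)) + norm K" for \<omega>
    using norm_triangle_ineq4[of "Bt \<omega>" K] norm_Bt_le[of \<omega>] by (simp add: h_def)
  from chebyshev[OF h_meas this pos(2) second_moment_Bt[folded h_def]]
  show "prob {\<omega>\<in>space M. (\<eta> * lam)\<^sup>2 < (h \<omega>)\<^sup>2} \<le> 128 * (real CARD('k))\<^sup>2 * Cs ^ 4 * (N * P ^ 3 / lam\<^sup>2) / \<eta>\<^sup>2"
    by (simp add: power_mult_distrib mult_ac)
qed

lemma sqrt_NP: "sqrt (N * P) * sqrt (N * P) = N * P" "P \<le> sqrt (N * P)"
proof -
  show "sqrt (N * P) * sqrt (N * P) = N * P"
    by simp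
  have "real P * real P \<le> real N * real P"
    using P_le_N by (intro mult_right_mono) auto
  then show "P \<le> sqrt (N * P)"
    by (intro real_le_rsqrt) (simp add: power2_eq_square)
qed

text \<open>Off the tail events all is deterministic. With q = sqrt(N P), both \<open>a0\<close> and
  the norm of \<open>St\<close> are at most sqrt(B) q, and P <= q absorbs the degree term. Since q^2
  / c = P / c_Q, \<open>errt\<close> and the numerator of \<open>rem\<close> are of order P;
  \<open>kB\<close> collects the constants.\<close>

theorem good_event_prob:
  fixes B \<eta> :: real
  assumes B: "B > 0" and \<eta>: "\<eta> > 0"
    and small: "sqrt (B * (P / N)) + C_x\<^sup>2 * (P / N) \<le> c_Q / 2"
  defines "kB \<equiv> sqrt 2 * (2 / c_Q) * ((sqrt B + C_x\<^sup>2) * Cs + 2 * C_x\<^sup>2 * sqrt B)"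
  shows "prob {\<omega>\<in>space M. \<not> (good \<omega> \<and> eps \<omega> \<le> 2 * (\<eta> + P / sqrt lam * kB) + 1 / G \<and> rem \<omega> \<le> P / sqrt lam * (2 * B / c_Q))}
    \<le> (8 * (real CARD('k))\<^sup>2 * C_x ^ 4 + 8 * real CARD('k) * Cs\<^sup>2) / B
      + 128 * (real CARD('k))\<^sup>2 * Cs ^ 4 * (N * P ^ 3 / lam\<^sup>2) / \<eta>\<^sup>2"
proof -
  let ?E1 = "{\<omega>\<in>space M. B * (N * P) < (a0 \<omega>)\<^sup>2}"
  let ?E2 = "{\<omega>\<in>space M. B * (N * P) < (norm (St \<omega>))\<^sup>2}"
  let ?E3 = "{\<omega>\<in>space M. (\<eta> * lam)\<^sup>2 < (h \<omega>)\<^sup>2}"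
  let ?E = "{\<omega>\<in>space M. \<not> (good \<omega> \<and> eps \<omega> \<le> 2 * (\<eta> + P / sqrt lam * kB) + 1 / G \<and> rem \<omega> \<le> P / sqrt lam * (2 * B / c_Q))}"
  define q where "q = sqrt (N * P)"
  have q: "q * q = N * P" "P \<le> q" "q \<ge> 0"
    using sqrt_NP by (auto simp: q_def)
  have sqB: "sqrt (B * (N * P)) = sqrt B * q"
    by (simp add: q_def real_sqrt_mult)
  have sub: "\<omega> \<in> space M - Bd \<union> ?E1 \<union> ?E2 \<union> ?E3" if \<omega>: "\<omega> \<in> ?E" for \<omega>
  proof (rule ccontr)
    assume "\<not> ?thesis"
    with \<omega> have Bd: "\<omega> \<in> Bd" and 1: "(a0 \<omega>)\<^sup>2 \<le> B * (N * P)" and 2: "(norm (St \<omega>))\<^sup>2 \<le> B * (N * P)"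
      and 3: "(h \<omega>)\<^sup>2 \<le> (\<eta> * lam)\<^sup>2"
      by auto
    have a0: "a0 \<omega> \<le> sqrt B * q"
      using real_le_rsqrt[OF 1] sqB by simp
    have S: "norm (St \<omega>) \<le> sqrt B * q"
      using real_le_rsqrt[OF 2] sqB by simp
    have h: "h \<omega> \<le> \<eta> * lam"
      using power2_le_imp_le[OF 3] \<eta> lam_pos by simp
    have a00: "a0 \<omega> \<ge> 0"
      by (simp add: a0_def)
    have "sqrt B * q = sqrt (B * (P / N)) * N"
      using N_P_pos by (simp add: q_def real_sqrt_mult real_sqrt_divide field_simps)
    then have "a0 \<omega> + C_x\<^sup>2 * P \<le> (sqrt (B * (P / N)) + C_x\<^sup>2 * (P / N)) * N"
      using a0 N_P_pos by (simp add: distrib_right)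
    also have "\<dots> \<le> c_Q / 2 * N"
      using small by (rule mult_right_mono) simp
    finally have good: "good \<omega>"
      using Bd by (simp add: good_def c_def)
    have "(a0 \<omega> + C_x\<^sup>2 * P) * Cs + 2 * C_x\<^sup>2 * norm (St \<omega>)
        \<le> (sqrt B * q + C_x\<^sup>2 * q) * Cs + 2 * C_x\<^sup>2 * (sqrt B * q)"
      using a0 S q B Cs_nonneg by (intro add_mono mult_right_mono mult_left_mono) auto
    also have "\<dots> = q * ((sqrt B + C_x\<^sup>2) * Cs + 2 * C_x\<^sup>2 * sqrt B)"
      by (simp add: algebra_simps)
    finally have "errt \<omega> \<le> sqrt (2 * N * P) * (2 / c) * (q * ((sqrt B + C_x\<^sup>2) * Cs + 2 * C_x\<^sup>2 * sqrt B))"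
      unfolding errt_def using c_pos by (intro mult_left_mono) auto
    also have "\<dots> = (q * q) * (sqrt 2 * (2 / c)) * ((sqrt B + C_x\<^sup>2) * Cs + 2 * C_x\<^sup>2 * sqrt B)"
      by (simp add: q_def real_sqrt_mult mult_ac)
    also have "\<dots> = P * kB"
      using N_P_pos unfolding q(1) by (simp add: kB_def c_def field_simps)
    finally have e: "errt \<omega> / sqrt lam \<le> P / sqrt lam * kB"
      using divide_right_mono[of "errt \<omega>" "P * kB" "sqrt lam"] lam_pos by simp
    have "h \<omega> / lam \<le> \<eta>"
      using h lam_pos by (simp add: field_simps)
    with e good have eps: "eps \<omega> \<le> 2 * (\<eta> + P / sqrt lam * kB) + 1 / G"
      by (simp add: eps_def)
    have "a0 \<omega> * (2 / c * norm (St \<omega>)) \<le> (sqrt B * q) * (2 / c * (sqrt B * q))"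
      using a0 S a00 c_pos B q(3) by (intro mult_mono mult_left_mono) auto
    also have "\<dots> = (sqrt B * sqrt B) * (q * q) * (2 / c)"
      by (simp only: mult_ac)
    also have "\<dots> = P * (2 * B / c_Q)"
      using N_P_pos B unfolding q(1) by (simp add: c_def field_simps)
    finally have "rem \<omega> \<le> P / sqrt lam * (2 * B / c_Q)"
      using divide_right_mono[of "a0 \<omega> * (2 / c * norm (St \<omega>))" "P * (2 * B / c_Q)" "sqrt lam"] lam_pos by (simp add: rem_def mult_ac)
    with good eps \<omega> show False
      by simp
  qed
  have sets: "?E1 \<in> events" "?E2 \<in> events" "?E3 \<in> events" "space M - Bd \<in> events"
    using Bd_sets by auto
  have "prob ?E \<le> prob (space M - Bd \<union> ?E1 \<union> ?E2 \<union> ?E3)"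
    using sub sets by (intro finite_measure_mono) auto
  also have "\<dots> \<le> prob (space M - Bd) + prob ?E1 + prob ?E2 + prob ?E3"
    using sets by (intro order.trans[OF measure_Un_le] add_mono) auto
  also have "prob (space M - Bd) = 0"
    using prob_compl[OF Bd_sets] prob_Bd by simp
  finally show ?thesis
    using tails[OF B \<eta>] by (simp add: add_divide_distrib)
qed

text \<open>P / N equals N P^3 / (N P)^2, and \<open>lam_le\<close> allows (N P)^2 to be replaced by
  a multiple of lam^2.\<close>

lemma P_over_N_le: "P / N \<le> 64 * (real CARD('k))\<^sup>2 * Cs ^ 4 * (N * P ^ 3 / lam\<^sup>2)"
proof -
  have "lam\<^sup>2 \<le> (CARD('k) * (8 * Cs\<^sup>2 * (N * P)))\<^sup>2"
    using lam_le lam_pos by (intro power_mono) auto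
  also have "\<dots> = 64 * (real CARD('k))\<^sup>2 * Cs ^ 4 * (real N * real P)\<^sup>2"
    by (simp add: power_mult_distrib)
  finally have "P / N * lam\<^sup>2 \<le> P / N * (64 * (real CARD('k))\<^sup>2 * Cs ^ 4 * (real N * real P)\<^sup>2)"
    by (intro mult_left_mono) auto
  also have "\<dots> = 64 * (real CARD('k))\<^sup>2 * Cs ^ 4 * (N * P ^ 3)"
    using N_P_pos by (simp add: power2_eq_square power3_eq_cube)
  finally show ?thesis
    using lam_pos by (simp add: field_simps)
qed

text \<open>The fourth power of the left side is P^4 / lam^2, which is at most the rate because P <=
  N.\<close>

lemma P_over_sqrt_lam_le: "P / sqrt lam \<le> sqrt (sqrt (N * P ^ 3 / lam\<^sup>2))"
proof -
  have "real P * real P ^ 3 \<le> real N * real P ^ 3"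
    using P_le_N by (intro mult_right_mono) auto
  then have "real P * real P ^ 3 / lam\<^sup>2 \<le> N * P ^ 3 / lam\<^sup>2"
    by (intro divide_right_mono) auto
  moreover have "((real P / sqrt lam)\<^sup>2)\<^sup>2 = real P * real P ^ 3 / lam\<^sup>2"
    using lam_pos by (simp add: power_divide power2_eq_square power3_eq_cube)
  ultimately have "((real P / sqrt lam)\<^sup>2)\<^sup>2 \<le> N * P ^ 3 / lam\<^sup>2"
    by simp
  then show ?thesis
    by (intro real_le_rsqrt)
qed

end

section \<open>Asymptotics\<close>

text \<open>Everything starts at G = 2, the first size that has room for a dyad.\<close>

locale dyadic_sequence =
  fixes M :: "nat \<Rightarrow> 'a measure" and N :: "nat \<Rightarrow> nat" and \<psi> :: "nat \<Rightarrow> nat \<Rightarrow> nat set"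
    and x :: "nat \<Rightarrow> nat \<Rightarrow> 'a \<Rightarrow> real^'k" and u :: "nat \<Rightarrow> nat \<Rightarrow> 'a \<Rightarrow> real"
    and C_x C_u c_Q :: real
  assumes dyadic_model: "G \<ge> 2 \<Longrightarrow> dyadic_model (M G) G (N G) (\<psi> G) (x G) (u G) C_x C_u c_Q"
    and c_Q_pos: "c_Q > 0"
    and rate: "(\<lambda>G. real (N G) * real (max_degree G (N G) (\<psi> G)) ^ 3
              / (lambda_min (Omega_mat (M G) (N G) (x G) (u G)))\<^sup>2) \<longlonglongrightarrow> 0"
begin

definition P where "P G = max_degree G (N G) (\<psi> G)"
definition lam where "lam G = lambda_min (Omega_mat (M G) (N G) (x G) (u G))"
definition \<delta> where "\<delta> G = real (N G * P G ^ 3) / (lam G)\<^sup>2"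
definition Cs where "Cs = C_x * C_u"

abbreviation "good G \<equiv> dyadic_model.good (M G) G (N G) (\<psi> G) (x G) (u G) C_x C_u c_Q"
abbreviation "eps G \<equiv> dyadic_model.eps (M G) G (N G) (\<psi> G) (x G) (u G) C_x C_u c_Q"
abbreviation "rem G \<equiv> dyadic_model.rem (M G) (N G) (x G) (u G) C_x C_u c_Q"

lemma lam_eq: "G \<ge> 2 \<Longrightarrow> dyadic_model.lam (M G) (N G) (x G) (u G) = lam G"
  using dyadic_model.lam_def[OF dyadic_model] dyadic_model.Om_def[OF dyadic_model] by (simp add: lam_def)

lemma Cs_eq: "dyadic_model.Cs C_x C_u = Cs"
  using dyadic_model.Cs_def[OF dyadic_model[of 2]] by (simp add: Cs_def)

lemma prob_space: "G \<ge> 2 \<Longrightarrow> prob_space (M G)"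
  using dyadic_model.axioms(1)[OF dyadic_model] .

lemma \<delta>_tendsto: "\<delta> \<longlonglongrightarrow> 0"
  using rate unfolding \<delta>_def[abs_def] P_def lam_def by simp

lemma P_over_N_tendsto: "(\<lambda>G. P G / N G) \<longlonglongrightarrow> 0"
proof (rule tendsto_sandwich[where f = "\<lambda>_. 0"])
  show "(\<lambda>G. 64 * (real CARD('k))\<^sup>2 * Cs ^ 4 * \<delta> G) \<longlonglongrightarrow> 0"
    using tendsto_mult_left[OF \<delta>_tendsto] by simp
  show "eventually (\<lambda>G. P G / N G \<le> 64 * (real CARD('k))\<^sup>2 * Cs ^ 4 * \<delta> G) sequentially"
    using eventually_ge_at_top[of 2]
  proof eventually_elim
    case (elim G)
    from dyadic_model.P_over_N_le[OF dyadic_model[OF elim]] show ?case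
      unfolding lam_eq[OF elim] Cs_eq by (simp add: \<delta>_def P_def)
  qed
qed auto

lemma P_over_sqrt_lam_tendsto: "(\<lambda>G. P G / sqrt (lam G)) \<longlonglongrightarrow> 0"
proof (rule tendsto_sandwich[where f = "\<lambda>_. 0"])
  show "(\<lambda>G. sqrt (sqrt (\<delta> G))) \<longlonglongrightarrow> 0"
    using tendsto_real_sqrt[OF tendsto_real_sqrt[OF \<delta>_tendsto]] by simp
  show "eventually (\<lambda>G. P G / sqrt (lam G) \<le> sqrt (sqrt (\<delta> G))) sequentially"
    using eventually_ge_at_top[of 2]
  proof eventually_elim
    case (elim G)
    from dyadic_model.P_over_sqrt_lam_le[OF dyadic_model[OF elim]] show ?case
      unfolding lam_eq[OF elim] by (simp add: \<delta>_def P_def)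
  qed
  show "eventually (\<lambda>G. 0 \<le> P G / sqrt (lam G)) sequentially"
    using eventually_ge_at_top[of 2]
  proof eventually_elim
    case (elim G)
    from dyadic_model.lam_pos[OF dyadic_model[OF elim]] show ?case
      unfolding lam_eq[OF elim] by simp
  qed
qed auto

lemma bad_event_negligible:
  assumes e: "e > 0"
  shows "eventually (\<lambda>G. measure (M G) {\<omega>\<in>space (M G). \<not> (good G \<omega> \<and> eps G \<omega> \<le> e \<and> rem G \<omega> \<le> e)} \<le> e) sequentially"
proof -
  let ?k = "real CARD('k)"
  define K1 where "K1 = 8 * ?k\<^sup>2 * C_x ^ 4 + 8 * ?k * Cs\<^sup>2"
  define K2 where "K2 = 128 * ?k\<^sup>2 * Cs ^ 4"
  \<comment> \<open>Makes the Chebyshev part K1 / B at most e / 2; the \<open>+ 1\<close> keeps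
    \<open>B\<close> positive when K1 = 0. \<open>B\<close> is fixed before G grows, so
    \<open>kB\<close> below is a constant.\<close>
  define B where "B = 2 * K1 / e + 1"
  \<comment> \<open>The contribution 2 \<eta> to \<open>eps\<close> is then e / 4, which leaves room
    for the vanishing terms.\<close>
  define \<eta> where "\<eta> = e / 8"
  define kB where "kB = sqrt 2 * (2 / c_Q) * ((sqrt B + C_x\<^sup>2) * Cs + 2 * C_x\<^sup>2 * sqrt B)"
  have K1: "K1 \<ge> 0"
    by (simp add: K1_def)
  then have B: "B > 0"
    using e by (simp add: B_def add_nonneg_pos)
  have \<eta>: "\<eta> > 0"
    using e by (simp add: \<eta>_def)
  have K1B: "K1 / B \<le> e / 2"
    using K1 e B by (simp add: B_def field_simps)
  have "(\<lambda>G. sqrt (B * (P G / N G)) + C_x\<^sup>2 * (P G / N G)) \<longlonglongrightarrow> sqrt (B * 0) + C_x\<^sup>2 * 0"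
    by (intro tendsto_intros P_over_N_tendsto)
  then have 1: "eventually (\<lambda>G. sqrt (B * (P G / N G)) + C_x\<^sup>2 * (P G / N G) < c_Q / 2) sequentially"
    by (rule order_tendstoD(2)) (use c_Q_pos in simp)
  have "(\<lambda>G. 2 * (\<eta> + P G / sqrt (lam G) * kB) + 1 / real G) \<longlonglongrightarrow> 2 * (\<eta> + 0 * kB) + 0"
    by (intro tendsto_intros P_over_sqrt_lam_tendsto lim_1_over_n)
  then have 2: "eventually (\<lambda>G. 2 * (\<eta> + P G / sqrt (lam G) * kB) + 1 / real G < e) sequentially"
    by (rule order_tendstoD(2)) (use e in \<open>simp add: \<eta>_def\<close>)
  have "(\<lambda>G. P G / sqrt (lam G) * (2 * B / c_Q)) \<longlonglongrightarrow> 0 * (2 * B / c_Q)"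
    by (intro tendsto_intros P_over_sqrt_lam_tendsto)
  then have 3: "eventually (\<lambda>G. P G / sqrt (lam G) * (2 * B / c_Q) < e) sequentially"
    by (rule order_tendstoD(2)) (use e in simp)
  have "(\<lambda>G. K2 * \<delta> G / \<eta>\<^sup>2) \<longlonglongrightarrow> K2 * 0 / \<eta>\<^sup>2"
    using \<eta> by (intro tendsto_intros \<delta>_tendsto) auto
  then have 4: "eventually (\<lambda>G. K2 * \<delta> G / \<eta>\<^sup>2 < e / 2) sequentially"
    by (rule order_tendstoD(2)) (use e in simp)
  show ?thesis
    using 1 2 3 4 eventually_ge_at_top[of 2]
  proof eventually_elim
    case (elim G)
    interpret D: dyadic_model "M G" G "N G" "\<psi> G" "x G" "u G" C_x C_u c_Q
      by (rule dyadic_model) (use elim in simp)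
    note eqs = lam_eq[OF elim(5)] Cs_eq
    let ?E = "{\<omega>\<in>space (M G). \<not> (good G \<omega> \<and> eps G \<omega> \<le> 2 * (\<eta> + P G / sqrt (lam G) * kB) + 1 / G
        \<and> rem G \<omega> \<le> P G / sqrt (lam G) * (2 * B / c_Q))}"
    have "D.prob ?E \<le> K1 / B + K2 * \<delta> G / \<eta>\<^sup>2"
      using D.good_event_prob[OF B \<eta>] elim(1) unfolding eqs
      by (simp add: K1_def K2_def kB_def \<delta>_def P_def)
    also have "\<dots> \<le> e"
      using K1B elim(4) by linarith
    finally have "D.prob ?E \<le> e" .
    moreover have "D.prob {\<omega>\<in>space (M G). \<not> (good G \<omega> \<and> eps G \<omega> \<le> e \<and> rem G \<omega> \<le> e)} \<le> D.prob ?E"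
    proof (rule D.finite_measure_mono)
      show "?E \<in> D.events"
        by measurable
    qed (use elim in auto)
    ultimately show ?case
      by linarith
  qed
qed

lemma eps_small_o_p: "small_o_p_one M eps"
  unfolding small_o_p_one_def
proof (intro allI impI LIMSEQ_I)
  fix \<eta> r :: real assume "\<eta> > 0" "r > 0"
  \<comment> \<open>One number serves both as a level within the threshold \<eta> and as a
    probability below r.\<close>
  define e where "e = min \<eta> (r / 2)"
  have e: "e > 0" "e \<le> \<eta>" "e < r"
    using \<open>\<eta> > 0\<close> \<open>r > 0\<close> by (auto simp: e_def)
  have "eventually (\<lambda>G. norm (measure (M G) {\<omega>\<in>space (M G). \<bar>eps G \<omega>\<bar> > \<eta>} - 0) < r) sequentially"
    using bad_event_negligible[OF e(1)] eventually_ge_at_top[of 2]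
  proof eventually_elim
    case (elim G)
    interpret D: dyadic_model "M G" G "N G" "\<psi> G" "x G" "u G" C_x C_u c_Q
      by (rule dyadic_model) (use elim in simp)
    have "D.prob {\<omega>\<in>space (M G). \<bar>eps G \<omega>\<bar> > \<eta>}
        \<le> D.prob {\<omega>\<in>space (M G). \<not> (good G \<omega> \<and> eps G \<omega> \<le> e \<and> rem G \<omega> \<le> e)}"
    proof (rule D.finite_measure_mono)
      show "{\<omega>\<in>space (M G). \<not> (good G \<omega> \<and> eps G \<omega> \<le> e \<and> rem G \<omega> \<le> e)} \<in> D.events"
        by measurable
    qed (use D.eps_nonneg e in \<open>auto simp: abs_of_nonneg\<close>)
    then show ?case
      using elim(1) e by simp
  qed
  then show "\<exists>no. \<forall>G\<ge>no. norm (measure (M G) {\<omega>\<in>space (M G). \<bar>eps G \<omega>\<bar> > \<eta>} - 0) < r"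
    unfolding eventually_sequentially .
qed

abbreviation T :: "(nat \<Rightarrow> real^'q^'k) \<Rightarrow> nat \<Rightarrow> 'a \<Rightarrow> real^'q" where
  "T R G \<equiv> dyadic_model.Tstat (M G) (N G) (x G) (u G) C_x C_u (R G)"

lemma char_T_tendsto:
  fixes R :: "nat \<Rightarrow> real^'q^'k"
  assumes R: "\<And>G. G \<ge> 2 \<Longrightarrow> rank (R G) = CARD('q)"
  shows "(\<lambda>G. \<integral>\<omega>. iexp (\<theta> \<bullet> T R G \<omega>) \<partial>M G) \<longlonglongrightarrow> of_real (exp (- (norm \<theta>)\<^sup>2 / 2))"
proof (rule LIMSEQ_I)
  fix r :: real assume r: "r > 0"
  \<comment> \<open>Chosen so that the term with 3 L in its denominator is below r / 2. Only
    afterwards, with \<open>L\<close> fixed, does \<delta> drive the other term to zero.\<close>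
  define L where "L = 2 * (norm \<theta>)\<^sup>2 / (3 * r) + 1"
  have L: "L > 0"
    using r by (simp add: L_def add_nonneg_pos)
  have L2: "(norm \<theta>)\<^sup>2 / (3 * L) < r / 2"
    using r L by (simp add: L_def field_simps)
  \<comment> \<open>The 8 is the cube of the 2 in D = 2 P.\<close>
  define K where "K = (192 * L * exp (2 * L) + 36 * exp 1) * (8 * (norm \<theta> * Cs) ^ 4)"
  have "(\<lambda>G. K * \<delta> G) \<longlonglongrightarrow> K * 0"
    by (intro tendsto_intros \<delta>_tendsto)
  then have 1: "eventually (\<lambda>G. K * \<delta> G < r / 2) sequentially"
    by (rule order_tendstoD(2)) (use r in simp)
  have "(\<lambda>G. 6 * (norm \<theta> * Cs) * (P G / sqrt (lam G))) \<longlonglongrightarrow> 6 * (norm \<theta> * Cs) * 0"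
    by (intro tendsto_intros P_over_sqrt_lam_tendsto)
  then have 2: "eventually (\<lambda>G. 6 * (norm \<theta> * Cs) * (P G / sqrt (lam G)) < 1) sequentially"
    by (rule order_tendstoD(2)) simp
  have "eventually (\<lambda>G. norm ((\<integral>\<omega>. iexp (\<theta> \<bullet> T R G \<omega>) \<partial>M G) - of_real (exp (- (norm \<theta>)\<^sup>2 / 2))) < r) sequentially"
    using 1 2 eventually_ge_at_top[of 2]
  proof eventually_elim
    case (elim G)
    interpret D: dyadic_model "M G" G "N G" "\<psi> G" "x G" "u G" C_x C_u c_Q
      by (rule dyadic_model) (use elim in simp)
    note eqs = lam_eq[OF elim(3)] Cs_eq
    have lam: "lam G > 0"
      using D.lam_pos unfolding eqs .
    have "6 * D.P * (norm \<theta> / sqrt D.lam * D.Cs) \<le> 1"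
      using elim(2) unfolding eqs by (simp add: P_def mult_ac)
    from D.char_Tstat_bound[OF R[OF elim(3)] this L]
    have "norm ((\<integral>\<omega>. iexp (\<theta> \<bullet> T R G \<omega>) \<partial>M G) - of_real (exp (- (norm \<theta>)\<^sup>2 / 2)))
      \<le> (norm \<theta>)\<^sup>2 / (3 * L) + (192 * L * exp (2 * L) + 36 * exp 1) * (real (N G * (2 * P G) ^ 3) * (norm \<theta> / sqrt (lam G) * Cs) ^ 4)"
      unfolding eqs by (simp add: P_def)
    also have "real (N G * (2 * P G) ^ 3) * (norm \<theta> / sqrt (lam G) * Cs) ^ 4 = 8 * (norm \<theta> * Cs) ^ 4 * \<delta> G"
    proof -
      have "sqrt (lam G) ^ 4 = (lam G)\<^sup>2"
        using lam power_mult[of "sqrt (lam G)" 2 2] by simp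
      then show ?thesis
        by (simp add: \<delta>_def power_mult_distrib power_divide)
    qed
    finally show ?case
      using elim(1) L2 by (simp add: K_def mult.assoc)
  qed
  then show "\<exists>no. \<forall>G\<ge>no. norm ((\<integral>\<omega>. iexp (\<theta> \<bullet> T R G \<omega>) \<partial>M G) - of_real (exp (- (norm \<theta>)\<^sup>2 / 2))) < r"
    unfolding eventually_sequentially .
qed

lemma tail_T:
  fixes R :: "nat \<Rightarrow> real^'q^'k"
  assumes R: "\<And>G. G \<ge> 2 \<Longrightarrow> rank (R G) = CARD('q)" and "c1 < c2" "e > 0"
  shows "eventually (\<lambda>G. measure (M G) {\<omega>\<in>space (M G). c2 \<le> (norm (T R G \<omega>))\<^sup>2} \<le> 1 - cdf (chi_square CARD('q)) c1 + e) sequentially"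
proof -
  \<comment> \<open>The shift by 2 is needed because \<open>norm_sq_tail_le\<close> asks for a
    probability space at every index.\<close>
  have "eventually (\<lambda>n. measure (M (n + 2)) {\<omega>\<in>space (M (n + 2)). c2 \<le> (norm (T R (n + 2) \<omega>))\<^sup>2}
      \<le> 1 - cdf (chi_square CARD('q)) c1 + e) sequentially"
  proof (rule norm_sq_tail_le[OF _ _ _ assms(2,3)])
    show "prob_space (M (n + 2))" for n
      by (rule prob_space) simp
    show "T R (n + 2) \<in> borel_measurable (M (n + 2))" for n
      by (rule dyadic_model.Tstat_meas[OF dyadic_model]) (use R in simp_all)
    show "(\<lambda>n. \<integral>\<omega>. iexp (\<theta> \<bullet> T R (n + 2) \<omega>) \<partial>M (n + 2)) \<longlonglongrightarrow> of_real (exp (- (norm \<theta>)\<^sup>2 / 2))" for \<theta>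
      by (rule LIMSEQ_ignore_initial_segment[OF char_T_tendsto[OF R]])
  qed
  then show ?thesis
    by (rule eventually_sequentially_seg[THEN iffD1])
qed

text \<open>Slack is spent along c < c2 < Q: the gap below c2 pays for the continuous test function
  in the tail bound, the gap below Q for \<open>eps\<close> and \<open>rem\<close>.\<close>

lemma wald_limsup_le:
  fixes R :: "nat \<Rightarrow> real^'q^'k"
  assumes R: "\<And>G. G \<ge> 2 \<Longrightarrow> rank (R G) = CARD('q)" and \<gamma>: "\<gamma> \<in> {0<..<1}"
    and y: "\<And>G n \<omega>. G \<ge> 2 \<Longrightarrow> n \<in> {1..N G} \<Longrightarrow> \<omega> \<in> space (M G) \<Longrightarrow> y G n \<omega> = \<beta> G \<bullet> x G n \<omega> + u G n \<omega>"
    and r: "\<And>G. G \<ge> 2 \<Longrightarrow> transpose (R G) *v \<beta> G = r G"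
  defines "Wald \<equiv> \<lambda>G \<omega>. wald (R G) (r G) (ols (N G) (\<lambda>n. x G n \<omega>) (\<lambda>n. y G n \<omega>))
      (jackknife_var G (N G) (\<psi> G) (\<lambda>n. x G n \<omega>) (\<lambda>n. y G n \<omega>))"
  shows "limsup (\<lambda>G. ereal (measure (M G) {\<omega>\<in>space (M G). Wald G \<omega> > chi_square_quantile CARD('q) (1 - \<gamma>)})) \<le> ereal \<gamma>"
proof (rule ereal_le_epsilon2)
  fix e :: real assume e: "e > 0"
  define Q where "Q = chi_square_quantile CARD('q) (1 - \<gamma>)"
  obtain c where c: "0 \<le> c" "c < Q" "1 - cdf (chi_square CARD('q)) c \<le> \<gamma> + e / 3"
    unfolding Q_def by (rule chi_square_quantile_tail[of "CARD('q)" \<gamma> "e / 3"]) (use \<gamma> e in auto)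
  define c2 where "c2 = (c + Q) / 2"
  have c2: "c < c2" "c2 < Q" "0 \<le> c2"
    using c by (auto simp: c2_def)
  \<comment> \<open>At t = 0 the expression is sqrt(Q) > sqrt(c2), so by continuity some small
    positive t still works; t bounds \<open>eps\<close>, \<open>rem\<close> and the bad probability
    at once.\<close>
  have "((\<lambda>t. sqrt ((1 - t) * Q) - t) \<longlongrightarrow> sqrt ((1 - 0) * Q) - 0) (at_right 0)"
    by (intro tendsto_intros)
  then have "eventually (\<lambda>t. sqrt c2 < sqrt ((1 - t) * Q) - t) (at_right 0)"
    using c2 by (intro order_tendstoD(1)) auto
  moreover have "eventually (\<lambda>t. t < min 1 (e / 3)) (at_right (0::real))"
    using e by (intro order_tendstoD(2)[OF tendsto_ident_at]) auto
  moreover have "eventually (\<lambda>t. 0 < t) (at_right (0::real))"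
    by (rule eventually_at_right_less)
  ultimately have "eventually (\<lambda>t. sqrt c2 < sqrt ((1 - t) * Q) - t \<and> t < min 1 (e / 3) \<and> 0 < t) (at_right 0)"
    by eventually_elim simp
  then have "\<exists>t. sqrt c2 < sqrt ((1 - t) * Q) - t \<and> t < min 1 (e / 3) \<and> 0 < t"
    by (rule eventually_happens'[rotated]) simp
  then obtain t where t: "sqrt c2 < sqrt ((1 - t) * Q) - t" "t < 1" "t < e / 3" "0 < t"
    by auto
  have tail: "eventually (\<lambda>G. measure (M G) {\<omega>\<in>space (M G). c2 \<le> (norm (T R G \<omega>))\<^sup>2}
      \<le> 1 - cdf (chi_square CARD('q)) c + e / 3) sequentially"
    by (rule tail_T) (use R c2 e in auto)
  have "eventually (\<lambda>G. measure (M G) {\<omega>\<in>space (M G). Wald G \<omega> > Q} \<le> \<gamma> + e) sequentially"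
    using bad_event_negligible[OF t(4)] tail eventually_ge_at_top[of 2]
  proof eventually_elim
    case (elim G)
    interpret D: dyadic_model "M G" G "N G" "\<psi> G" "x G" "u G" C_x C_u c_Q
      by (rule dyadic_model) (use elim in simp)
    let ?bad = "{\<omega>\<in>space (M G). \<not> (good G \<omega> \<and> eps G \<omega> \<le> t \<and> rem G \<omega> \<le> t)}"
    let ?tail = "{\<omega>\<in>space (M G). c2 \<le> (norm (T R G \<omega>))\<^sup>2}"
    have sets: "?bad \<in> D.events" "?tail \<in> D.events"
      using D.Tstat_meas[OF R[OF elim(3)]] by measurable
    \<comment> \<open>A large Wald statistic forces either a failed error bound or a large
      linearised statistic.\<close>
    have "\<omega> \<in> ?bad \<union> ?tail" if \<omega>: "\<omega> \<in> space (M G)" "Wald G \<omega> > Q" for \<omega>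
    proof (rule ccontr)
      assume "\<not> ?thesis"
      with \<omega> have good: "good G \<omega>" and eps: "eps G \<omega> \<le> t" and rem: "rem G \<omega> \<le> t"
        and T: "(norm (T R G \<omega>))\<^sup>2 < c2"
        by auto
      have rem0: "rem G \<omega> \<ge> 0"
        using D.c_pos D.lam_pos by (simp add: D.rem_def D.a0_def)
      have "Wald G \<omega> \<le> (norm (T R G \<omega>) + rem G \<omega>)\<^sup>2 / (1 - eps G \<omega>)"
        unfolding Wald_def r[OF elim(3), symmetric]
        by (rule D.wald_le[OF R[OF elim(3)] y[OF elim(3)]]) (use \<omega> good eps t in auto)
      also have "\<dots> \<le> (norm (T R G \<omega>) + t)\<^sup>2 / (1 - t)"
        using rem rem0 eps t by (intro frac_le power_mono) auto
      finally have "Q < (norm (T R G \<omega>) + t)\<^sup>2 / (1 - t)"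
        using \<omega>(2) by linarith
      then have "(1 - t) * Q < (norm (T R G \<omega>) + t)\<^sup>2"
        using t by (simp add: field_simps)
      then have "sqrt ((1 - t) * Q) < norm (T R G \<omega>) + t"
        using t by (intro real_less_lsqrt) auto
      with t(1) have "sqrt c2 < norm (T R G \<omega>)"
        by linarith
      moreover have "norm (T R G \<omega>) \<le> sqrt c2"
        using T by (intro real_le_rsqrt) simp
      ultimately show False
        by simp
    qed
    then have "D.prob {\<omega>\<in>space (M G). Wald G \<omega> > Q} \<le> D.prob (?bad \<union> ?tail)"
      using sets by (intro D.finite_measure_mono) auto
    also have "\<dots> \<le> D.prob ?bad + D.prob ?tail"
      using sets by (rule measure_Un_le)
    also have "\<dots> \<le> t + (\<gamma> + e / 3 + e / 3)"
      using elim(1,2) c(3) e by (intro add_mono) auto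
    finally show ?case
      using t by simp
  qed
  then have "limsup (\<lambda>G. ereal (measure (M G) {\<omega>\<in>space (M G). Wald G \<omega> > Q})) \<le> ereal (\<gamma> + e)"
    by (intro Limsup_bounded) (auto elim: eventually_mono)
  then show "limsup (\<lambda>G. ereal (measure (M G) {\<omega>\<in>space (M G). Wald G \<omega> > chi_square_quantile CARD('q) (1 - \<gamma>)})) \<le> ereal \<gamma> + ereal e"
    by (simp add: Q_def)
qed

end

theorem proposition1:
  fixes M :: "nat \<Rightarrow> 'a measure"
    and N :: "nat \<Rightarrow> nat"
    and \<psi> :: "nat \<Rightarrow> nat \<Rightarrow> nat set"
    and \<beta> :: "nat \<Rightarrow> real^'k"
    and x :: "nat \<Rightarrow> nat \<Rightarrow> 'a \<Rightarrow> real^'k"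
    and u y :: "nat \<Rightarrow> nat \<Rightarrow> 'a \<Rightarrow> real"
    and C_x C_u c_Q :: real
  assumes prob: "\<And>G. G \<ge> 2 \<Longrightarrow> prob_space (M G)"
    and support: "\<And>G n. G \<ge> 2 \<Longrightarrow> n \<in> {1..N G} \<Longrightarrow> \<psi> G n \<subseteq> {1..G} \<and> card (\<psi> G n) = 2"
    and meas_x: "\<And>G n. G \<ge> 2 \<Longrightarrow> n \<in> {1..N G} \<Longrightarrow> x G n \<in> borel_measurable (M G)"
    and meas_u: "\<And>G n. G \<ge> 2 \<Longrightarrow> n \<in> {1..N G} \<Longrightarrow> u G n \<in> borel_measurable (M G)"
    and model: "\<And>G n \<omega>. G \<ge> 2 \<Longrightarrow> n \<in> {1..N G} \<Longrightarrow> \<omega> \<in> space (M G) \<Longrightarrow>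
        y G n \<omega> = \<beta> G \<bullet> x G n \<omega> + u G n \<omega>"
    and dyadic_dependence: "\<And>G S1 S2. G \<ge> 2 \<Longrightarrow> S1 \<subseteq> {1..N G} \<Longrightarrow> S2 \<subseteq> {1..N G} \<Longrightarrow>
        S1 \<inter> S2 = {} \<Longrightarrow> (\<forall>n\<in>S1. \<forall>m\<in>S2. \<psi> G n \<inter> \<psi> G m = {}) \<Longrightarrow>
        prob_space.indep_var (M G)
          (Pi\<^sub>M S1 (\<lambda>_. borel)) (\<lambda>\<omega>. \<lambda>n\<in>S1. (x G n \<omega>, u G n \<omega>))
          (Pi\<^sub>M S2 (\<lambda>_. borel)) (\<lambda>\<omega>. \<lambda>m\<in>S2. (x G m \<omega>, u G m \<omega>))"
    and bounded_x: "\<And>G n. G \<ge> 2 \<Longrightarrow> n \<in> {1..N G} \<Longrightarrow> AE \<omega> in M G. norm (x G n \<omega>) \<le> C_x"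
    and bounded_u: "\<And>G n. G \<ge> 2 \<Longrightarrow> n \<in> {1..N G} \<Longrightarrow> AE \<omega> in M G. \<bar>u G n \<omega>\<bar> \<le> C_u"
    and exogeneity: "\<And>G n. G \<ge> 2 \<Longrightarrow> n \<in> {1..N G} \<Longrightarrow>
        integral\<^sup>L (M G) (\<lambda>\<omega>. u G n \<omega> *\<^sub>R x G n \<omega>) = 0"
    and c_Q_pos: "c_Q > 0"
    and identification: "\<And>G. G \<ge> 2 \<Longrightarrow> lambda_min (Q_mat (M G) (N G) (x G)) \<ge> c_Q"
    and Omega_pos_def: "\<And>G. G \<ge> 2 \<Longrightarrow> pos_def (Omega_mat (M G) (N G) (x G) (u G))"
    and variance_accumulation:
      "(\<lambda>G. real (N G) * real (max_degree G (N G) (\<psi> G)) ^ 3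
              / (lambda_min (Omega_mat (M G) (N G) (x G) (u G)))\<^sup>2) \<longlonglongrightarrow> 0"
    and configuration: "eventually (\<lambda>G. min_degree G (N G) (\<psi> G) \<ge> 1) sequentially"
  shows
    "(\<exists>\<epsilon> :: nat \<Rightarrow> 'a \<Rightarrow> real.
        (\<forall>G\<ge>2. \<epsilon> G \<in> borel_measurable (M G)) \<and> small_o_p_one M \<epsilon> \<and>
        (\<forall>R :: nat \<Rightarrow> real^'q^'k. (\<forall>G\<ge>2. rank (R G) = CARD('q)) \<longrightarrow>
          (\<forall>G\<ge>2. \<forall>\<omega>\<in>space (M G).
             lambda_min
               (mat_inv_sqrt (sandwich (R G) (V_mat (M G) (N G) (x G) (u G)))
                ** sandwich (R G)
                     (jackknife_var G (N G) (\<psi> G) (\<lambda>n. x G n \<omega>) (\<lambda>n. y G n \<omega>))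
                ** mat_inv_sqrt (sandwich (R G) (V_mat (M G) (N G) (x G) (u G))))
             \<ge> 1 - \<epsilon> G \<omega>)))
     \<and>
     (\<forall>(R :: nat \<Rightarrow> real^'q^'k) (r :: nat \<Rightarrow> real^'q) \<gamma> :: real.
        (\<forall>G\<ge>2. rank (R G) = CARD('q)) \<longrightarrow>
        (\<forall>G\<ge>2. transpose (R G) *v \<beta> G = r G) \<longrightarrow>
        \<gamma> \<in> {0<..<1} \<longrightarrow>
        limsup (\<lambda>G. ereal (measure (M G)
          {\<omega> \<in> space (M G).
             wald (R G) (r G)
               (ols (N G) (\<lambda>n. x G n \<omega>) (\<lambda>n. y G n \<omega>))
               (jackknife_var G (N G) (\<psi> G) (\<lambda>n. x G n \<omega>) (\<lambda>n. y G n \<omega>))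
             > chi_square_quantile CARD('q) (1 - \<gamma>)}))
        \<le> ereal \<gamma>)"
proof -
  \<comment> \<open>Absolute values provide the nonnegative bounds required by the locale, since the
    hypotheses do not fix the signs of the constants.\<close>
  interpret dyadic_sequence M N \<psi> x u "\<bar>C_x\<bar>" "\<bar>C_u\<bar>" c_Q
  proof (rule dyadic_sequence.intro)
    fix G :: nat assume G: "G \<ge> 2"
    interpret prob_space "M G"
      by (rule prob[OF G])
    show "dyadic_model (M G) G (N G) (\<psi> G) (x G) (u G) \<bar>C_x\<bar> \<bar>C_u\<bar> c_Q"
    proof unfold_locales
      fix n assume n: "n \<in> {1..N G}"
      show "\<psi> G n \<subseteq> {1..G} \<and> card (\<psi> G n) = 2"
        by (rule support[OF G n])
      show "AE \<omega> in M G. norm (x G n \<omega>) \<le> \<bar>C_x\<bar>"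
        using bounded_x[OF G n] by eventually_elim linarith
      show "AE \<omega> in M G. \<bar>u G n \<omega>\<bar> \<le> \<bar>C_u\<bar>"
        using bounded_u[OF G n] by eventually_elim linarith
    next
      fix S1 S2 assume "S1 \<subseteq> {1..N G}" "S2 \<subseteq> {1..N G}" "S1 \<inter> S2 = {}" "\<forall>n\<in>S1. \<forall>m\<in>S2. \<psi> G n \<inter> \<psi> G m = {}"
      then show "indep_var (Pi\<^sub>M S1 (\<lambda>_. borel)) (\<lambda>\<omega>. \<lambda>n\<in>S1. (x G n \<omega>, u G n \<omega>))
          (Pi\<^sub>M S2 (\<lambda>_. borel)) (\<lambda>\<omega>. \<lambda>m\<in>S2. (x G m \<omega>, u G m \<omega>))"
        by (rule dyadic_dependence[OF G])
    qed (use G meas_x meas_u exogeneity c_Q_pos identification Omega_pos_def in auto)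
  qed (use c_Q_pos variance_accumulation in auto)
  show ?thesis
  proof (intro conjI exI[of _ eps] allI impI ballI)
    show "eps G \<in> borel_measurable (M G)" if "G \<ge> 2" for G
      by (rule dyadic_model.eps_meas[OF dyadic_model[OF that]])
    show "small_o_p_one M eps"
      by (rule eps_small_o_p)
    fix R :: "nat \<Rightarrow> real^'q^'k" and G \<omega>
    assume R: "\<forall>G\<ge>2. rank (R G) = CARD('q)" and G: "G \<ge> 2" and \<omega>: "\<omega> \<in> space (M G)"
    interpret D: dyadic_model "M G" G "N G" "\<psi> G" "x G" "u G" "\<bar>C_x\<bar>" "\<bar>C_u\<bar>" c_Q
      by (rule dyadic_model[OF G])
    show "lambda_min
       (mat_inv_sqrt (sandwich (R G) (V_mat (M G) (N G) (x G) (u G)))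
        ** sandwich (R G) (jackknife_var G (N G) (\<psi> G) (\<lambda>n. x G n \<omega>) (\<lambda>n. y G n \<omega>))
        ** mat_inv_sqrt (sandwich (R G) (V_mat (M G) (N G) (x G) (u G)))) \<ge> 1 - eps G \<omega>"
    proof (rule lambda_min_standardised_ge[OF D.VR_pos_def transpose_sandwich[OF transpose_jackknife_var]])
      show "rank (R G) = CARD('q)"
        using R G by blast
      show "(1 - eps G \<omega>) * (z \<bullet> (sandwich (R G) (V_mat (M G) (N G) (x G) (u G)) *v z))
          \<le> z \<bullet> (sandwich (R G) (jackknife_var G (N G) (\<psi> G) (\<lambda>n. x G n \<omega>) (\<lambda>n. y G n \<omega>)) *v z)" for z
        unfolding sandwich_form by (rule D.jackknife_conservative[OF model[OF G _ \<omega>]])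
    qed
  next
    fix R :: "nat \<Rightarrow> real^'q^'k" and r :: "nat \<Rightarrow> real^'q" and \<gamma> :: real
    assume "\<forall>G\<ge>2. rank (R G) = CARD('q)" "\<forall>G\<ge>2. transpose (R G) *v \<beta> G = r G" "\<gamma> \<in> {0<..<1}"
    then show "limsup (\<lambda>G. ereal (measure (M G) {\<omega> \<in> space (M G).
        wald (R G) (r G) (ols (N G) (\<lambda>n. x G n \<omega>) (\<lambda>n. y G n \<omega>))
          (jackknife_var G (N G) (\<psi> G) (\<lambda>n. x G n \<omega>) (\<lambda>n. y G n \<omega>))
          > chi_square_quantile CARD('q) (1 - \<gamma>)})) \<le> ereal \<gamma>"
      by (intro wald_limsup_le[where \<beta> = \<beta>] model) auto
  qed
qed

end
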